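(* Let $\tilde u\in L^\infty(\mathbb{R}\times\mathbb{R}_+)$ be a weak solution to $$\Big(\frac1{\tilde u}\Big)_t-\big(\tilde a\,\tilde v(\tilde u)\big)_y=0,\qquad \tilde u(y,0)=\tilde u_0(y).$$ Let the map $T$ be defined by $$T:\mathbb{R}\times\mathbb{R}_+\to \mathrm{Im}(y)\times\mathbb{R}_+,\qquad (x,t)\mapsto(y(x,t),\bar t(x,t)),$$ where $y(x,t)=\int_{x(t)}^x\rho(z,t)\,dz$ and $\bar t(x,t)=t$, with $\rho=\tilde u\circ T$, and where $x(t)$ is a vehicle trajectory satisfying $\frac{\partial}{\partial t}x(t)=a(x(t))\,v(\rho(x(t),t))$. Assume that $0<\delta\le\rho(x,t)\le1$ for all $(x,t)\in\mathbb{R}\times\mathbb{R}_+$, that $v(\rho)>0$ for $\rho>0$, and that $v\in L^\infty((\delta,1])$ is Lipschitz continuous. Assume also that $a\in L^\infty(\mathbb{R})$ is Lipschitz continuous and $a>0$. Let $\tilde a=a\circ T^{-1}$, $\tilde v=v\circ T^{-1}$ and $\tilde u_0=u_0\circ T^{-1}$. Then $u=\tilde u\circ T$ is a weak solution to $$u_t+(a(x)v(u)u)_x=0,\qquad u(x,0)=u_0(x).$$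
   Context: Here $x$ is the Eulerian (position) coordinate and $y$ the Lagrangian (mass) coordinate. The compositions with $T^{-1}$ are understood as expressing a quantity given in Eulerian coordinates $(x,t)$ in Lagrangian coordinates: $\tilde a(y,t)=a(x)$ whenever $(y,t)=T(x,t)$; $\tilde v(\tilde u)=v(u)\circ T^{-1}$, i.e. $\tilde v(\tilde u)(y,t)=v(\tilde u(y,t))$; and $\tilde u_0(y)=u_0(x)$ whenever $(y,0)=T(x,0)$. Weak solutions are in the distributional sense with the initial datum included: for $D_t-(G)_y=0$, $D(y,0)=D_0(y)$ this means $\int_0^\infty\int_{\mathbb{R}}(\phi_tD-\phi_yG)\,dy\,dt+\int_{\mathbb{R}}\phi(y,0)D_0(y)\,dy=0$ for all smooth compactly supported test functions $\phi$ on $\mathbb{R}\times\mathbb{R}_+$, where $\mathbb{R}_+=[0,\infty)$.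
   Formalization: The value v(ρ(x(t),t)) in the trajectory equation is required to be a one-sided strong L¹ trace of v(ρ) along x(t), since otherwise changing ũ on the null set y=0 makes the claim false; the equation is taken for almost every t. *)

theory Defs
  imports "HOL-Analysis.Analysis"
begin

text \<open>
  Points of the plane are pairs (space, time); only their values on
  \<open>UNIV \<times> {0..}\<close>, i.e. for time \<open>\<ge> 0\<close>, matter for functions on the half-plane.
\<close>

definition Linfty_on :: "'a::euclidean_space set \<Rightarrow> ('a \<Rightarrow> real) \<Rightarrow> bool" where
  "Linfty_on S f \<longleftrightarrow>
     f \<in> borel_measurable (lebesgue_on S) \<and> (\<exists>C. AE z in lebesgue_on S. \<bar>f z\<bar> \<le> C)"

definition loc_integrable_on :: "'a::euclidean_space set \<Rightarrow> ('a \<Rightarrow> real) \<Rightarrow> bool" where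
  "loc_integrable_on S f \<longleftrightarrow> (\<forall>K. compact K \<and> K \<subseteq> S \<longrightarrow> set_integrable lebesgue K f)"

definition dx :: "(real \<times> real \<Rightarrow> real) \<Rightarrow> real \<times> real \<Rightarrow> real" where
  "dx \<phi> = (\<lambda>(x, t). deriv (\<lambda>s. \<phi> (s, t)) x)"

definition dt :: "(real \<times> real \<Rightarrow> real) \<Rightarrow> real \<times> real \<Rightarrow> real" where
  "dt \<phi> = (\<lambda>(x, t). deriv (\<lambda>s. \<phi> (x, s)) t)"

fun Ck :: "nat \<Rightarrow> (real \<times> real \<Rightarrow> real) \<Rightarrow> bool" where
  "Ck 0 \<phi> \<longleftrightarrow> continuous_on UNIV \<phi>"
| "Ck (Suc k) \<phi> \<longleftrightarrow> \<phi> differentiable_on UNIV \<and> Ck k (dx \<phi>) \<and> Ck k (dt \<phi>)"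

text \<open>
  Smooth compactly supported test functions on \<open>\<real> \<times> [0, \<infinity>)\<close> are the restrictions of
  smooth compactly supported functions on the plane; they need not vanish at time 0.
\<close>

definition test_fun :: "(real \<times> real \<Rightarrow> real) \<Rightarrow> bool" where
  "test_fun \<phi> \<longleftrightarrow> (\<forall>k. Ck k \<phi>) \<and> compact (closure {z. \<phi> z \<noteq> 0})"

text \<open>
  Distributional solution of \<open>D\<^sub>t + F\<^sub>x = 0\<close> on \<open>\<real> \<times> [0, \<infinity>)\<close> with initial datum \<open>D\<^sub>0\<close>.
  The local integrability makes all the integrals genuine (otherwise they would be 0 by
  convention).
\<close>

definition weak_solution ::
  "(real \<times> real \<Rightarrow> real) \<Rightarrow> (real \<times> real \<Rightarrow> real) \<Rightarrow> (real \<Rightarrow> real) \<Rightarrow> bool" where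
  "weak_solution D F D0 \<longleftrightarrow>
     loc_integrable_on (UNIV \<times> {0..}) D \<and>
     loc_integrable_on (UNIV \<times> {0..}) F \<and>
     loc_integrable_on UNIV D0 \<and>
     (\<forall>\<phi>. test_fun \<phi> \<longrightarrow>
        (LINT z : UNIV \<times> {0..} | lebesgue. dt \<phi> z * D z + dx \<phi> z * F z)
        + (LINT x | lebesgue. \<phi> (x, 0) * D0 x) = 0)"

text \<open>
  \<open>w\<close> is the strong (\<open>L\<^sup>1\<close>) trace of \<open>f\<close> along the curve \<open>x = X t\<close>, taken from the right
  (\<open>\<sigma> = 1\<close>) or from the left (\<open>\<sigma> = -1\<close>). Below, \<open>p = (t, s)\<close> with \<open>s\<close> the distance to the
  curve.
\<close>

definition strong_trace ::
  "real \<Rightarrow> (real \<times> real \<Rightarrow> real) \<Rightarrow> (real \<Rightarrow> real) \<Rightarrow> (real \<Rightarrow> real) \<Rightarrow> bool" where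
  "strong_trace \<sigma> f X w \<longleftrightarrow>
     (\<forall>\<tau>>0.
        (\<forall>\<epsilon>>0. set_integrable lebesgue ({0..\<tau>} \<times> {0..\<epsilon>})
                 (\<lambda>p. \<bar>f (X (fst p) + \<sigma> * snd p, fst p) - w (fst p)\<bar>)) \<and>
        ((\<lambda>\<epsilon>. (1 / \<epsilon>) * (LINT p : {0..\<tau>} \<times> {0..\<epsilon>} | lebesgue.
                 \<bar>f (X (fst p) + \<sigma> * snd p, fst p) - w (fst p)\<bar>)) \<longlongrightarrow> 0) (at_right 0))"

text \<open>
  Solutions of \<open>X'(t) = a(X(t)) v(\<rho>(X(t),t))\<close>. As \<open>\<rho>\<close> may be discontinuous in time, the equation is
  understood in Caratheodory's sense (the right-hand side being bounded, absolute continuity is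
  Lipschitz continuity). As \<open>\<rho>\<close> is an \<open>L\<^sup>\<infinity>\<close> function and the curve is a null set, the value
  \<open>v(\<rho>(X(t),t))\<close> of the velocity on the curve is meant as a one-sided trace; without this
  requirement it could be changed arbitrarily without changing the class of \<open>\<rho>\<close>.
\<close>

definition vehicle_trajectory ::
  "(real \<Rightarrow> real) \<Rightarrow> (real \<Rightarrow> real) \<Rightarrow> (real \<times> real \<Rightarrow> real) \<Rightarrow> (real \<Rightarrow> real) \<Rightarrow> bool" where
  "vehicle_trajectory a v \<rho> X \<longleftrightarrow>
     (\<forall>\<tau>>0. \<exists>L. L-lipschitz_on {0..\<tau>} X) \<and>
     (AE t in lebesgue. t > 0 \<longrightarrow>
        (X has_real_derivative a (X t) * v (\<rho> (X t, t))) (at t)) \<and>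
     (\<exists>\<sigma>\<in>{-1, 1}. strong_trace \<sigma> (\<lambda>z. v (\<rho> z)) X (\<lambda>t. v (\<rho> (X t, t))))"

end

theory Submission
  imports Defs
begin

text \<open>
  In the Lagrangian coordinates \<open>(y, t)\<close> the position \<open>\<xi> (y, t)\<close> satisfies \<open>\<xi>\<^sub>y = 1 / u_L\<close>, and the weak
  equation says that \<open>\<xi>\<^sub>t - a_L v(u_L)\<close> does not depend on \<open>y\<close>. The trace along the vehicle trajectory
  \<open>y = 0\<close> identifies this function of time as 0, so for almost every \<open>y\<close> the curve \<open>\<xi> (y, \<cdot>)\<close> is
  absolutely continuous with derivative \<open>a_L v(u_L)\<close>. Integrating \<open>d/dt \<phi>(\<xi> (y, t), t)\<close> along these
  curves, then over \<open>y\<close>, and changing variables by \<open>x = \<xi> (y, t)\<close>, \<open>\<rho> dx = dy\<close>, gives the Eulerian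
  weak equation. The measure \<open>\<rho> dx\<close> is pushed forward to \<open>dy\<close> because both agree on intervals.
\<close>

section \<open>Smooth test functions\<close>

text \<open>The distribution \<open>\<xi>_t\<close> and the speed \<open>b\<close> are not compared
  directly: the argument works with the integrated defect \<open>E = \<xi> - x0 - B\<close>, where
  \<open>B\<close> is the time integral of \<open>b\<close>. Product test functions give a zero
  integral of \<open>\<theta>' \<kappa>' E\<close>. As \<theta> may be nonzero at time 0, the
  initial datum is included and \<open>\<theta>'\<close> is free on positive times, its compensating
  mass being placed at negative times. Compact support forces \<open>\<kappa>'\<close> to have mean
  zero: the mass of an indicator is balanced on a strip of width \<epsilon> beside
  \<open>y = 0\<close>, where the averaged trace and the equation of the vehicle make
  \<open>E\<close> small as \<epsilon> tends to 0. Hence all box integrals of \<open>E\<close>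
  vanish.

  The other obstacle is the choice of representatives. \<open>T\<close> is built from pointwise
  values of \<rho>, whereas \<xi> is built from a Borel version of the Lagrangian density, so the
  two are matched only for almost every time. Time 0 may be exceptional and gets its own coordinate
  \<open>x0\<close>. The bounds \<delta> and 1 on the density make the maps bi-Lipschitz in space,
  so that null sets correspond.\<close>

fun nsmooth :: "nat \<Rightarrow> (real \<Rightarrow> real) \<Rightarrow> bool" where
  "nsmooth 0 f \<longleftrightarrow> continuous_on UNIV f"
| "nsmooth (Suc k) f \<longleftrightarrow> (\<exists>f'. (\<forall>x. (f has_real_derivative f' x) (at x)) \<and> nsmooth k f')"

lemma nsmooth_SucD: "nsmooth (Suc k) f \<Longrightarrow> nsmooth k f"
proof (induction k arbitrary: f)
  case 0
  then obtain f' where "\<And>x. (f has_real_derivative f' x) (at x)" by auto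
  then show ?case
    by (auto intro!: continuous_at_imp_continuous_on DERIV_isCont)
next
  case (Suc k)
  then obtain f' where f': "\<And>x. (f has_real_derivative f' x) (at x)" "nsmooth (Suc k) f'" by auto
  then show ?case
    unfolding nsmooth.simps using Suc.IH[OF f'(2)] by (intro exI[of _ f'] conjI allI)
qed

lemma nsmooth_const: "nsmooth k (\<lambda>x. c)"
  by (induction k arbitrary: c) (auto intro!: exI[of _ "\<lambda>_. 0"])

lemma nsmooth_add: "nsmooth k f \<Longrightarrow> nsmooth k g \<Longrightarrow> nsmooth k (\<lambda>x. f x + g x)"
proof (induction k arbitrary: f g)
  case 0
  then show ?case by (auto intro: continuous_intros)
next
  case (Suc k)
  then obtain f' g' where "\<And>x. (f has_real_derivative f' x) (at x)" "nsmooth k f'"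
      "\<And>x. (g has_real_derivative g' x) (at x)" "nsmooth k g'" by auto
  then show ?case
    unfolding nsmooth.simps
    by (intro exI[of _ "\<lambda>x. f' x + g' x"] conjI allI DERIV_add Suc.IH)
qed

lemma nsmooth_mult: "nsmooth k f \<Longrightarrow> nsmooth k g \<Longrightarrow> nsmooth k (\<lambda>x. f x * g x)"
proof (induction k arbitrary: f g)
  case 0
  then show ?case by (auto intro: continuous_intros)
next
  case (Suc k)
  then obtain f' g' where D: "\<And>x. (f has_real_derivative f' x) (at x)" "nsmooth k f'"
      "\<And>x. (g has_real_derivative g' x) (at x)" "nsmooth k g'" by auto
  have "nsmooth k (\<lambda>x. f' x * g x + g' x * f x)"
    using D(2,4) nsmooth_SucD[OF Suc.prems(1)] nsmooth_SucD[OF Suc.prems(2)]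
    by (intro nsmooth_add Suc.IH)
  moreover have "((\<lambda>x. f x * g x) has_real_derivative f' x * g x + g' x * f x) (at x)" for x
    using DERIV_mult[OF D(1) D(3)] .
  ultimately show ?case
    unfolding nsmooth.simps by (intro exI[of _ "\<lambda>x. f' x * g x + g' x * f x"] conjI allI)
qed

lemma nsmooth_affine: "nsmooth k f \<Longrightarrow> nsmooth k (\<lambda>x. f (c * x + d))"
proof (induction k arbitrary: f)
  case 0
  then show ?case by (auto intro!: continuous_intros elim: continuous_on_compose2)
next
  case (Suc k)
  then obtain f' where D: "\<And>x. (f has_real_derivative f' x) (at x)" "nsmooth k f'" by auto
  have "((\<lambda>x. f (c * x + d)) has_real_derivative f' (c * x + d) * c) (at x)" for x
    by (rule DERIV_chain2[OF D(1)]) (auto intro!: derivative_eq_intros)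
  moreover have "nsmooth k (\<lambda>x. f' (c * x + d) * c)"
    using Suc.IH[OF D(2)] nsmooth_const by (rule nsmooth_mult)
  ultimately show ?case
    unfolding nsmooth.simps by (intro exI[of _ "\<lambda>x. f' (c * x + d) * c"] conjI allI)
qed

lemma tensor_partial_derivatives:
  assumes "\<And>x. (f has_real_derivative f' x) (at x)" "\<And>x. (g has_real_derivative g' x) (at x)"
  shows "dx (\<lambda>z. f (fst z) * g (snd z)) = (\<lambda>z. f' (fst z) * g (snd z))"
    and "dt (\<lambda>z. f (fst z) * g (snd z)) = (\<lambda>z. f (fst z) * g' (snd z))"
  unfolding dx_def dt_def
  by (auto intro!: ext DERIV_imp_deriv derivative_eq_intros assms)

text \<open>Partial derivatives of a product of one-variable functions are again such products, so
  this class is stable under \<open>dx\<close> and \<open>dt\<close> and the induction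
  closes.\<close>

lemma Ck_tensor:
  "nsmooth k f \<Longrightarrow> nsmooth k g \<Longrightarrow> Ck k (\<lambda>z. f (fst z) * g (snd z))"
proof (induction k arbitrary: f g)
  case 0
  then show ?case
    by (auto intro!: continuous_intros elim: continuous_on_compose2)
next
  case (Suc k)
  then obtain f' g' where D: "\<And>x. (f has_real_derivative f' x) (at x)" "nsmooth k f'"
      "\<And>x. (g has_real_derivative g' x) (at x)" "nsmooth k g'" by auto
  have F: "((\<lambda>z. f (fst z)) has_derivative (\<lambda>h. f' (fst z) * fst h)) (at z)" for z :: "real \<times> real"
    using has_derivative_compose[of fst fst z UNIV f "(*) (f' (fst z))"] D(1)[of "fst z"]
    by (simp add: has_field_derivative_def bounded_linear_imp_has_derivative bounded_linear_fst)
  have G: "((\<lambda>z. g (snd z)) has_derivative (\<lambda>h. g' (snd z) * snd h)) (at z)" for z :: "real \<times> real"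
    using has_derivative_compose[of snd snd z UNIV g "(*) (g' (snd z))"] D(3)[of "snd z"]
    by (simp add: has_field_derivative_def bounded_linear_imp_has_derivative bounded_linear_snd)
  have "(\<lambda>z. f (fst z) * g (snd z)) differentiable_on UNIV"
    using has_derivative_mult[OF F G]
    by (auto simp: differentiable_on_def intro!: differentiableI)
  moreover have "nsmooth k f" "nsmooth k g" using Suc.prems by (blast intro: nsmooth_SucD)+
  ultimately show ?case
    using Suc.IH D by (simp add: tensor_partial_derivatives[OF D(1) D(3)])
qed

lemma test_fun_tensor:
  assumes "\<And>k. nsmooth k f" "\<And>k. nsmooth k g"
    and "\<And>x. \<bar>x\<bar> > M \<Longrightarrow> f x = 0" "\<And>x. \<bar>x\<bar> > M \<Longrightarrow> g x = 0"
  shows "test_fun (\<lambda>z. f (fst z) * g (snd z))"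
  unfolding test_fun_def
proof
  show "\<forall>k. Ck k (\<lambda>z. f (fst z) * g (snd z))" using assms Ck_tensor by blast
  have "{z. f (fst z) * g (snd z) \<noteq> 0} \<subseteq> cbox (-M, -M) (M, M)"
  proof
    fix z assume "z \<in> {z. f (fst z) * g (snd z) \<noteq> 0}"
    then have "\<not> \<bar>fst z\<bar> > M" "\<not> \<bar>snd z\<bar> > M" using assms(3,4) by auto
    then show "z \<in> cbox (-M, -M) (M, M)" by (cases z) (auto simp: cbox_Pair_iff)
  qed
  then have "bounded {z. f (fst z) * g (snd z) \<noteq> 0}"
    by (meson bounded_cbox bounded_subset)
  then show "compact (closure {z. f (fst z) * g (snd z) \<noteq> 0})"
    by (simp add: compact_closure)
qed

section \<open>A flat function, a bump and a smooth ramp\<close>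

definition flat :: "real poly \<Rightarrow> real \<Rightarrow> real" where
  "flat p x = (if x \<le> 0 then 0 else poly p (1 / x) * exp (- (1 / x)))"

lemma poly_div_exp_tendsto_0: "((\<lambda>x. poly p x * exp (- x)) \<longlongrightarrow> (0::real)) at_top"
proof -
  have "((\<lambda>x. \<Sum>i\<le>degree p. coeff p i * (x ^ i / exp x)) \<longlongrightarrow> (\<Sum>i\<le>degree p. coeff p i * 0)) at_top"
    by (intro tendsto_sum tendsto_mult tendsto_const tendsto_power_div_exp_0)
  then show ?thesis
    by (simp add: poly_altdef sum_distrib_right exp_minus divide_inverse mult.assoc)
qed

text \<open>Differentiating \<open>p(1/x) exp(-1/x)\<close> for positive x gives the same expression
  with \<open>p\<close> replaced by \<open>X^2 (p - p')\<close>; carrying a polynomial along makes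
  the class closed under differentiation. At 0 the difference quotient tends to 0 because the
  exponential beats every polynomial in \<open>1/x\<close>.\<close>

lemma has_real_derivative_flat:
  "(flat p has_real_derivative flat ([:0, 0, 1:] * (p - pderiv p)) x) (at x)"
proof (cases x "0::real" rule: linorder_cases)
  case less
  then have "\<forall>\<^sub>F y in nhds x. flat p y = 0"
    by (auto simp: flat_def eventually_nhds intro!: exI[of _ "{..<0}"])
  then show ?thesis
    using less by (subst DERIV_cong_ev[where g = "\<lambda>_. 0"]) (auto simp: flat_def)
next
  case greater
  then have *: "\<forall>\<^sub>F y in nhds x. flat p y = poly p (1 / y) * exp (- (1 / y))"
    by (auto simp: flat_def eventually_nhds intro!: exI[of _ "{0<..}"])
  have "((\<lambda>y. poly p (1 / y) * exp (- (1 / y))) has_real_derivative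
      flat ([:0, 0, 1:] * (p - pderiv p)) x) (at x)"
    using greater
    by (auto intro!: derivative_eq_intros DERIV_chain2[OF poly_DERIV]
        simp: flat_def power2_eq_square algebra_simps divide_simps)
  then show ?thesis
    using * by (subst DERIV_cong_ev) auto
next
  case equal
  have "((\<lambda>y. flat p y / y) \<longlongrightarrow> 0) (at_right 0)"
  proof -
    \<comment> \<open>The factor \<open>[:0, 1:]\<close> absorbs the division by y: for positive y
      and \<open>x = 1 / y\<close>, the quotient \<open>flat p y / y\<close> is
      \<open>x p(x) exp(-x)\<close>.\<close>
    have "((\<lambda>x. poly ([:0, 1:] * p) x * exp (- x)) \<longlongrightarrow> 0) at_top"
      by (rule poly_div_exp_tendsto_0)
    from filterlim_compose[OF this filterlim_inverse_at_top_right]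
    show ?thesis
      by (rule tendsto_cong[THEN iffD1, rotated])
        (auto simp: flat_def eventually_at_right_less inverse_eq_divide
          intro!: eventually_mono[OF eventually_at_right_less])
  qed
  moreover have "((\<lambda>y. flat p y / y) \<longlongrightarrow> 0) (at_left 0)"
    by (rule tendsto_eventually) (auto simp: flat_def eventually_at_left_field intro!: exI[of _ "-1"])
  ultimately have "((\<lambda>y. flat p y / y) \<longlongrightarrow> 0) (at 0)"
    by (simp add: filterlim_split_at)
  then show ?thesis
    using equal by (simp add: has_field_derivative_iff flat_def)
qed

lemma nsmooth_flat: "nsmooth k (flat p)"
proof (induction k arbitrary: p)
  case 0
  have "isCont (flat p) x" for x using has_real_derivative_flat DERIV_isCont by blast
  then show ?case by (simp add: continuous_at_imp_continuous_on)
next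
  case (Suc k)
  show ?case
    unfolding nsmooth.simps
    by (intro exI[of _ "flat ([:0, 0, 1:] * (p - pderiv p))"] conjI allI has_real_derivative_flat Suc)
qed

lemma antiderivative_real:
  fixes f :: "real \<Rightarrow> real"
  assumes "continuous_on UNIV f"
  obtains F where "\<And>x. (F has_real_derivative f x) (at x)" "F 0 = 0"
proof -
  have "\<exists>F. \<forall>x. -\<infinity> < ereal x \<longrightarrow> ereal x < \<infinity> \<longrightarrow> (F has_vector_derivative f x) (at x)"
    using assms by (intro einterval_antiderivative) (auto simp: continuous_on_eq_continuous_at)
  then obtain F where "\<And>x. (F has_vector_derivative f x) (at x)" by auto
  then have "((\<lambda>x. F x - F 0) has_real_derivative f x) (at x)" for x
    by (auto intro!: derivative_eq_intros simp: has_real_derivative_iff_has_vector_derivative)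
  then show ?thesis using that[of "\<lambda>x. F x - F 0"] by auto
qed

text \<open>A bump on (0, 1) is integrated to a smooth step \<open>h\<close>, and the step to a ramp
  \<open>H\<close>, a smooth substitute for the positive part. Past 1 the ramp has slope 1 but lags
  behind by the constant \<open>c\<close>, which cancels later in sums of ramps of zero total
  weight.\<close>

lemma smooth_ramp:
  obtains H h :: "real \<Rightarrow> real" and c :: real
  where "\<And>k. nsmooth k H" "\<And>k. nsmooth k h"
    and "\<And>x. (H has_real_derivative h x) (at x)"
    and "\<And>x. 0 \<le> h x" "\<And>x. h x \<le> 1"
    and "\<And>x. x \<le> 0 \<Longrightarrow> H x = 0" "\<And>x. x \<le> 0 \<Longrightarrow> h x = 0"
    and "\<And>x. x \<ge> 1 \<Longrightarrow> H x = x - c" "\<And>x. x \<ge> 1 \<Longrightarrow> h x = 1"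
proof -
  \<comment> \<open>The product of \<open>exp(-1/x)\<close> and its mirror image is positive exactly
    on (0, 1).\<close>
  define B where "B = (\<lambda>x. flat 1 x * flat 1 ((-1) * x + 1))"
  have B: "nsmooth k B" for k
    unfolding B_def by (intro nsmooth_mult nsmooth_affine nsmooth_flat)
  have B0: "B x = 0" if "x \<le> 0 \<or> x \<ge> 1" for x using that by (auto simp: B_def flat_def)
  have Bnn: "B x \<ge> 0" for x by (auto simp: B_def flat_def)
  have Bpos: "B x > 0" if "0 < x" "x < 1" for x using that by (auto simp: B_def flat_def)
  have Bc: "continuous_on UNIV B" using B[of 0] by simp
  obtain g where g: "\<And>x. (g has_real_derivative B x) (at x)" "g 0 = 0"
    by (rule antiderivative_real[OF Bc]) blast
  have gmono: "g x \<le> g y" if "x \<le> y" for x y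
    using that g Bnn by (meson DERIV_nonneg_imp_nondecreasing)
  have g1: "g 1 > 0"
    using MVT2[of 0 1 g B] g Bpos by auto
  have g_const: "g x = 0" if "x \<le> 0" for x
  proof (cases "x = 0")
    case False
    then have "x < 0" using that by simp
    from MVT2[OF this g(1)] obtain z where "z < 0" "g 0 - g x = (0 - x) * B z" by blast
    then show ?thesis using B0[of z] g(2) by simp
  qed (simp add: g(2))
  have g_const1: "g x = g 1" if "x \<ge> 1" for x
  proof (cases "x = 1")
    case False
    then have "1 < x" using that by simp
    from MVT2[OF this g(1)] obtain z where "z > 1" "g x - g 1 = (x - 1) * B z" by blast
    then show ?thesis using B0[of z] by simp
  qed simp
  define h where "h = (\<lambda>x. (1 / g 1) * g x)"
  have h: "nsmooth k h" for k
  proof -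
    have "nsmooth (Suc k) g"
      unfolding nsmooth.simps by (intro exI[of _ B] conjI allI B g(1))
    then show ?thesis unfolding h_def by (intro nsmooth_mult nsmooth_const) (rule nsmooth_SucD)
  qed
  have h01: "h x = 0" if "x \<le> 0" for x using g_const that by (simp add: h_def)
  have h11: "h x = 1" if "x \<ge> 1" for x using g_const1[OF that] g1 by (simp add: h_def)
  have hb: "0 \<le> h x" "h x \<le> 1" for x
    using gmono[of x "max x 1"] gmono[of "min x 0" x] g_const[of "min x 0"] g_const1[of "max x 1"] g1
    by (simp_all add: h_def divide_simps)
  have hc: "continuous_on UNIV h" using h[of 0] by simp
  obtain H where H: "\<And>x. (H has_real_derivative h x) (at x)" "H 0 = 0"
    by (rule antiderivative_real[OF hc]) blast
  have Hs: "nsmooth k H" for k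
  proof -
    have "nsmooth (Suc k) H"
      unfolding nsmooth.simps by (intro exI[of _ h] conjI allI h H(1))
    then show ?thesis by (rule nsmooth_SucD)
  qed
  have H0: "H x = 0" if "x \<le> 0" for x
  proof (cases "x = 0")
    case False
    then have "x < 0" using that by simp
    from MVT2[OF this H(1)] obtain z where "z < 0" "H 0 - H x = (0 - x) * h z" by blast
    then show ?thesis using h01[of z] H(2) by simp
  qed (simp add: H(2))
  have H1: "H x = x - (1 - H 1)" if "x \<ge> 1" for x
  proof (cases "x = 1")
    case False
    then have "1 < x" using that by simp
    from MVT2[OF this H(1)] obtain z where "z > 1" "H x - H 1 = (x - 1) * h z" by blast
    then show ?thesis using h11[of z] by simp
  qed simp
  show ?thesis
    by (rule that[of H h "1 - H 1", OF Hs h H(1) hb H0 h01 H1 h11])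
qed

section \<open>Derivatives and supports of test functions\<close>

lemma test_fun_has_derivative:
  assumes "test_fun \<phi>"
  shows "(\<phi> has_derivative (\<lambda>h. fst h * dx \<phi> z + snd h * dt \<phi> z)) (at z)"
proof -
  have "Ck 1 \<phi>" using assms by (simp add: test_fun_def)
  then have "\<phi> differentiable (at z)" by (cases z) (simp add: differentiable_on_def)
  then obtain D where D: "(\<phi> has_derivative D) (at z)" by (auto simp: differentiable_def)
  interpret D: bounded_linear D using D by (rule has_derivative_bounded_linear)
  have z: "z = (fst z, snd z)" by simp
  have "((\<lambda>s. (s, snd z)) has_derivative (\<lambda>h. (h, 0))) (at (fst z))"
    by (auto intro!: derivative_eq_intros)
  from has_derivative_compose[OF this, of \<phi> D] have "((\<lambda>s. \<phi> (s, snd z)) has_derivative (\<lambda>h. D (h, 0))) (at (fst z))"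
    using D by simp
  moreover have "(\<lambda>h. D (h, 0)) = (*) (D (1, 0))"
  proof
    show "D (h, 0) = D (1, 0) * h" for h using D.scaleR[of h "(1, 0)"] by (simp add: mult.commute)
  qed
  ultimately have 1: "((\<lambda>s. \<phi> (s, snd z)) has_real_derivative D (1, 0)) (at (fst z))"
    by (simp only: has_field_derivative_def)
  have "((\<lambda>s. (fst z, s)) has_derivative (\<lambda>h. (0, h))) (at (snd z))"
    by (auto intro!: derivative_eq_intros)
  from has_derivative_compose[OF this, of \<phi> D] have "((\<lambda>s. \<phi> (fst z, s)) has_derivative (\<lambda>h. D (0, h))) (at (snd z))"
    using D by simp
  moreover have "(\<lambda>h. D (0, h)) = (*) (D (0, 1))"
  proof
    show "D (0, h) = D (0, 1) * h" for h using D.scaleR[of h "(0, 1)"] by (simp add: mult.commute)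
  qed
  ultimately have 2: "((\<lambda>s. \<phi> (fst z, s)) has_real_derivative D (0, 1)) (at (snd z))"
    by (simp only: has_field_derivative_def)
  have eq: "dx \<phi> z = D (1, 0)" "dt \<phi> z = D (0, 1)"
    using DERIV_imp_deriv[OF 1] DERIV_imp_deriv[OF 2] by (auto simp: dx_def dt_def case_prod_unfold)
  have "D h = fst h * D (1, 0) + snd h * D (0, 1)" for h
    using D.add[of "fst h *\<^sub>R (1, 0)" "snd h *\<^sub>R (0, 1)"] D.scaleR[of "fst h" "(1, 0)"] D.scaleR[of "snd h" "(0, 1)"]
    by simp
  then have "D = (\<lambda>h. fst h * dx \<phi> z + snd h * dt \<phi> z)" unfolding eq by (rule ext)
  with D show ?thesis by simp
qed

lemma test_fun_continuous:
  assumes "test_fun \<phi>"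
  shows "continuous_on UNIV \<phi>" "continuous_on UNIV (dx \<phi>)" "continuous_on UNIV (dt \<phi>)"
proof -
  have "Ck 0 \<phi>" "Ck 1 \<phi>" using assms by (auto simp: test_fun_def)
  then show "continuous_on UNIV \<phi>" "continuous_on UNIV (dx \<phi>)" "continuous_on UNIV (dt \<phi>)"
    by simp_all
qed

lemma test_fun_support:
  assumes "test_fun \<phi>"
  obtains R where "R > 0" "\<And>x t. \<bar>x\<bar> > R \<or> \<bar>t\<bar> > R \<Longrightarrow> \<phi> (x, t) = 0 \<and> dx \<phi> (x, t) = 0 \<and> dt \<phi> (x, t) = 0"
proof -
  have "bounded (closure {z. \<phi> z \<noteq> 0})" using assms by (auto simp: test_fun_def intro: compact_imp_bounded)
  then obtain R where R: "R > 0" "\<And>z. z \<in> closure {z. \<phi> z \<noteq> 0} \<Longrightarrow> norm z \<le> R"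
    by (auto simp: bounded_pos)
  have zero: "\<phi> (x, t) = 0" if "\<bar>x\<bar> > R \<or> \<bar>t\<bar> > R" for x t
  proof (rule ccontr)
    assume "\<phi> (x, t) \<noteq> 0"
    then have "(x, t) \<in> closure {z. \<phi> z \<noteq> 0}" by (intro closure_subset[THEN subsetD]) simp
    then have "norm (x, t) \<le> R" by (rule R(2))
    then show False using that norm_fst_le[of x t] norm_snd_le[of t x] by auto
  qed
  have D0: "deriv f x = 0" if "open S" "x \<in> S" "\<And>y. y \<in> S \<Longrightarrow> f y = 0" for f :: "real \<Rightarrow> real" and S x
  proof -
    have "(f has_real_derivative 0) (at x)"
      using that by (intro has_field_derivative_transform_within_open[of "\<lambda>_. 0" 0 x S f]) auto
    then show ?thesis by (rule DERIV_imp_deriv)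
  qed
  have op: "open {s::real. \<bar>s\<bar> > R}" by (intro open_Collect_less continuous_intros)
  have "dx \<phi> (x, t) = 0 \<and> dt \<phi> (x, t) = 0" if "\<bar>x\<bar> > R \<or> \<bar>t\<bar> > R" for x t
  proof (cases "\<bar>x\<bar> > R")
    case True
    then show ?thesis
      using D0[OF op, of x "\<lambda>s. \<phi> (s, t)"] D0[OF open_UNIV, of t "\<lambda>s. \<phi> (x, s)"] zero
      by (simp add: dx_def dt_def)
  next
    case False
    then show ?thesis
      using that D0[OF op, of t "\<lambda>s. \<phi> (x, s)"] D0[OF open_UNIV, of x "\<lambda>s. \<phi> (s, t)"] zero
      by (simp add: dx_def dt_def)
  qed
  with zero R(1) that show ?thesis by blast
qed

section \<open>Calculus with bounded measurable functions\<close>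

lemma integrable_bounded_support:
  fixes f :: "'a::euclidean_space \<Rightarrow> real"
  assumes "f \<in> borel_measurable borel" "\<And>z. z \<in> cbox a b \<Longrightarrow> \<bar>f z\<bar> \<le> C" "\<And>z. z \<notin> cbox a b \<Longrightarrow> f z = 0"
  shows "integrable lborel f"
proof (rule Bochner_Integration.integrable_bound)
  show "integrable lborel (\<lambda>z. C * indicator (cbox a b) z :: real)"
    by (intro integrable_mult_right integrable_real_indicator emeasure_lborel_cbox_finite) auto
  show "f \<in> borel_measurable lborel" using assms(1) by simp
  show "AE z in lborel. norm (f z) \<le> norm (C * indicator (cbox a b) z :: real)"
    using assms(2,3) by (intro AE_I2) (fastforce simp: indicator_def)
qed

lemma integral_tendsto_bounded_support:
  fixes f :: "'a::euclidean_space \<Rightarrow> real"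
  assumes "\<And>n. s n \<in> borel_measurable borel" "f \<in> borel_measurable borel"
    and "\<And>n z. z \<in> cbox a b \<Longrightarrow> \<bar>s n z\<bar> \<le> C" "\<And>n z. z \<notin> cbox a b \<Longrightarrow> s n z = 0"
    and "AE z in lborel. (\<lambda>n. s n z) \<longlonglongrightarrow> f z"
  shows "(\<lambda>n. LINT z|lborel. s n z) \<longlonglongrightarrow> (LINT z|lborel. f z)"
proof (rule integral_dominated_convergence[where w = "\<lambda>z. C * indicator (cbox a b) z"])
  show "integrable lborel (\<lambda>z. C * indicator (cbox a b) z :: real)"
    by (intro integrable_mult_right integrable_real_indicator emeasure_lborel_cbox_finite) auto
  show "AE z in lborel. norm (s n z) \<le> C * indicator (cbox a b) z" for n
    using assms(3,4) by (intro AE_I2) (fastforce simp: indicator_def)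
qed (use assms in auto)

lemma set_integrable_Icc_bounded:
  fixes b :: "real \<Rightarrow> real"
  assumes "b \<in> borel_measurable borel" "\<And>s. \<bar>b s\<bar> \<le> C"
  shows "set_integrable lborel {x..y} b"
  unfolding set_integrable_def
  using assms by (intro integrable_bounded_support[of _ x y C]) auto

lemma abs_set_integral_Icc_le:
  fixes b :: "real \<Rightarrow> real"
  assumes "b \<in> borel_measurable borel" "\<And>s. s \<in> {x..y} \<Longrightarrow> \<bar>b s\<bar> \<le> C" "x \<le> y"
  shows "\<bar>LBINT s:{x..y}. b s\<bar> \<le> C * (y - x)"
proof -
  have "\<bar>LBINT s:{x..y}. b s\<bar> \<le> (LBINT s:{x..y}. C)"
    unfolding set_lebesgue_integral_def
    using assms
    by (intro order_trans[OF integral_abs_bound] integral_mono integrable_bounded_support[of _ x y C])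
      (auto simp: indicator_def intro: order_trans[OF abs_ge_zero])
  also have "\<dots> = C * (y - x)" using assms by (simp add: set_integral_const)
  finally show ?thesis .
qed

text \<open>Measurable functions are almost everywhere limits of continuous ones. Truncation at the
  level \<open>C\<close> keeps continuity and does not disturb the limit, which is itself bounded by
  \<open>C\<close>; the common bound prepares dominated convergence.\<close>

lemma bounded_borel_approx_continuous:
  fixes b :: "real \<Rightarrow> real"
  assumes "b \<in> borel_measurable borel" "\<And>s. \<bar>b s\<bar> \<le> C"
  obtains c where "\<And>n. continuous_on UNIV (c n)" "\<And>n s. \<bar>c n s\<bar> \<le> C"
    "AE s in lborel. (\<lambda>n. c n s) \<longlonglongrightarrow> b s"
proof -
  have "b measurable_on UNIV"
    using measurable_completion[of b lborel borel] assms(1)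
    by (intro lebesgue_measurable_imp_measurable_on) (auto simp: lebesgue_on_UNIV_eq)
  then obtain N g where N: "negligible N" and g: "\<And>n::nat. continuous_on UNIV (g n)"
    and lim: "\<And>x. x \<notin> N \<Longrightarrow> (\<lambda>n. g n x) \<longlonglongrightarrow> b x"
    by (auto simp: measurable_on_def)
  define c where "c n s = max (-C) (min C (g n s))" for n s
  show ?thesis
  proof (rule that[of c])
    show "continuous_on UNIV (c n)" for n
      unfolding c_def by (intro continuous_intros g)
    show "\<bar>c n s\<bar> \<le> C" for n s using assms(2)[of 0] by (auto simp: c_def)
    have "(\<lambda>n. c n s) \<longlonglongrightarrow> b s" if "s \<notin> N" for s
    proof -
      have "(\<lambda>n. c n s) \<longlonglongrightarrow> max (-C) (min C (b s))"
        unfolding c_def by (intro tendsto_intros lim that)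
      then show ?thesis using assms(2)[of s] by (auto simp: abs_le_iff max_def min_def split: if_splits)
    qed
    then have "AE s in lebesgue. (\<lambda>n. c n s) \<longlonglongrightarrow> b s"
      using N by (intro AE_I'[of N]) (auto simp: negligible_iff_null_sets)
    then show "AE s in lborel. (\<lambda>n. c n s) \<longlonglongrightarrow> b s"
      by (simp add: AE_completion_iff)
  qed
qed

text \<open>Approximating the measurable speed \<open>b\<close> by continuous speeds gives
  continuously differentiable curves \<open>G n\<close>, to which the fundamental theorem applies.
  These curves converge pointwise to \<open>g\<close>, so dominated convergence carries the identity
  over.\<close>

lemma integral_chain_rule:
  fixes \<phi> \<phi>x \<phi>t :: "real \<times> real \<Rightarrow> real"
  assumes b: "b \<in> borel_measurable borel" "\<And>s. \<bar>b s\<bar> \<le> C"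
    and \<phi>: "\<And>z. (\<phi> has_derivative (\<lambda>h. fst h * \<phi>x z + snd h * \<phi>t z)) (at z)"
    and cont: "continuous_on UNIV \<phi>x" "continuous_on UNIV \<phi>t"
    and g: "\<And>t. \<alpha> \<le> t \<Longrightarrow> g t = g0 + (LBINT s:{\<alpha>..t}. b s)"
    and "\<alpha> \<le> \<beta>"
  shows "(LBINT t:{\<alpha>..\<beta>}. \<phi>t (g t, t) + \<phi>x (g t, t) * b t) = \<phi> (g \<beta>, \<beta>) - \<phi> (g0, \<alpha>)"
proof -
  obtain c where c: "\<And>n::nat. continuous_on UNIV (c n)" "\<And>n s. \<bar>c n s\<bar> \<le> C"
    and lim: "AE s in lborel. (\<lambda>n. c n s) \<longlonglongrightarrow> b s"
    using bounded_borel_approx_continuous[OF b] by blast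
  have cm: "c n \<in> borel_measurable borel" for n
    using c(1) by (rule borel_measurable_continuous_onI)
  define G where "G n t = g0 + (LBINT s:{\<alpha>..t}. c n s)" for n t
  have G_lim: "(\<lambda>n. G n t) \<longlonglongrightarrow> g t" if "\<alpha> \<le> t" for t
    unfolding G_def g[OF that] set_lebesgue_integral_def
    using c cm b lim
    by (intro tendsto_add tendsto_const integral_tendsto_bounded_support[where a = \<alpha> and b = t and C = C])
      (auto intro!: tendsto_intros elim!: eventually_mono)
  have G_bound: "\<bar>G n t\<bar> \<le> \<bar>g0\<bar> + C * (\<beta> - \<alpha>)" if "t \<in> {\<alpha>..\<beta>}" for n t
  proof -
    have "0 \<le> C" using b(2)[of 0] by simp
    then have "\<bar>LBINT s:{\<alpha>..t}. c n s\<bar> \<le> C * (t - \<alpha>)" "C * (t - \<alpha>) \<le> C * (\<beta> - \<alpha>)"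
      using that c cm by (auto intro!: abs_set_integral_Icc_le mult_left_mono)
    then show ?thesis unfolding G_def by linarith
  qed
  have G_deriv: "(G n has_vector_derivative c n t) (at t within {\<alpha>..\<beta>})" if "t \<in> {\<alpha>..\<beta>}" for n t
  proof -
    have "((\<lambda>u. g0 + (LBINT s=\<alpha>..u. c n s)) has_vector_derivative 0 + c n t) (at t within {\<alpha>..\<beta>})"
      using that \<open>\<alpha> \<le> \<beta>\<close> continuous_on_subset[OF c(1)]
      by (intro has_vector_derivative_add has_vector_derivative_const interval_integral_FTC2) auto
    from has_vector_derivative_transform[OF that _ this, of "G n"] show ?thesis
      by (simp add: G_def interval_integral_Icc)
  qed
  define F where "F n t = \<phi>t (G n t, t) + \<phi>x (G n t, t) * c n t" for n t
  have Gc: "continuous_on {\<alpha>..\<beta>} (G n)" for n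
    using G_deriv has_vector_derivative_continuous continuous_on_eq_continuous_within by blast
  have Fc: "continuous_on {\<alpha>..\<beta>} (F n)" for n
    unfolding F_def
    by (intro continuous_intros Gc continuous_on_compose2[OF cont(1)] continuous_on_compose2[OF cont(2)]
        continuous_on_subset[OF c(1)]) auto
  have chain: "((\<lambda>t. \<phi> (G n t, t)) has_vector_derivative F n t) (at t within {\<alpha>..\<beta>})"
    if "t \<in> {\<alpha>..\<beta>}" for n t
  proof -
    have "((\<lambda>t. (G n t, t)) has_derivative (\<lambda>h. (h * c n t, h))) (at t within {\<alpha>..\<beta>})"
      using G_deriv[OF that, of n]
      by (auto simp: has_vector_derivative_def intro!: derivative_eq_intros)
    from has_derivative_compose[OF this \<phi>]
    show ?thesis by (simp add: has_vector_derivative_def F_def algebra_simps)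
  qed
  have FTC: "(LBINT t:{\<alpha>..\<beta>}. F n t) = \<phi> (G n \<beta>, \<beta>) - \<phi> (g0, \<alpha>)" for n
  proof -
    have "(LBINT s:{\<alpha>..\<alpha>}. c n s) = 0"
      using abs_set_integral_Icc_le[OF cm c(2), of \<alpha> \<alpha> n] by simp
    then have "G n \<alpha> = g0" by (simp add: G_def)
    then show ?thesis
      using integral_FTC_Icc[OF \<open>\<alpha> \<le> \<beta>\<close> chain Fc] by (simp add: set_lebesgue_integral_def)
  qed
  \<comment> \<open>All approximating curves stay within this distance of 0, so one compact
    rectangle supplies the bounds of \<open>\<phi>x\<close> and \<open>\<phi>t\<close> for dominated
    convergence.\<close>
  let ?R = "\<bar>g0\<bar> + C * (\<beta> - \<alpha>)"
  have K: "compact ({-?R..?R} \<times> {\<alpha>..\<beta>})" by (intro compact_Times compact_Icc)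
  obtain Mx where Mx: "\<And>z. z \<in> {-?R..?R} \<times> {\<alpha>..\<beta>} \<Longrightarrow> \<bar>\<phi>x z\<bar> \<le> Mx"
    using compact_imp_bounded[OF compact_continuous_image[OF continuous_on_subset[OF cont(1)] K]]
    by (auto simp: bounded_iff)
  obtain Mt where Mt: "\<And>z. z \<in> {-?R..?R} \<times> {\<alpha>..\<beta>} \<Longrightarrow> \<bar>\<phi>t z\<bar> \<le> Mt"
    using compact_imp_bounded[OF compact_continuous_image[OF continuous_on_subset[OF cont(2)] K]]
    by (auto simp: bounded_iff)
  have F_bound: "\<bar>F n t\<bar> \<le> Mt + Mx * C" if "t \<in> {\<alpha>..\<beta>}" for n t
  proof -
    have "(G n t, t) \<in> {-?R..?R} \<times> {\<alpha>..\<beta>}" using G_bound[OF that, of n] that by auto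
    then have "\<bar>\<phi>t (G n t, t)\<bar> \<le> Mt" "\<bar>\<phi>x (G n t, t)\<bar> * \<bar>c n t\<bar> \<le> Mx * C"
      using Mx Mt c(2) by (auto intro!: mult_mono order_trans[OF abs_ge_zero Mx])
    then show ?thesis unfolding F_def abs_mult[symmetric] by linarith
  qed
  have isC: "isCont \<phi> z" "isCont \<phi>x z" "isCont \<phi>t z" for z
    using has_derivative_continuous[OF \<phi>, of z] cont
    by (auto simp: continuous_on_eq_continuous_at simp del: split_paired_All)
  have "AE t in lborel. (\<lambda>n. indicator {\<alpha>..\<beta>} t * F n t) \<longlonglongrightarrow>
          indicator {\<alpha>..\<beta>} t * (\<phi>t (g t, t) + \<phi>x (g t, t) * b t)"
    using lim
  proof eventually_elim
    case (elim t)
    show ?case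
    proof (cases "t \<in> {\<alpha>..\<beta>}")
      case True
      then have "(\<lambda>n. (G n t, t)) \<longlonglongrightarrow> (g t, t)"
        by (intro tendsto_intros G_lim) auto
      then show ?thesis
        unfolding F_def
        by (intro tendsto_mult tendsto_add tendsto_const elim
            isCont_tendsto_compose[OF isC(2)] isCont_tendsto_compose[OF isC(3)])
    qed simp
  qed
  moreover have Fm: "(\<lambda>t. indicator {\<alpha>..\<beta>} t * F n t) \<in> borel_measurable borel" for n
    using borel_measurable_continuous_on_indicator[OF _ Fc, of n] by simp
  moreover have gm: "(\<lambda>t. indicator {\<alpha>..\<beta>} t * (\<phi>t (g t, t) + \<phi>x (g t, t) * b t)) \<in> borel_measurable borel"
  proof -
    have [measurable]: "(\<lambda>t. indicator {\<alpha>..\<beta>} t * G n t) \<in> borel_measurable borel" for n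
      using borel_measurable_continuous_on_indicator[OF _ Gc, of n] by simp
    have "(\<lambda>t. indicator {\<alpha>..\<beta>} t * g t) \<in> borel_measurable borel"
    proof (rule borel_measurable_LIMSEQ_real)
      show "(\<lambda>n. indicator {\<alpha>..\<beta>} t * G n t) \<longlonglongrightarrow> indicator {\<alpha>..\<beta>} t * g t" for t
        by (cases "t \<in> {\<alpha>..\<beta>}") (auto simp: G_lim)
    qed measurable
    note [measurable] = this b(1) borel_measurable_continuous_onI[OF cont(1)] borel_measurable_continuous_onI[OF cont(2)]
    \<comment> \<open>\<open>g\<close> is known only for times from \<alpha> on; its truncation is
      measurable and is therefore put inside \<open>\<phi>t\<close> and \<open>\<phi>x\<close> as
      well, which changes nothing on the interval.\<close>
    have "(\<lambda>t. indicator {\<alpha>..\<beta>} t * (\<phi>t (indicator {\<alpha>..\<beta>} t * g t, t) + \<phi>x (indicator {\<alpha>..\<beta>} t * g t, t) * b t))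
        \<in> borel_measurable borel"
      by measurable
    then show ?thesis
      by (rule measurable_cong[THEN iffD1, rotated]) (auto simp: indicator_def)
  qed
  ultimately have "(\<lambda>n. LBINT t:{\<alpha>..\<beta>}. F n t) \<longlonglongrightarrow> (LBINT t:{\<alpha>..\<beta>}. \<phi>t (g t, t) + \<phi>x (g t, t) * b t)"
    unfolding set_lebesgue_integral_def real_scaleR_def
    by (intro integral_tendsto_bounded_support[where a = \<alpha> and b = \<beta> and C = "Mt + Mx * C"])
      (auto simp: F_bound)
  moreover have "(\<lambda>n. \<phi> (G n \<beta>, \<beta>) - \<phi> (g0, \<alpha>)) \<longlonglongrightarrow> \<phi> (g \<beta>, \<beta>) - \<phi> (g0, \<alpha>)"
    using \<open>\<alpha> \<le> \<beta>\<close> by (intro tendsto_intros isCont_tendsto_compose[OF isC(1)] G_lim)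
  ultimately show ?thesis
    unfolding FTC by (rule LIMSEQ_unique)
qed

text \<open>This is the chain rule for the function \<open>\<theta>(t) x\<close> of
  \<open>(x, t)\<close> along the curve \<open>x = g t\<close>.\<close>

lemma integral_by_parts_bounded:
  fixes \<theta> \<theta>' :: "real \<Rightarrow> real"
  assumes b: "b \<in> borel_measurable borel" "\<And>s. \<bar>b s\<bar> \<le> C"
    and \<theta>: "\<And>t. (\<theta> has_real_derivative \<theta>' t) (at t)" "continuous_on UNIV \<theta>'"
    and g: "\<And>t. \<alpha> \<le> t \<Longrightarrow> g t = g0 + (LBINT s:{\<alpha>..t}. b s)"
    and "\<alpha> \<le> \<beta>"
  shows "(LBINT t:{\<alpha>..\<beta>}. \<theta>' t * g t + \<theta> t * b t) = \<theta> \<beta> * g \<beta> - \<theta> \<alpha> * g0"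
proof -
  have c: "continuous_on UNIV \<theta>"
    using \<theta>(1) by (auto intro!: continuous_at_imp_continuous_on DERIV_isCont)
  have "((\<lambda>z. \<theta> (snd z)) has_derivative (\<lambda>h. \<theta>' (snd z) * snd h)) (at z)" for z :: "real \<times> real"
    using has_derivative_compose[of snd snd z UNIV \<theta> "(*) (\<theta>' (snd z))"] \<theta>(1)[of "snd z"]
    by (simp add: has_field_derivative_def bounded_linear_imp_has_derivative bounded_linear_snd)
  from has_derivative_mult[OF this bounded_linear_imp_has_derivative[OF bounded_linear_fst]]
  have "((\<lambda>z. \<theta> (snd z) * fst z) has_derivative
      (\<lambda>h. fst h * \<theta> (snd z) + snd h * (\<theta>' (snd z) * fst z))) (at z)" for z :: "real \<times> real"
    by (rule has_derivative_eq_rhs) (auto simp: algebra_simps)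
  from integral_chain_rule[OF b this _ _ g \<open>\<alpha> \<le> \<beta>\<close>]
  show ?thesis
    by (simp add: c continuous_on_compose2[OF c] continuous_on_compose2[OF \<theta>(2)] continuous_intros)
qed

text \<open>The integral of a difference quotient of \<open>X\<close> is a difference of quotients
  of an antiderivative, which converges to the increment of \<open>X\<close>; the Lipschitz bound
  supplies the domination. As \<open>g\<close> is not assumed measurable, it is replaced by the
  limit \<open>g'\<close> of Borel difference quotients.\<close>

lemma lipschitz_eq_integral_of_derivative:
  fixes X g :: "real \<Rightarrow> real"
  assumes lip: "\<And>\<tau>. \<tau> > 0 \<Longrightarrow> \<exists>L. L-lipschitz_on {0..\<tau>} X"
    and der: "AE t in lborel. t > 0 \<longrightarrow> (X has_real_derivative g t) (at t)"
  obtains g' where "g' \<in> borel_measurable borel" "AE t in lborel. t > 0 \<longrightarrow> g' t = g t"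
    "\<And>\<tau>. \<tau> \<ge> 0 \<Longrightarrow> X \<tau> = X 0 + (LBINT s:{0..\<tau>}. g' s)"
proof -
  define Y where "Y t = X (max 0 t)" for t
  have Xc: "continuous_on {0..\<tau>} X" if "\<tau> > 0" for \<tau>
    using lip[OF that] lipschitz_on_continuous_on by blast
  have Yc: "continuous_on UNIV Y"
  proof (rule continuous_at_imp_continuous_on, safe)
    fix t :: real
    have "continuous_on {..<\<bar>t\<bar> + 1} Y"
      unfolding Y_def
      by (intro continuous_on_compose2[OF Xc[of "\<bar>t\<bar> + 1"]] continuous_intros) auto
    then show "isCont Y t"
      by (rule continuous_on_interior) (auto simp: interior_open)
  qed
  have [measurable]: "Y \<in> borel_measurable borel"
    by (rule borel_measurable_continuous_onI[OF Yc])
  define D where "D n t = real (Suc n) * (Y (t + 1 / real (Suc n)) - Y t)" for n t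
  have [measurable]: "D n \<in> borel_measurable borel" for n
    unfolding D_def by measurable
  define g' where "g' t = lim (\<lambda>n. D n t)" for t
  have g'm: "g' \<in> borel_measurable borel"
    unfolding g'_def by measurable
  have zero: "(\<lambda>n. 1 / real (Suc n)) \<longlonglongrightarrow> 0"
    using LIMSEQ_inverse_real_of_nat by (simp add: inverse_eq_divide)
  have quot: "(\<lambda>n. real (Suc n) * (f (t + 1 / real (Suc n)) - f t)) \<longlonglongrightarrow> f'"
    if "(f has_real_derivative f') (at t within {t..})" for f f' t
  proof -
    have "((\<lambda>y. (f y - f t) / (y - t)) \<longlongrightarrow> f') (at t within {t..})"
      using that by (simp add: has_field_derivative_iff)
    then have "(\<lambda>n. (f (t + 1 / real (Suc n)) - f t) / ((t + 1 / real (Suc n)) - t)) \<longlonglongrightarrow> f'"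
      by (rule filterlim_compose)
        (use tendsto_add[OF tendsto_const[of t] zero] in \<open>auto simp: filterlim_at\<close>)
    then show ?thesis by (simp add: mult.commute)
  qed
  have ae: "AE t in lborel. t > 0 \<longrightarrow> (\<lambda>n. D n t) \<longlonglongrightarrow> g t"
    using der
  proof eventually_elim
    case (elim t)
    show ?case
    proof
      assume "t > 0"
      with elim have "(X has_real_derivative g t) (at t within {t..})"
        by (auto intro: has_field_derivative_at_within)
      from quot[OF this] show "(\<lambda>n. D n t) \<longlonglongrightarrow> g t"
        using \<open>t > 0\<close> by (simp add: D_def Y_def max_def add_pos_nonneg less_imp_le)
    qed
  qed
  then have g'g: "AE t in lborel. t > 0 \<longrightarrow> g' t = g t"
    by eventually_elim (auto simp: g'_def limI)
  obtain F where F: "\<And>x. (F has_real_derivative Y x) (at x)"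
    using antiderivative_real[OF Yc] by blast
  have "X \<tau> = X 0 + (LBINT s:{0..\<tau>}. g' s)" if "\<tau> \<ge> 0" for \<tau>
  proof (cases "\<tau> = 0")
    case True
    have "(LBINT s:{0..0}. g' s) = 0"
      using set_integral_discrete_difference[of "{0}" "{0}" "{}" lborel g']
      by (simp add: set_lebesgue_integral_def)
    then show ?thesis using True by simp
  next
    case False
    then have "\<tau> > 0" using that by simp
    \<comment> \<open>The quotients at times up to \<tau> look ahead by at most 1.\<close>
    obtain L where L: "L-lipschitz_on {0..\<tau> + 1} X" using lip[of "\<tau> + 1"] \<open>\<tau> > 0\<close> by auto
    have Dbd: "\<bar>D n t\<bar> \<le> L" if "t \<in> {0..\<tau>}" for n t
    proof -
      have "1 / real (Suc n) \<le> 1" by simp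
      then have "dist (X (t + 1 / real (Suc n))) (X t) \<le> L * dist (t + 1 / real (Suc n)) t"
        using that by (intro lipschitz_onD[OF L]) (auto intro: add_nonneg_nonneg add_mono simp del: of_nat_Suc)
      then have "\<bar>X (t + 1 / real (Suc n)) - X t\<bar> \<le> L / real (Suc n)"
        by (simp add: dist_real_def)
      then have "real (Suc n) * \<bar>X (t + 1 / real (Suc n)) - X t\<bar> \<le> real (Suc n) * (L / real (Suc n))"
        by (intro mult_left_mono) simp_all
      moreover have "D n t = real (Suc n) * (X (t + 1 / real (Suc n)) - X t)"
        using that by (simp add: D_def Y_def max_def add_nonneg_nonneg del: of_nat_Suc)
      ultimately show ?thesis by (simp add: abs_mult del: of_nat_Suc)
    qed
    have Dint: "(LBINT s:{0..\<tau>}. D n s) =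
        real (Suc n) * (F (\<tau> + 1 / real (Suc n)) - F \<tau>) - real (Suc n) * (F (0 + 1 / real (Suc n)) - F 0)" for n
    proof -
      have "((\<lambda>t. real (Suc n) * (F (t + 1 / real (Suc n)) - F t)) has_real_derivative D n t) (at t)" for t
        unfolding D_def
        by (auto intro!: derivative_eq_intros DERIV_chain2[OF F] F)
      then have "((\<lambda>t. real (Suc n) * (F (t + 1 / real (Suc n)) - F t)) has_vector_derivative D n t) (at t within {0..\<tau>})" for t
        by (metis has_field_derivative_at_within has_real_derivative_iff_has_vector_derivative)
      from integral_FTC_Icc[OF \<open>\<tau> \<ge> 0\<close> this] have *: "continuous_on {0..\<tau>} (D n) \<Longrightarrow> ?thesis"
        by (simp add: set_lebesgue_integral_def)
      have "continuous_on {0..\<tau>} (D n)"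
        unfolding D_def
        by (intro continuous_intros continuous_on_compose2[OF Yc] continuous_on_subset[OF Yc]) auto
      then show ?thesis by (rule *)
    qed
    have "(\<lambda>n. LBINT s:{0..\<tau>}. D n s) \<longlonglongrightarrow> (LBINT s:{0..\<tau>}. g' s)"
      unfolding set_lebesgue_integral_def real_scaleR_def
    proof (rule integral_tendsto_bounded_support[where a = 0 and b = \<tau> and C = L])
      show "AE z in lborel. (\<lambda>n. indicator {0..\<tau>} z * D n z) \<longlonglongrightarrow> indicator {0..\<tau>} z * g' z"
        using ae g'g AE_lborel_singleton[of 0]
        by eventually_elim (auto simp: indicator_def intro: tendsto_intros)
    qed (use g'm Dbd in auto)
    moreover have "(\<lambda>n. LBINT s:{0..\<tau>}. D n s) \<longlonglongrightarrow> Y \<tau> - Y 0"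
      unfolding Dint
      by (rule tendsto_diff[OF quot[OF has_field_derivative_at_within[OF F]]
            quot[OF has_field_derivative_at_within[OF F]]])
    ultimately have "(LBINT s:{0..\<tau>}. g' s) = Y \<tau> - Y 0" by (rule LIMSEQ_unique)
    then show ?thesis using that by (simp add: Y_def)
  qed
  with g'm g'g that show ?thesis by blast
qed

section \<open>Change of variables by the mass coordinate\<close>

lemma interval_integral_diff_bounded:
  fixes R :: "real \<Rightarrow> real" and c :: real
  assumes "R \<in> borel_measurable borel" "\<And>s. \<bar>R s\<bar> \<le> C" "x \<le> y"
  shows "(LBINT z=c..y. R z) - (LBINT z=c..x. R z) = (LBINT z:{x..y}. R z)"
proof -
  have "interval_lebesgue_integrable lborel (ereal p) (ereal q) R" for p q :: real
  proof -
    have "set_integrable lborel {p<..<q} R" for p q :: real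
      by (rule set_integrable_subset[OF set_integrable_Icc_bounded[OF assms(1,2), of p q]]) auto
    then show ?thesis by (auto simp: interval_lebesgue_integrable_def)
  qed
  then have "(LBINT z=c..x. R z) + (LBINT z=x..y. R z) = (LBINT z=c..y. R z)"
    by (intro interval_integral_sum) (auto simp: min_def max_def)
  then show ?thesis using \<open>x \<le> y\<close> by (simp add: interval_integral_Icc)
qed

lemma set_integral_Icc_bounds:
  fixes R :: "real \<Rightarrow> real"
  assumes "R \<in> borel_measurable borel" "\<And>s. m \<le> R s" "\<And>s. R s \<le> M" "x \<le> y"
  shows "m * (y - x) \<le> (LBINT z:{x..y}. R z)" "(LBINT z:{x..y}. R z) \<le> M * (y - x)"
proof -
  have b: "\<bar>R s\<bar> \<le> max \<bar>m\<bar> \<bar>M\<bar>" for s using assms(2,3)[of s] by auto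
  have c: "set_integrable lborel {x..y} (\<lambda>_. k)" for k :: real
    by (rule set_integrable_Icc_bounded[of _ "\<bar>k\<bar>"]) auto
  have k: "(LBINT z:{x..y}. k) = k * (y - x)" for k
    using \<open>x \<le> y\<close> by (simp add: set_integral_const)
  show "m * (y - x) \<le> (LBINT z:{x..y}. R z)"
    unfolding k[symmetric]
    by (intro set_integral_mono c set_integrable_Icc_bounded[OF assms(1) b] assms)
  show "(LBINT z:{x..y}. R z) \<le> M * (y - x)"
    unfolding k[symmetric]
    by (intro set_integral_mono c set_integrable_Icc_bounded[OF assms(1) b] assms)
qed

text \<open>The base point \<open>c\<close> and the offset \<open>k\<close> are free so that the
  same facts serve the mass coordinate (base point \<open>X t\<close>, offset 0) and the position
  \<xi> (base point 0, offset \<open>X t\<close>).\<close>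

lemma indefinite_integral_bounds:
  fixes R Y :: "real \<Rightarrow> real" and c k :: real
  assumes R: "R \<in> borel_measurable borel" "\<And>s. m \<le> R s" "\<And>s. R s \<le> M"
    and Y: "\<And>x. Y x = k + (LBINT z=c..x. R z)" and "x \<le> y"
  shows "Y y - Y x = (LBINT z:{x..y}. R z)" "m * (y - x) \<le> Y y - Y x" "Y y - Y x \<le> M * (y - x)"
proof -
  have b: "\<bar>R s\<bar> \<le> max \<bar>m\<bar> \<bar>M\<bar>" for s using R(2,3)[of s] by auto
  show *: "Y y - Y x = (LBINT z:{x..y}. R z)"
    using interval_integral_diff_bounded[OF R(1) b \<open>x \<le> y\<close>] by (simp add: Y)
  show "m * (y - x) \<le> Y y - Y x" "Y y - Y x \<le> M * (y - x)"
    unfolding * using set_integral_Icc_bounds[OF R \<open>x \<le> y\<close>] .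
qed

lemma indefinite_integral_continuous:
  fixes R Y :: "real \<Rightarrow> real" and c k :: real
  assumes R: "R \<in> borel_measurable borel" "\<And>s. m \<le> R s" "\<And>s. R s \<le> M"
    and Y: "\<And>x. Y x = k + (LBINT z=c..x. R z)"
  shows "continuous_on UNIV Y"
proof -
  let ?C = "max \<bar>m\<bar> \<bar>M\<bar>"
  have "\<bar>Y y - Y x\<bar> \<le> ?C * \<bar>y - x\<bar>" for x y
  proof (induction x y rule: linorder_wlog)
    case (le x y)
    have "- ?C * (y - x) \<le> m * (y - x)" "M * (y - x) \<le> ?C * (y - x)"
      using le by (intro mult_right_mono; linarith)+
    then show ?case
      using indefinite_integral_bounds(2,3)[OF R Y le] le by (auto simp: abs_le_iff)
  qed (simp add: abs_minus_commute)
  then have "?C-lipschitz_on UNIV Y"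
    by (intro lipschitz_onI) (auto simp: dist_real_def)
  then show ?thesis by (rule lipschitz_on_continuous_on)
qed

lemma indefinite_integral_surj:
  fixes R Y :: "real \<Rightarrow> real" and c k :: real
  assumes R: "R \<in> borel_measurable borel" "\<And>s. m \<le> R s" "\<And>s. R s \<le> M" and "0 < m"
    and Y: "\<And>x. Y x = k + (LBINT z=c..x. R z)"
  shows "\<exists>x. Y x = y"
proof -
  \<comment> \<open>As the slope is at least \<open>m\<close>, moving by this distance from 0
    changes \<open>Y\<close> by at least \<open>|y| + |Y 0|\<close>, enough to reach or pass y on
    either side.\<close>
  let ?d = "(\<bar>y\<bar> + \<bar>Y 0\<bar>) / m"
  have d: "?d \<ge> 0" "m * ?d = \<bar>y\<bar> + \<bar>Y 0\<bar>" using \<open>0 < m\<close> by auto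
  have "m * ?d \<le> Y 0 - Y (- ?d)" "m * ?d \<le> Y ?d - Y 0"
    using indefinite_integral_bounds(2)[OF R Y, of "- ?d" 0] indefinite_integral_bounds(2)[OF R Y, of 0 ?d] d(1)
    by auto
  then have "Y (- ?d) \<le> y" "y \<le> Y ?d"
    unfolding d(2) by linarith+
  then have "\<exists>x\<ge>- ?d. x \<le> ?d \<and> Y x = y"
    using indefinite_integral_continuous[OF R Y] d
    by (intro IVT') (auto intro: continuous_on_subset)
  then show ?thesis by blast
qed

text \<open>The preimage of an interval \<open>(Y p, Y q)\<close> is \<open>(p, q)\<close>, whose
  mass under the density is the increment \<open>Y q - Y p\<close>, that is, the length of the
  interval. The result serves as the change of variables and also as the means of pulling back null
  sets.\<close>

lemma distr_indefinite_integral: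
  fixes R Y :: "real \<Rightarrow> real" and c k :: real
  assumes R: "R \<in> borel_measurable borel" "\<And>s. m \<le> R s" "\<And>s. R s \<le> M" and "0 < m"
    and Y: "\<And>x. Y x = k + (LBINT z=c..x. R z)"
  shows "distr (density lborel (\<lambda>x. ennreal (R x))) borel Y = lborel"
proof (rule lborel_eqI[symmetric])
  have [measurable]: "R \<in> borel_measurable borel" "Y \<in> borel_measurable borel"
    using R(1) borel_measurable_continuous_onI[OF indefinite_integral_continuous[OF R Y]] by auto
  have mono: "x < y \<Longrightarrow> Y x < Y y" for x y
    using indefinite_integral_bounds(2)[OF R Y, of x y] mult_pos_pos[OF \<open>0 < m\<close>, of "y - x"] by simp
  fix l u :: real assume "\<And>b. b \<in> Basis \<Longrightarrow> l \<bullet> b \<le> u \<bullet> b"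
  then have "l \<le> u" by simp
  obtain p q where pq: "Y p = l" "Y q = u"
    using indefinite_integral_surj[OF R \<open>0 < m\<close> Y] by metis
  with mono[of q p] \<open>l \<le> u\<close> have "p \<le> q" by (cases p q rule: linorder_cases) auto
  have iff: "l < Y x \<and> Y x < u \<longleftrightarrow> p < x \<and> x < q" for x
    using mono pq by auto (metis linorder_neqE_linordered_idom not_less_iff_gr_or_eq)+
  have b: "\<bar>R s\<bar> \<le> max \<bar>m\<bar> \<bar>M\<bar>" for s using R(2,3)[of s] by auto
  have "emeasure (distr (density lborel (\<lambda>x. ennreal (R x))) borel Y) (box l u)
      = (\<integral>\<^sup>+x. ennreal (R x) * indicator (Y -` box l u) x \<partial>lborel)"
    using measurable_sets_borel[OF \<open>Y \<in> borel_measurable borel\<close>, of "box l u"]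
    by (simp add: emeasure_distr emeasure_density)
  also have "\<dots> = (\<integral>\<^sup>+x. ennreal (indicator {p..q} x * R x) \<partial>lborel)"
    using AE_lborel_singleton[of p] AE_lborel_singleton[of q]
    by (intro nn_integral_cong_AE, eventually_elim) (auto simp: indicator_def box_real iff)
  also have "\<dots> = ennreal (LBINT x:{p..q}. R x)"
    unfolding set_lebesgue_integral_def real_scaleR_def
    using set_integrable_Icc_bounded[OF R(1) b, of p q] order.trans[OF less_imp_le[OF \<open>0 < m\<close>] R(2)]
    by (intro nn_integral_eq_integral) (auto simp: set_integrable_def indicator_def)
  also have "\<dots> = ennreal (u - l)"
    using indefinite_integral_bounds(1)[OF R Y \<open>p \<le> q\<close>] pq by simp
  finally show "emeasure (distr (density lborel (\<lambda>x. ennreal (R x))) borel Y) (box l u) =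
      ennreal (\<Prod>b\<in>Basis. (u - l) \<bullet> b)" by simp
qed simp

section \<open>The mass coordinate at a fixed time\<close>

lemma borel_measurable_lebesgue_if_set_integrable:
  fixes r :: "real \<Rightarrow> real"
  assumes "\<And>x1 x2. set_integrable lebesgue {x1..x2} r"
  shows "r \<in> borel_measurable lebesgue"
proof -
  have "(\<lambda>x. indicator {- real n..real n} x * r x) \<in> borel_measurable lebesgue" for n
    using assms[of "- real n" "real n"] unfolding set_integrable_def real_scaleR_def
    by (rule borel_measurable_integrable)
  moreover have "(\<lambda>n. indicator {- real n..real n} x * r x) \<longlonglongrightarrow> r x" for x
  proof (rule tendsto_eventually)
    obtain N :: nat where "\<bar>x\<bar> \<le> real N" using real_arch_simple by blast
    then have "x \<in> {- real n..real n}" if "N \<le> n" for n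
      using that by (auto simp: abs_le_iff intro: order_trans)
    then show "\<forall>\<^sub>F n in sequentially. indicator {- real n..real n} x * r x = r x"
      unfolding eventually_sequentially by (intro exI[of _ N] allI impI) simp
  qed
  ultimately show ?thesis
    by (rule borel_measurable_LIMSEQ_real[rotated])
qed

locale mass_profile =
  fixes r Y :: "real \<Rightarrow> real" and c \<delta> :: real
  assumes r_int: "\<And>x1 x2. set_integrable lebesgue {x1..x2} r"
    and r_bd: "\<And>x. \<delta> \<le> r x" "\<And>x. r x \<le> 1" and \<delta>: "0 < \<delta>"
    and Y: "\<And>x. Y x = (LINT z=c..x|lebesgue. r z)"
begin

text \<open>Clamping an almost everywhere equal Borel function to \<open>[\<delta>, 1]\<close> makes
  the bounds hold everywhere and changes nothing where it agrees with \<open>r\<close>, so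
  \<open>Y\<close> is its indefinite integral too. The summand 0 is the offset \<open>k\<close> of
  the general facts.\<close>

lemma borel_version:
  obtains R where "R \<in> borel_measurable borel" "\<And>x. \<delta> \<le> R x" "\<And>x. R x \<le> 1"
    "AE x in lborel. r x = R x" "\<And>x. Y x = 0 + (LBINT z=c..x. R z)"
proof -
  have r_meas: "r \<in> borel_measurable lebesgue"
    by (rule borel_measurable_lebesgue_if_set_integrable[OF r_int])
  obtain R0 where R0: "R0 \<in> borel_measurable lborel" "AE x in lborel. r x = R0 x"
    using completion_ex_borel_measurable_real[OF r_meas] by auto
  define R where "R x = max \<delta> (min 1 (R0 x))" for x
  have \<delta>1: "\<delta> \<le> 1" using r_bd[of 0] by simp
  have R: "R \<in> borel_measurable borel" "\<And>x. \<delta> \<le> R x" "\<And>x. R x \<le> 1"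
    using R0(1) \<delta>1 unfolding R_def[abs_def] by auto
  have ae: "AE x in lborel. r x = R x"
    using R0(2)
  proof eventually_elim
    case (elim x)
    then show ?case using r_bd[of x] by (auto simp: R_def)
  qed
  have set: "(LINT z:A|lebesgue. r z) = (LBINT z:A. R z)" if "A \<in> sets borel" for A
  proof -
    have "(LINT z:A|lebesgue. r z) = (LINT z:A|lebesgue. R z)"
      unfolding set_lebesgue_integral_def
    proof (rule integral_cong_AE)
      show "AE x in lebesgue. indicator A x *\<^sub>R r x = indicator A x *\<^sub>R R x"
        using AE_completion[OF ae] by eventually_elim simp
      have [measurable]: "A \<in> sets lebesgue" "R \<in> borel_measurable lebesgue"
        using that measurable_completion[of R lborel borel] R(1) by simp_all
      note [measurable] = r_meas
      show "(\<lambda>x. indicator A x *\<^sub>R r x) \<in> borel_measurable lebesgue"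
        "(\<lambda>x. indicator A x *\<^sub>R R x) \<in> borel_measurable lebesgue"
        by measurable
    qed
    also have "\<dots> = (LBINT z:A. R z)"
      unfolding set_lebesgue_integral_def using that R by (intro integral_completion) simp
    finally show ?thesis .
  qed
  have "Y x = 0 + (LBINT z=c..x. R z)" for x
    by (simp add: Y interval_lebesgue_integral_def set)
  then show ?thesis using that R ae by blast
qed

lemma Y_measurable [measurable]: "Y \<in> borel_measurable borel"
proof -
  obtain R where "R \<in> borel_measurable borel" "\<And>x. \<delta> \<le> R x" "\<And>x. R x \<le> 1"
    "AE x in lborel. r x = R x" "\<And>x. Y x = 0 + (LBINT z=c..x. R z)" by (rule borel_version) blast
  then show ?thesis by (metis indefinite_integral_continuous borel_measurable_continuous_onI)
qed

lemma Y_surj: "\<exists>x. Y x = y"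
proof -
  obtain R where R: "R \<in> borel_measurable borel" "\<And>x. \<delta> \<le> R x" "\<And>x. R x \<le> 1"
    and "AE x in lborel. r x = R x" and YR: "\<And>x. Y x = 0 + (LBINT z=c..x. R z)"
    by (rule borel_version) blast
  show ?thesis by (rule indefinite_integral_surj[OF R \<delta> YR])
qed

text \<open>By the pushforward, the preimage of the exceptional set has zero mass; the density is at
  least \<delta>, so zero mass means zero length.\<close>

lemma AE_pullback:
  assumes "AE y in lborel. Q y"
  shows "AE x in lborel. Q (Y x)"
proof -
  obtain R where R: "R \<in> borel_measurable borel" "\<And>x. \<delta> \<le> R x" "\<And>x. R x \<le> 1"
    and rR: "AE x in lborel. r x = R x" and YR: "\<And>x. Y x = 0 + (LBINT z=c..x. R z)"
    by (rule borel_version) blast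
  note [measurable] = R(1)
  have "AE y in distr (density lborel (\<lambda>x. ennreal (R x))) borel Y. Q y"
    unfolding distr_indefinite_integral[OF R \<delta> YR] by (rule assms)
  then have "AE x in density lborel (\<lambda>x. ennreal (R x)). Q (Y x)"
    by (rule AE_distrD[rotated]) simp
  then have "AE x in lborel. 0 < ennreal (R x) \<longrightarrow> Q (Y x)"
    by (simp add: AE_density)
  then show ?thesis
  proof eventually_elim
    case (elim x)
    then show ?case using R(2)[of x] \<delta> by simp
  qed
qed

end

text \<open>\<open>w\<close> is the Lagrangian density at the fixed time, tied to \<open>r\<close>
  pointwise along \<open>Y\<close>, and \<open>W\<close> is a Borel version of it. Position has
  slope \<open>1 / w\<close> with respect to mass, which makes \<open>G\<close> the candidate for
  the inverse of \<open>Y\<close>.\<close>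

locale mass_coordinate = mass_profile +
  fixes w W G :: "real \<Rightarrow> real"
  assumes W: "W \<in> borel_measurable borel" "\<And>y. \<delta> \<le> W y" "\<And>y. W y \<le> 1"
    and wW: "AE y in lborel. w y = W y"
    and wr: "\<And>x. w (Y x) = r x"
    and G: "\<And>y. G y = c + (LBINT s=(0::real)..y. 1 / W s)"
begin

lemma r_eq: "AE x in lborel. r x = W (Y x)"
  and distr_Y: "distr (density lborel (\<lambda>x. ennreal (W (Y x)))) borel Y = lborel"
proof -
  obtain R where R: "R \<in> borel_measurable borel" "\<And>x. \<delta> \<le> R x" "\<And>x. R x \<le> 1"
    and rR: "AE x in lborel. r x = R x" and YR: "\<And>x. Y x = 0 + (LBINT z=c..x. R z)"
    by (rule borel_version) blast
  note [measurable] = R(1) W(1)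
  note D = distr_indefinite_integral[OF R \<delta> YR]
  show *: "AE x in lborel. r x = W (Y x)"
    using AE_pullback[OF wW] by (simp add: wr)
  have "density lborel (\<lambda>x. ennreal (W (Y x))) = density lborel (\<lambda>x. ennreal (R x))"
    by (rule density_cong) (use * rR in \<open>auto elim!: eventually_elim2\<close>)
  then show "distr (density lborel (\<lambda>x. ennreal (W (Y x)))) borel Y = lborel"
    using D by simp
qed

lemma change_of_variables:
  fixes f :: "real \<Rightarrow> real"
  assumes [measurable]: "f \<in> borel_measurable borel"
  shows "(LBINT x. f (Y x) * W (Y x)) = (LBINT y. f y)"
proof -
  note [measurable] = W(1)
  have nn: "AE x in lborel. 0 \<le> W (Y x)" using W(2) \<delta> by (intro AE_I2) (meson order_trans less_imp_le)
  have "(LBINT y. f y) = integral\<^sup>L (distr (density lborel (\<lambda>x. ennreal (W (Y x)))) borel Y) f"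
    by (simp only: distr_Y)
  also have "\<dots> = (LBINT x. f (Y x) * W (Y x))"
    using nn by (simp add: integral_distr integral_density mult.commute)
  finally show ?thesis ..
qed

lemma W_inverse: "(\<lambda>y. 1 / W y) \<in> borel_measurable borel" "1 \<le> 1 / W y" "1 / W y \<le> 1 / \<delta>"
proof -
  show "(\<lambda>y. 1 / W y) \<in> borel_measurable borel" using W(1) by measurable
  have "0 < W y" using W(2)[of y] \<delta> by linarith
  then show "1 \<le> 1 / W y" "1 / W y \<le> 1 / \<delta>"
    using W(2,3)[of y] \<delta> by (auto simp: divide_simps)
qed

text \<open>Substituting \<open>s = Y x\<close> in the integral of \<open>1 / W\<close> over
  \<open>[Y p, Y q]\<close> brings in the factor \<open>W (Y x)\<close>, which cancels and leaves
  \<open>q - p\<close>. So \<open>G\<close> after \<open>Y\<close> is a translation, and it fixes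
  the base point \<open>c\<close>, where the mass is 0. Surjectivity of \<open>Y\<close> turns the
  left inverse into a right inverse.\<close>

lemma G_Y: "G (Y x) = x" and Y_G: "Y (G y) = y"
proof -
  obtain R where R: "R \<in> borel_measurable borel" "\<And>x. \<delta> \<le> R x" "\<And>x. R x \<le> 1"
    and rR: "AE x in lborel. r x = R x" and YR: "\<And>x. Y x = 0 + (LBINT z=c..x. R z)"
    by (rule borel_version) blast
  note [measurable] = R(1) W(1)
  have mono: "x < y \<Longrightarrow> Y x < Y y" for x y
    using indefinite_integral_bounds(2)[OF R YR, of x y] mult_pos_pos[OF \<delta>, of "y - x"] by simp
  have diff: "G (Y q) - G (Y p) = q - p" if "p \<le> q" for p q
  proof -
    have "Y p \<le> Y q" using mono[of p q] that by (cases "p = q") auto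
    have iff: "Y x \<in> {Y p..Y q} \<longleftrightarrow> x \<in> {p..q}" for x
      using mono by (auto simp: not_less[symmetric])  (metis linorder_neqE_linordered_idom not_less_iff_gr_or_eq)+
    have "G (Y q) - G (Y p) = (LBINT s:{Y p..Y q}. 1 / W s)"
      by (rule indefinite_integral_bounds(1)[OF W_inverse G \<open>Y p \<le> Y q\<close>])
    also have "\<dots> = (LBINT x. (indicator {Y p..Y q} (Y x) * (1 / W (Y x))) * W (Y x))"
      unfolding set_lebesgue_integral_def real_scaleR_def
      by (rule change_of_variables[symmetric]) simp
    also have "\<dots> = (LBINT x. indicator {p..q} x)"
    proof (rule Bochner_Integration.integral_cong)
      fix x
      have "W (Y x) \<noteq> 0" using W(2)[of "Y x"] \<delta> by linarith
      then show "indicator {Y p..Y q} (Y x) * (1 / W (Y x)) * W (Y x) = (indicator {p..q} x :: real)"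
        by (simp only: indicator_def iff) simp
    qed simp
    also have "\<dots> = q - p" using that by simp
    finally show ?thesis .
  qed
  have "Y c = 0" by (simp add: YR)
  then have "G (Y c) = c" by (simp add: G)
  then show GY: "G (Y x) = x" for x
    using diff[of c x] diff[of x c] by (cases "c \<le> x") auto
  show "Y (G y) = y"
    using indefinite_integral_surj[OF R \<delta> YR, of y] GY by auto
qed

end

section \<open>Lebesgue measure on the plane\<close>

lemma box_Fubini:
  fixes f :: "real \<times> real \<Rightarrow> real"
  assumes [measurable]: "f \<in> borel_measurable borel"
    and bd: "\<And>y t. y \<in> {a..b} \<Longrightarrow> t \<in> {c..d} \<Longrightarrow> \<bar>f (y, t)\<bar> \<le> C"
  shows "set_integrable lborel ({a..b} \<times> {c..d}) f"
    and "(LINT z:{a..b} \<times> {c..d}|lborel. f z) = (LBINT y:{a..b}. LBINT t:{c..d}. f (y, t))"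
    and "(LINT z:{a..b} \<times> {c..d}|lborel. f z) = (LBINT t:{c..d}. LBINT y:{a..b}. f (y, t))"
proof -
  let ?g = "\<lambda>y t. indicator {a..b} y * (indicator {c..d} t * f (y, t))"
  have ind: "indicator ({a..b} \<times> {c..d}) z = (indicator {a..b} (fst z) * indicator {c..d} (snd z) :: real)"
    for z :: "real \<times> real"
    by (cases z) (auto simp: indicator_def)
  have K: "{a..b} \<times> {c..d} = cbox (a, c) (b, d)" by (auto simp: cbox_Pair_eq)
  have [measurable]: "{a..b} \<times> {c..d} \<in> sets borel" unfolding K by simp
  show *: "set_integrable lborel ({a..b} \<times> {c..d}) f"
    unfolding set_integrable_def K using bd
    by (intro integrable_bounded_support[of _ "(a, c)" "(b, d)" C]) (auto simp flip: K)
  then have int: "integrable (lborel \<Otimes>\<^sub>M lborel) (\<lambda>(y, t). ?g y t)"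
    unfolding set_integrable_def lborel_prod ind by (simp add: case_prod_unfold mult.assoc)
  have eq: "(LINT z:{a..b} \<times> {c..d}|lborel. f z) = integral\<^sup>L (lborel \<Otimes>\<^sub>M lborel) (\<lambda>(y, t). ?g y t)"
    unfolding set_lebesgue_integral_def lborel_prod ind by (simp add: case_prod_unfold mult.assoc)
  have "integral\<^sup>L (lborel \<Otimes>\<^sub>M lborel) (\<lambda>(y, t). ?g y t) = (LBINT y. LBINT t. ?g y t)"
    using lborel_pair.integral_fst'[OF int] by simp
  then show "(LINT z:{a..b} \<times> {c..d}|lborel. f z) = (LBINT y:{a..b}. LBINT t:{c..d}. f (y, t))"
    unfolding eq by (simp add: set_lebesgue_integral_def)
  have "integral\<^sup>L (lborel \<Otimes>\<^sub>M lborel) (\<lambda>(y, t). ?g y t) = (LBINT t. LBINT y. ?g y t)"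
    using lborel_pair.integral_snd[OF int] by simp
  also have "\<dots> = (LBINT t:{c..d}. LBINT y:{a..b}. f (y, t))"
    unfolding set_lebesgue_integral_def
    by (simp add: mult.left_commute[of "indicator {a..b} _"])
  finally show "(LINT z:{a..b} \<times> {c..d}|lborel. f z) = (LBINT t:{c..d}. LBINT y:{a..b}. f (y, t))"
    unfolding eq .
qed

text \<open>
  If \<open>f\<close> has zero integral over every box, then the density \<open>1 + f / C \<ge> 0\<close> gives every box its volume,
  so it is the density of Lebesgue measure itself.
\<close>

lemma AE_zero_if_box_integrals_zero:
  fixes f :: "'a::euclidean_space \<Rightarrow> real"
  assumes [measurable]: "f \<in> borel_measurable borel" and bd: "\<And>z. \<bar>f z\<bar> \<le> C"
    and int: "integrable lborel f" and box: "\<And>l u. (LINT z:box l u|lborel. f z) = 0"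
  shows "AE z in lborel. f z = 0"
proof -
  define K where "K = C + 1"
  have K: "K > 0" using bd[of undefined] by (simp add: K_def)
  have le: "\<bar>f z\<bar> \<le> K" for z using bd[of z] by (simp add: K_def)
  have nn: "0 \<le> 1 + f z / K" for z using le[of z] K by (auto simp: divide_simps)
  define D where "D = density lborel (\<lambda>z. ennreal (1 + f z / K))"
  have "lborel = D"
  proof (rule lborel_eqI)
    fix l u :: 'a assume lu: "\<And>b. b \<in> Basis \<Longrightarrow> l \<bullet> b \<le> u \<bullet> b"
    have fin: "emeasure lborel (box l u) \<noteq> \<infinity>" using emeasure_lborel_box_finite[of l u] by auto
    have i1: "integrable lborel (\<lambda>z. indicator (box l u) z * 1 :: real)"
      using fin by (auto simp: integrable_real_indicator top.not_eq_extremum)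
    have i2: "integrable lborel (\<lambda>z. indicator (box l u) z * f z)"
      using integrable_mult_indicator[OF _ int, of "box l u"] by simp
    have "emeasure D (box l u) = (\<integral>\<^sup>+z. ennreal (1 + f z / K) * indicator (box l u) z \<partial>lborel)"
      by (simp add: D_def emeasure_density)
    also have "\<dots> = (\<integral>\<^sup>+z. ennreal (indicator (box l u) z * 1 + (indicator (box l u) z * f z) / K) \<partial>lborel)"
      by (intro nn_integral_cong) (auto simp: indicator_def)
    also have "\<dots> = ennreal (LINT z|lborel. indicator (box l u) z * 1 + (indicator (box l u) z * f z) / K)"
      using i1 i2 nn by (intro nn_integral_eq_integral) (auto simp: indicator_def)
    also have "(LINT z|lborel. indicator (box l u) z * 1 + (indicator (box l u) z * f z) / K)
        = measure lborel (box l u) + 0 / K"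
    proof -
      have "(LINT z|lborel. indicator (box l u) z * f z) = 0"
        using box[of l u] by (simp add: set_lebesgue_integral_def)
      then show ?thesis using i1 i2 by simp
    qed
    also have "ennreal (measure lborel (box l u) + 0 / K) = (\<Prod>b\<in>Basis. (u - l) \<bullet> b)"
      using lu by (simp add: measure_lborel_box)
    finally show "emeasure D (box l u) = ennreal (\<Prod>b\<in>Basis. (u - l) \<bullet> b)" .
  qed (simp add: D_def)
  then have "density lborel (\<lambda>z. 1) = density lborel (\<lambda>z. ennreal (1 + f z / K))"
    by (simp add: D_def density_1)
  then have "AE z in lborel. 1 = ennreal (1 + f z / K)"
    by (rule sigma_finite_measure.density_unique[OF sigma_finite_lborel, rotated 2]) auto
  then show ?thesis
  proof eventually_elim
    case (elim z)
    then have "1 + f z / K = 1" using nn[of z] by (metis ennreal_1 ennreal_inj zero_le_one)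
    then show ?case using K by simp
  qed
qed

text \<open>The bound is left anonymous: the integrands are sums and products of many factors, and
  for integrability on a rectangle only the existence of a dominating constant matters.\<close>

definition bdd_on :: "'a set \<Rightarrow> ('a \<Rightarrow> real) \<Rightarrow> bool" where
  "bdd_on K f \<longleftrightarrow> (\<exists>C. \<forall>z\<in>K. \<bar>f z\<bar> \<le> C)"

lemma bdd_onI: "(\<And>z. z \<in> K \<Longrightarrow> \<bar>f z\<bar> \<le> C) \<Longrightarrow> bdd_on K f"
  by (auto simp: bdd_on_def)

lemma bdd_on_add: "bdd_on K f \<Longrightarrow> bdd_on K g \<Longrightarrow> bdd_on K (\<lambda>z. f z + g z)"
proof -
  assume "bdd_on K f" "bdd_on K g"
  then obtain C D where "\<And>z. z \<in> K \<Longrightarrow> \<bar>f z\<bar> \<le> C" "\<And>z. z \<in> K \<Longrightarrow> \<bar>g z\<bar> \<le> D"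
    by (auto simp: bdd_on_def)
  then have "\<bar>f z + g z\<bar> \<le> C + D" if "z \<in> K" for z
    using that by (intro order_trans[OF abs_triangle_ineq] add_mono) auto
  then show ?thesis by (rule bdd_onI)
qed

lemma bdd_on_mult: "bdd_on K f \<Longrightarrow> bdd_on K g \<Longrightarrow> bdd_on K (\<lambda>z. f z * g z)"
proof -
  assume "bdd_on K f" "bdd_on K g"
  then obtain C D where "\<And>z. z \<in> K \<Longrightarrow> \<bar>f z\<bar> \<le> C" "\<And>z. z \<in> K \<Longrightarrow> \<bar>g z\<bar> \<le> D"
    by (auto simp: bdd_on_def)
  then have "\<bar>f z * g z\<bar> \<le> C * D" if "z \<in> K" for z
    using that unfolding abs_mult by (intro mult_mono) (auto intro: order_trans[OF abs_ge_zero])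
  then show ?thesis by (rule bdd_onI)
qed

lemma bdd_on_minus: "bdd_on K f \<Longrightarrow> bdd_on K (\<lambda>z. - f z)"
  by (simp add: bdd_on_def)

lemma bdd_on_diff: "bdd_on K f \<Longrightarrow> bdd_on K g \<Longrightarrow> bdd_on K (\<lambda>z. f z - g z)"
  using bdd_on_add[OF _ bdd_on_minus, of K f g] by simp

lemma bdd_on_abs: "bdd_on K f \<Longrightarrow> bdd_on K (\<lambda>z. \<bar>f z\<bar>)"
  by (simp add: bdd_on_def)

lemma bdd_on_const: "bdd_on K (\<lambda>z. c)"
  by (rule bdd_onI[where C = "\<bar>c\<bar>"]) simp

lemma bdd_on_continuous:
  assumes "compact K" "continuous_on K f" shows "bdd_on K f"
  using compact_imp_bounded[OF compact_continuous_image[OF assms(2,1)]]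
  by (auto simp: bdd_on_def bounded_iff)

lemma bdd_on_fst:
  fixes f :: "real \<Rightarrow> real"
  assumes "continuous_on UNIV f" shows "bdd_on ({a..b} \<times> K) (\<lambda>z. f (fst z))"
proof -
  have "bdd_on {a..b} f" by (rule bdd_on_continuous) (auto intro: continuous_on_subset[OF assms])
  then show ?thesis by (auto simp: bdd_on_def)
qed

lemma bdd_on_snd:
  fixes f :: "real \<Rightarrow> real"
  assumes "continuous_on UNIV f" shows "bdd_on (K \<times> {a..b}) (\<lambda>z. f (snd z))"
proof -
  have "bdd_on {a..b} f" by (rule bdd_on_continuous) (auto intro: continuous_on_subset[OF assms])
  then show ?thesis by (auto simp: bdd_on_def)
qed

lemmas bdd_on_intros = bdd_on_add bdd_on_mult bdd_on_minus bdd_on_diff bdd_on_abs bdd_on_const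

lemma box_Fubini_bdd_on:
  fixes f :: "real \<times> real \<Rightarrow> real"
  assumes "f \<in> borel_measurable borel" "bdd_on ({a..b} \<times> {c..d}) f"
  shows "set_integrable lborel ({a..b} \<times> {c..d}) f"
    and "(LINT z:{a..b} \<times> {c..d}|lborel. f z) = (LBINT y:{a..b}. LBINT t:{c..d}. f (y, t))"
    and "(LINT z:{a..b} \<times> {c..d}|lborel. f z) = (LBINT t:{c..d}. LBINT y:{a..b}. f (y, t))"
proof -
  obtain C where "\<And>y t. y \<in> {a..b} \<Longrightarrow> t \<in> {c..d} \<Longrightarrow> \<bar>f (y, t)\<bar> \<le> C"
    using assms(2) unfolding bdd_on_def by blast
  note * = box_Fubini[OF assms(1) this]
  show "set_integrable lborel ({a..b} \<times> {c..d}) f"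
    and "(LINT z:{a..b} \<times> {c..d}|lborel. f z) = (LBINT y:{a..b}. LBINT t:{c..d}. f (y, t))"
    and "(LINT z:{a..b} \<times> {c..d}|lborel. f z) = (LBINT t:{c..d}. LBINT y:{a..b}. f (y, t))"
    using * by auto
qed

section \<open>Null sets of the plane, and the passage from Lebesgue to Borel measurable
  functions\<close>

lemma borel_measurable_fst_snd [measurable]:
  "fst \<in> borel_measurable (borel :: (real \<times> real) measure)"
  "snd \<in> borel_measurable (borel :: (real \<times> real) measure)"
  by (auto intro!: borel_measurable_continuous_onI continuous_intros)

text \<open>\<open>Q\<close> may fail to be measurable, so Fubini is applied to a Borel null set
  containing its exceptional set.\<close>

lemma AE_lborel_sections:
  fixes Q :: "real \<times> real \<Rightarrow> bool"
  assumes "AE z in lborel. Q z"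
  shows "AE y in lborel. AE t in lborel. Q (y, t)" "AE t in lborel. AE y in lborel. Q (y, t)"
proof -
  obtain N where N: "N \<in> null_sets lborel" "{z \<in> space lborel. \<not> Q z} \<subseteq> N"
    using assms by (auto elim!: AE_E simp: null_sets_def)
  then have [measurable]: "N \<in> sets borel" by (simp add: null_sets_def)
  have ae: "AE z in lborel \<Otimes>\<^sub>M lborel. z \<notin> N"
    unfolding lborel_prod by (rule AE_not_in[OF N(1)])
  have "AE y in lborel. AE t in lborel. (y, t) \<notin> N"
    using lborel_pair.AE_pair[OF ae] by simp
  moreover have "(AE y in lborel. AE t in lborel. (y, t) \<notin> N) \<longleftrightarrow> (AE t in lborel. AE y in lborel. (y, t) \<notin> N)"
  proof (rule lborel_pair.AE_commute)
    have "{x \<in> space (lborel \<Otimes>\<^sub>M lborel). (fst x, snd x) \<notin> N} = - N"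
      by (auto simp: space_pair_measure)
    then show "{x \<in> space (lborel \<Otimes>\<^sub>M lborel). (fst x, snd x) \<notin> N} \<in> sets (lborel \<Otimes>\<^sub>M lborel)"
      unfolding lborel_prod by simp
  qed
  ultimately have ae': "AE y in lborel. AE t in lborel. (y, t) \<notin> N" "AE t in lborel. AE y in lborel. (y, t) \<notin> N"
    by auto
  have Q: "z \<notin> N \<Longrightarrow> Q z" for z using N(2) by auto
  show "AE y in lborel. AE t in lborel. Q (y, t)"
    using ae'(1) by (rule eventually_mono) (erule eventually_mono, rule Q)
  show "AE t in lborel. AE y in lborel. Q (y, t)"
    using ae'(2) by (rule eventually_mono) (erule eventually_mono, rule Q)
qed

text \<open>Null sections control a set only if it is measurable. For this reason exceptional sets
  are enlarged to Borel sets, and the preimages of these are checked to be Borel before this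
  direction of Fubini is used.\<close>

lemma AE_lborel_if_sections:
  fixes N :: "(real \<times> real) set"
  assumes N: "N \<in> sets borel"
  shows "(AE y in lborel. AE t in lborel. (y, t) \<notin> N) \<Longrightarrow> AE z in lborel. z \<notin> N"
    and "(AE t in lborel. AE y in lborel. (y, t) \<notin> N) \<Longrightarrow> AE z in lborel. z \<notin> N"
proof -
  have "{x \<in> space (lborel \<Otimes>\<^sub>M lborel). (fst x, snd x) \<notin> N} = - N"
    by (auto simp: space_pair_measure)
  then have m: "{x \<in> space (lborel \<Otimes>\<^sub>M lborel). (fst x, snd x) \<notin> N} \<in> sets (lborel \<Otimes>\<^sub>M lborel)"
    unfolding lborel_prod using N by simp
  show 1: "AE z in lborel. z \<notin> N" if "AE y in lborel. AE t in lborel. (y, t) \<notin> N"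
  proof -
    have "AE x in (lborel \<Otimes>\<^sub>M lborel). (fst x, snd x) \<notin> N"
      using lborel_pair.AE_pair_iff[OF m] that by blast
    then show ?thesis unfolding lborel_prod by simp
  qed
  show "AE z in lborel. z \<notin> N" if "AE t in lborel. AE y in lborel. (y, t) \<notin> N"
    using lborel_pair.AE_commute[OF m] that by (intro 1) blast
qed

lemma AE_lborel_borel_null_set:
  fixes Q :: "'a::euclidean_space \<Rightarrow> bool"
  assumes "AE z in lborel. Q z"
  obtains N where "N \<in> sets borel" "AE z in lborel. z \<notin> N" "\<And>z. z \<notin> N \<Longrightarrow> Q z"
proof -
  obtain N where N: "N \<in> null_sets lborel" "{z \<in> space lborel. \<not> Q z} \<subseteq> N"
    using assms by (auto elim!: AE_E simp: null_sets_def)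
  then show ?thesis using AE_not_in[OF N(1)] that[of N] by (auto simp: null_sets_def)
qed

lemma AE_lborel_fst_snd:
  assumes "AE t in lborel. Q (t :: real)"
  shows "AE z in lborel. Q (snd (z :: real \<times> real))" "AE z in lborel. Q (fst (z :: real \<times> real))"
proof -
  obtain N where N: "N \<in> sets borel" "AE z in lborel. z \<notin> N" "\<And>z. z \<notin> N \<Longrightarrow> Q z"
    using AE_lborel_borel_null_set[OF assms] by blast
  have "snd -` N \<in> sets (borel :: (real \<times> real) measure)" "fst -` N \<in> sets (borel :: (real \<times> real) measure)"
    using measurable_sets_borel[OF borel_measurable_fst_snd(2) N(1)]
      measurable_sets_borel[OF borel_measurable_fst_snd(1) N(1)] by auto
  note m = this
  have "AE z in lborel. z \<notin> (snd -` N :: (real \<times> real) set)"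
    by (rule AE_lborel_if_sections(1)[OF m(1)]) (use N(2) in auto)
  then show "AE z in lborel. Q (snd (z :: real \<times> real))" by eventually_elim (auto intro: N(3))
  have "AE z in lborel. z \<notin> (fst -` N :: (real \<times> real) set)"
    by (rule AE_lborel_if_sections(2)[OF m(2)]) (use N(2) in auto)
  then show "AE z in lborel. Q (fst (z :: real \<times> real))" by eventually_elim (auto intro: N(3))
qed

lemma borel_measurable_lebesgue_AE_eq:
  fixes f g :: "'a::euclidean_space \<Rightarrow> real"
  assumes g: "g \<in> borel_measurable borel" and eq: "AE z in lborel. f z = g z"
  shows "f \<in> borel_measurable lebesgue"
proof (rule borel_measurableI)
  fix S :: "real set" assume "open S"
  have gl: "g \<in> borel_measurable lebesgue" using measurable_completion[of g lborel borel] g by simp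
  show "f -` S \<inter> space lebesgue \<in> sets lebesgue"
  proof (rule completion.in_sets_AE)
    show "g -` S \<inter> space lebesgue \<in> sets lebesgue"
      using gl \<open>open S\<close> by (intro measurable_sets[where A = borel]) auto
    show "AE z in lebesgue. z \<in> g -` S \<inter> space lebesgue \<longleftrightarrow> z \<in> f -` S \<inter> space lebesgue"
      using AE_completion[OF eq] by eventually_elim simp
  qed simp
qed

lemma integral_lebesgue_eq_lborel:
  fixes f g :: "'a::euclidean_space \<Rightarrow> real"
  assumes g: "g \<in> borel_measurable borel" and eq: "AE z in lborel. f z = g z"
  shows "(LINT z|lebesgue. f z) = (LINT z|lborel. g z)"
    and "integrable lebesgue f \<longleftrightarrow> integrable lborel g"
proof -
  have m: "f \<in> borel_measurable lebesgue" "g \<in> borel_measurable lebesgue"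
    using borel_measurable_lebesgue_AE_eq[OF g] eq by auto
  have "(LINT z|lebesgue. f z) = (LINT z|lebesgue. g z)"
    by (rule integral_cong_AE[OF m AE_completion[OF eq]])
  then show "(LINT z|lebesgue. f z) = (LINT z|lborel. g z)"
    using integral_completion[of g lborel] g by simp
  have "integrable lebesgue f \<longleftrightarrow> integrable lebesgue g"
    by (rule integrable_cong_AE[OF m AE_completion[OF eq]])
  then show "integrable lebesgue f \<longleftrightarrow> integrable lborel g"
    using integrable_completion[of g lborel] g by simp
qed

text \<open>The weak formulations are stated with Lebesgue measure and Lebesgue measurable
  functions, while the arguments run on Borel representatives; this is the bridge, and agreement is
  asked for only on the domain of integration.\<close>

lemma set_integral_lebesgue_eq_lborel:
  fixes f g :: "'a::euclidean_space \<Rightarrow> real"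
  assumes g: "g \<in> borel_measurable borel" and S: "S \<in> sets borel"
    and eq: "AE z in lborel. z \<in> S \<longrightarrow> f z = g z"
  shows "(LINT z:S|lebesgue. f z) = (LINT z:S|lborel. g z)"
    and "set_integrable lebesgue S f \<longleftrightarrow> set_integrable lborel S g"
proof -
  have m: "(\<lambda>z. indicator S z *\<^sub>R g z) \<in> borel_measurable borel" using g S by measurable
  have ae: "AE z in lborel. indicator S z *\<^sub>R f z = indicator S z *\<^sub>R g z"
    using eq by eventually_elim (auto simp: indicator_def)
  show "(LINT z:S|lebesgue. f z) = (LINT z:S|lborel. g z)"
    "set_integrable lebesgue S f \<longleftrightarrow> set_integrable lborel S g"
    unfolding set_lebesgue_integral_def set_integrable_def
    using integral_lebesgue_eq_lborel[OF m ae] by auto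
qed

lemma loc_integrable_on_bounded:
  fixes f g :: "'a::euclidean_space \<Rightarrow> real"
  assumes g: "g \<in> borel_measurable borel" "\<And>z. \<bar>g z\<bar> \<le> C"
    and eq: "AE z in lborel. z \<in> S \<longrightarrow> f z = g z"
  shows "loc_integrable_on S f"
  unfolding loc_integrable_on_def
proof (intro allI impI)
  fix K assume K: "compact K \<and> K \<subseteq> S"
  then have Kb: "K \<in> sets borel" by (auto intro: borel_compact)
  obtain a b where ab: "K \<subseteq> cbox a b" using K compact_imp_bounded bounded_subset_cbox_symmetric by metis
  have "set_integrable lborel K g"
    unfolding set_integrable_def
    using g Kb ab order_trans[OF abs_ge_zero g(2)]
    by (intro integrable_bounded_support[of _ a b C]) (auto simp: indicator_def)
  moreover have "AE z in lborel. z \<in> K \<longrightarrow> f z = g z" using eq K by (auto elim!: eventually_mono)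
  ultimately show "set_integrable lebesgue K f"
    using set_integral_lebesgue_eq_lborel(2)[OF g(1) Kb] by blast
qed

section \<open>Transport in Lagrangian coordinates\<close>

text \<open>
  A list of weighted nodes \<open>(c, p)\<close> encodes the function \<open>\<Sum> c (x - p)\<^sup>+\<close>; it has compact
  support if \<open>\<Sum> c = 0\<close> and \<open>\<Sum> c p = 0\<close>.
\<close>

lemma smooth_approx_of_ramps:
  fixes xs :: "(real \<times> real) list"
  assumes "(\<Sum>(c, p)\<leftarrow>xs. c) = 0" "(\<Sum>(c, p)\<leftarrow>xs. c * p) = 0"
    and M: "\<And>c p. (c, p) \<in> set xs \<Longrightarrow> \<bar>p\<bar> + 1 \<le> M"
  obtains \<kappa> \<kappa>' :: "nat \<Rightarrow> real \<Rightarrow> real"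
  where "\<And>n k. nsmooth k (\<kappa> n)" "\<And>n x. (\<kappa> n has_real_derivative \<kappa>' n x) (at x)"
    "\<And>n. continuous_on UNIV (\<kappa>' n)"
    "\<And>n x. \<bar>x\<bar> \<ge> M \<Longrightarrow> \<kappa> n x = 0" "\<And>n x. \<bar>x\<bar> \<ge> M \<Longrightarrow> \<kappa>' n x = 0"
    "\<And>n x. \<bar>\<kappa>' n x\<bar> \<le> (\<Sum>(c, p)\<leftarrow>xs. \<bar>c\<bar>)"
    "\<And>x. (\<lambda>n. \<kappa>' n x) \<longlonglongrightarrow> (\<Sum>(c, p)\<leftarrow>xs. c * of_bool (p < x))"
proof -
  obtain H h :: "real \<Rightarrow> real" and e
    where H: "\<And>k. nsmooth k H" "\<And>k. nsmooth k h" "\<And>x. (H has_real_derivative h x) (at x)"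
      "\<And>x. 0 \<le> h x" "\<And>x. h x \<le> 1" "\<And>x. x \<le> 0 \<Longrightarrow> H x = 0" "\<And>x. x \<le> 0 \<Longrightarrow> h x = 0"
      "\<And>x. x \<ge> 1 \<Longrightarrow> H x = x - e" "\<And>x. x \<ge> 1 \<Longrightarrow> h x = 1"
    by (rule smooth_ramp) blast
  define N where "N n = real (Suc n)" for n
  have N: "N n \<ge> 1" for n by (simp add: N_def)
  \<comment> \<open>The ramps are compressed to width \<open>1 / N n\<close>; dividing by
    \<open>N n\<close> preserves the slopes \<open>c\<close>, so the limit has the prescribed
    kinks.\<close>
  define \<kappa> where "\<kappa> n x = (\<Sum>(c, p)\<leftarrow>xs. c / N n * H (N n * x + - (N n * p)))" for n x
  define \<kappa>' where "\<kappa>' n x = (\<Sum>(c, p)\<leftarrow>xs. c * h (N n * x + - (N n * p)))" for n x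
  show ?thesis
  proof (rule that[of \<kappa> \<kappa>'])
    show "nsmooth k (\<kappa> n)" for n k
      unfolding \<kappa>_def[abs_def]
    proof (induction xs)
      case (Cons cp ys)
      obtain c p where cp: "cp = (c, p)" by (cases cp)
      have "nsmooth k (\<lambda>x. c / N n * H (N n * x + - (N n * p)))"
        by (intro nsmooth_mult nsmooth_const nsmooth_affine H(1))
      from nsmooth_add[OF this Cons] show ?case by (simp add: cp)
    qed (simp add: nsmooth_const)
    show "(\<kappa> n has_real_derivative \<kappa>' n x) (at x)" for n x
      unfolding \<kappa>_def[abs_def] \<kappa>'_def
    proof (induction xs)
      case (Cons cp ys)
      obtain c p where cp: "cp = (c, p)" by (cases cp)
      have "((\<lambda>x. H (N n * x + - (N n * p))) has_real_derivative h (N n * x + - (N n * p)) * N n) (at x)"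
        by (rule DERIV_chain2[OF H(3)]) (auto intro!: derivative_eq_intros)
      from DERIV_add[OF DERIV_cmult[OF this, of "c / N n"] Cons]
      show ?case using N[of n] by (simp add: cp)
    qed simp
    show "continuous_on UNIV (\<kappa>' n)" for n
    proof -
      have "nsmooth 0 (\<kappa>' n)"
        unfolding \<kappa>'_def[abs_def]
      proof (induction xs)
        case (Cons cp ys)
        obtain c p where cp: "cp = (c, p)" by (cases cp)
        have "nsmooth 0 (\<lambda>x. c * h (N n * x + - (N n * p)))"
          by (intro nsmooth_mult nsmooth_const nsmooth_affine H(2))
        from nsmooth_add[OF this Cons] show ?case by (simp add: cp del: nsmooth.simps)
      qed (simp add: nsmooth_const)
      then show ?thesis by simp
    qed
    show "\<kappa> n x = 0" "\<kappa>' n x = 0" if "\<bar>x\<bar> \<ge> M" for n x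
    proof -
      have "x \<le> - M \<or> M \<le> x" using that by linarith
      then have "\<kappa> n x = 0 \<and> \<kappa>' n x = 0"
      proof
        assume 1: "x \<le> - M"
        then have "N n * x + - (N n * p) \<le> 0" if "(c, p) \<in> set xs" for c p
          using M[OF that] N[of n] by (auto intro!: mult_left_mono)
        then have *: "map (\<lambda>(c, p). c / N n * H (N n * x + - (N n * p))) xs = map (\<lambda>_. 0) xs"
            "map (\<lambda>(c, p). c * h (N n * x + - (N n * p))) xs = map (\<lambda>_. 0) xs"
          using H(6,7) by auto
        show ?thesis unfolding \<kappa>_def \<kappa>'_def * by simp
      next
        assume 2: "M \<le> x"
        have *: "N n * x + - (N n * p) \<ge> 1" if "(c, p) \<in> set xs" for c p
        proof -
          have "x - p \<ge> 1" using M[OF that] 2 by linarith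
          then have "1 * 1 \<le> N n * (x - p)" using N[of n] by (intro mult_mono) auto
          then show ?thesis by (simp add: algebra_simps)
        qed
        have **: "map (\<lambda>(c, p). c / N n * H (N n * x + - (N n * p))) xs
              = map (\<lambda>(c, p). (x - e / N n) * c - c * p) xs"
            "map (\<lambda>(c, p). c * h (N n * x + - (N n * p))) xs = map (\<lambda>(c, p). c) xs"
        proof -
          have "c / N n * H (N n * x + - (N n * p)) = (x - e / N n) * c - c * p" if "(c, p) \<in> set xs" for c p
            unfolding H(8)[OF *[OF that]] using N[of n] by (simp add: field_simps)
          then show "map (\<lambda>(c, p). c / N n * H (N n * x + - (N n * p))) xs
              = map (\<lambda>(c, p). (x - e / N n) * c - c * p) xs" by auto
        qed (use * H(9) in auto)
        \<comment> \<open>Beyond all nodes every ramp is affine. The zero total weight removes the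
          slope and the lag \<open>e / N n\<close>, the zero first moment removes the rest.\<close>
        have "(\<Sum>(c, p)\<leftarrow>xs. (x - e / N n) * c - c * p)
            = (x - e / N n) * (\<Sum>(c, p)\<leftarrow>xs. c) - (\<Sum>(c, p)\<leftarrow>xs. c * p)"
          by (induction xs) (auto simp: algebra_simps)
        then show ?thesis unfolding \<kappa>_def \<kappa>'_def ** using assms(1,2) by simp
      qed
      then show "\<kappa> n x = 0" "\<kappa>' n x = 0" by auto
    qed
    show "\<bar>\<kappa>' n x\<bar> \<le> (\<Sum>(c, p)\<leftarrow>xs. \<bar>c\<bar>)" for n x
      unfolding \<kappa>'_def
    proof (induction xs)
      case (Cons cp ys)
      obtain c p where cp: "cp = (c, p)" by (cases cp)
      have "\<bar>c * h (N n * x + - (N n * p))\<bar> \<le> \<bar>c\<bar>"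
        using H(4,5) by (auto simp: abs_mult intro!: mult_left_le)
      then show ?case using Cons by (auto simp: cp intro!: order_trans[OF abs_triangle_ineq])
    qed simp
    show "(\<lambda>n. \<kappa>' n x) \<longlonglongrightarrow> (\<Sum>(c, p)\<leftarrow>xs. c * of_bool (p < x))" for x
      unfolding \<kappa>'_def
    proof (induction xs)
      case (Cons cp ys)
      obtain c p where cp: "cp = (c, p)" by (cases cp)
      have "(\<lambda>n. h (N n * x + - (N n * p))) \<longlonglongrightarrow> of_bool (p < x)"
      proof (cases "p < x")
        case True
        obtain m where m: "1 / (x - p) \<le> real m" using real_arch_simple by blast
        have "N n * x + - (N n * p) \<ge> 1" if "m \<le> n" for n
        proof -
          have "1 / (x - p) \<le> N n" using m that by (simp add: N_def)
          then show ?thesis using True by (simp add: field_simps)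
        qed
        then show ?thesis
          using True H(9) by (intro tendsto_eventually) (auto simp: eventually_sequentially)
      next
        case False
        then have "N n * x + - (N n * p) \<le> 0" for n
          using N[of n] by (auto intro!: mult_left_mono)
        then show ?thesis using False H(7) by simp
      qed
      from tendsto_add[OF tendsto_mult[OF tendsto_const[of c] this] Cons]
      show ?case by (simp add: cp)
    qed simp
  qed
qed

text \<open>
  In Lagrangian coordinates \<open>z = (y, t)\<close>: \<open>\<xi> z\<close> is the position and \<open>b z\<close> the speed of the
  vehicle \<open>y\<close>. The vehicle \<open>y = 0\<close> moves along \<open>X\<close>.
\<close>

locale lagrangian =
  fixes U :: "real \<times> real \<Rightarrow> real" and U0 X w a vb :: "real \<Rightarrow> real" and \<sigma> \<delta> A L V :: real
  assumes U_meas [measurable]: "U \<in> borel_measurable borel"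
    and U_ge: "\<And>z. \<delta> \<le> U z" and U_le: "\<And>z. U z \<le> 1" and \<delta>: "0 < \<delta>"
    and U0_meas [measurable]: "U0 \<in> borel_measurable borel"
    and U0_ge: "\<And>y. \<delta> \<le> U0 y" and U0_le: "\<And>y. U0 y \<le> 1"
    and X_cont: "continuous_on UNIV X"
    and X_eq: "\<And>t. t \<ge> 0 \<Longrightarrow> X t = X 0 + (LBINT s:{0..t}. a (X s) * w s)"
    and w_meas [measurable]: "w \<in> borel_measurable borel" and w_le: "\<And>t. \<bar>w t\<bar> \<le> V"
    and a_lip: "\<And>x y. \<bar>a x - a y\<bar> \<le> L * \<bar>x - y\<bar>" and a_le: "\<And>x. \<bar>a x\<bar> \<le> A"
    and vb_meas [measurable]: "vb \<in> borel_measurable borel" and vb_le: "\<And>r. \<bar>vb r\<bar> \<le> V"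
    and \<sigma>: "\<sigma> \<in> {-1, 1}"
begin

definition \<xi> :: "real \<times> real \<Rightarrow> real" where
  "\<xi> z = X (snd z) + (LBINT s=(0::real)..fst z. 1 / U (s, snd z))"

definition x0 :: "real \<Rightarrow> real" where
  "x0 y = X 0 + (LBINT s=(0::real)..y. 1 / U0 s)"

definition b :: "real \<times> real \<Rightarrow> real" where
  "b z = a (\<xi> z) * vb (U z)"

definition B :: "real \<times> real \<Rightarrow> real" where
  "B z = (LBINT s:{0..snd z}. b (fst z, s))"

text \<open>The defect in \<open>\<xi> (y, t) = x0 y + B (y, t)\<close>, the time-integrated form of
  \<open>\<xi>_t = b\<close>. In this form it is a measurable function, bounded on compact
  rectangles in nonnegative time.\<close>

definition E :: "real \<times> real \<Rightarrow> real" where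
  "E z = \<xi> z - x0 (fst z) - B z"

lemma X_meas [measurable]: "X \<in> borel_measurable borel"
  by (rule borel_measurable_continuous_onI[OF X_cont])

lemma L_nonneg: "0 \<le> L"
  using a_lip[of 0 1] by simp

lemma A_nonneg: "0 \<le> A"
  using a_le[of 0] by simp

lemma V_nonneg: "0 \<le> V"
  using w_le[of 0] by simp

lemma a_cont: "continuous_on UNIV a"
proof -
  have "L-lipschitz_on UNIV a"
    using a_lip L_nonneg by (intro lipschitz_onI) (auto simp: dist_real_def)
  then show ?thesis by (rule lipschitz_on_continuous_on)
qed

lemma a_meas [measurable]: "a \<in> borel_measurable borel"
  by (rule borel_measurable_continuous_onI[OF a_cont])

lemma inverse_U: "(\<lambda>y. 1 / U (y, t)) \<in> borel_measurable borel" "1 \<le> 1 / U z" "1 / U z \<le> 1 / \<delta>"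
proof -
  show "(\<lambda>y. 1 / U (y, t)) \<in> borel_measurable borel" by measurable
  have "0 < U z" using U_ge[of z] \<delta> by linarith
  then show "1 \<le> 1 / U z" "1 / U z \<le> 1 / \<delta>"
    using U_le[of z] U_ge[of z] \<delta> by (auto simp: divide_simps)
qed

lemma inverse_U0: "(\<lambda>y. 1 / U0 y) \<in> borel_measurable borel" "1 \<le> 1 / U0 y" "1 / U0 y \<le> 1 / \<delta>"
proof -
  show "(\<lambda>y. 1 / U0 y) \<in> borel_measurable borel" by measurable
  have "0 < U0 y" using U0_ge[of y] \<delta> by linarith
  then show "1 \<le> 1 / U0 y" "1 / U0 y \<le> 1 / \<delta>"
    using U0_le[of y] U0_ge[of y] \<delta> by (auto simp: divide_simps)
qed

lemma abs_inverse_U: "\<bar>1 / U z\<bar> \<le> 1 / \<delta>" and abs_inverse_U0: "\<bar>1 / U0 y\<bar> \<le> 1 / \<delta>"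
  using inverse_U(2,3)[of z] inverse_U0(2,3)[of y] by auto

lemma \<xi>_section: "\<xi> (y, t) = X t + (LBINT s=(0::real)..y. 1 / U (s, t))"
  by (simp add: \<xi>_def)

lemmas \<xi>_bounds = indefinite_integral_bounds[OF inverse_U \<xi>_section]
lemmas x0_bounds = indefinite_integral_bounds[OF inverse_U0 x0_def]
lemmas x0_cont = indefinite_integral_continuous[OF inverse_U0 x0_def]

lemma \<xi>_0: "\<xi> (0, t) = X t" by (simp add: \<xi>_def)
lemma x0_0: "x0 0 = X 0" by (simp add: x0_def)

lemma \<xi>_near_X: "\<bar>\<xi> (y, t) - X t\<bar> \<le> \<bar>y\<bar> / \<delta>"
  using \<xi>_bounds(2,3)[of 0 y t] \<xi>_bounds(2,3)[of y 0 t] by (auto simp: \<xi>_0 abs_if)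

text \<open>Densities are at most 1, so positions spread at least as fast as masses. This keeps
  \<open>\<phi> (\<xi> (y, t), t)\<close> compactly supported in y.\<close>

lemma \<xi>_far_X: "\<bar>y\<bar> \<le> \<bar>\<xi> (y, t) - X t\<bar>"
  using \<xi>_bounds(2,3)[of 0 y t] \<xi>_bounds(2,3)[of y 0 t] by (auto simp: \<xi>_0 abs_if)

lemma x0_near_X: "\<bar>x0 y - X 0\<bar> \<le> \<bar>y\<bar> / \<delta>"
  using x0_bounds(2,3)[of 0 y] x0_bounds(2,3)[of y 0] by (auto simp: x0_0 abs_if)

lemma x0_far_X: "\<bar>y\<bar> \<le> \<bar>x0 y - X 0\<bar>"
  using x0_bounds(2,3)[of 0 y] x0_bounds(2,3)[of y 0] by (auto simp: x0_0 abs_if)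

lemma \<xi>_meas [measurable]: "\<xi> \<in> borel_measurable borel"
proof -
  \<comment> \<open>The signed interval integral is written as one integral over the line with a
    jointly measurable integrand, so that measurability in endpoint and time follows from
    Fubini.\<close>
  define F where "F z s = (if 0 < s \<and> s < fst z then 1 / U (s, snd z)
      else if fst z < s \<and> s < 0 then - (1 / U (s, snd z)) else 0)" for z :: "real \<times> real" and s
  have [measurable]: "case_prod F \<in> borel_measurable (borel \<Otimes>\<^sub>M lborel)"
    unfolding F_def by measurable
  have "\<xi> = (\<lambda>z. X (snd z) + (LINT s|lborel. F z s))"
  proof
    fix z :: "real \<times> real"
    have "(LBINT s=(0::real)..fst z. 1 / U (s, snd z)) = (LINT s|lborel. F z s)"
    proof (cases "0 \<le> fst z")
      case True
      then show ?thesis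
        unfolding interval_lebesgue_integral_def set_lebesgue_integral_def einterval_eq
        by (auto simp: F_def indicator_def intro!: Bochner_Integration.integral_cong)
    next
      case False
      have "(LBINT s=(0::real)..fst z. 1 / U (s, snd z)) = - (LBINT s:{fst z<..<0}. 1 / U (s, snd z))"
        using False unfolding interval_lebesgue_integral_def einterval_eq by auto
      also have "\<dots> = (LINT s|lborel. - (indicator {fst z<..<0} s * (1 / U (s, snd z))))"
        by (simp add: set_lebesgue_integral_def)
      also have "\<dots> = (LINT s|lborel. F z s)"
        by (rule Bochner_Integration.integral_cong) (use False in \<open>auto simp: F_def indicator_def\<close>)
      finally show ?thesis .
    qed
    then show "\<xi> z = X (snd z) + (LINT s|lborel. F z s)" by (simp add: \<xi>_def)
  qed
  then show ?thesis by simp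
qed

lemma x0_meas [measurable]: "x0 \<in> borel_measurable borel"
  by (rule borel_measurable_continuous_onI[OF x0_cont])

lemma b_meas [measurable]: "b \<in> borel_measurable borel"
  unfolding b_def[abs_def] by measurable

lemma b_le: "\<bar>b z\<bar> \<le> A * V"
  unfolding b_def abs_mult using a_le vb_le A_nonneg by (intro mult_mono) auto

lemma B_meas [measurable]: "B \<in> borel_measurable borel"
proof -
  define F where "F z s = (if 0 \<le> s \<and> s \<le> snd z then b (fst z, s) else 0)" for z :: "real \<times> real" and s
  have [measurable]: "case_prod F \<in> borel_measurable (borel \<Otimes>\<^sub>M lborel)"
    unfolding F_def by measurable
  have "B = (\<lambda>z. LINT s|lborel. F z s)"
    unfolding F_def
    by (auto simp: B_def set_lebesgue_integral_def indicator_def intro!: ext Bochner_Integration.integral_cong)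
  then show ?thesis by simp
qed

lemma B_le: "t \<ge> 0 \<Longrightarrow> \<bar>B (y, t)\<bar> \<le> A * V * t"
  using abs_set_integral_Icc_le[of "\<lambda>s. b (y, s)" 0 t "A * V"] b_le by (simp add: B_def)

lemma E_meas [measurable]: "E \<in> borel_measurable borel"
  unfolding E_def[abs_def] by measurable

lemma \<xi>_bdd: "bdd_on ({-M..M} \<times> {0..M'}) \<xi>"
proof -
  have "bdd_on ({-M..M} \<times> {0..M'}) (\<lambda>z. \<xi> z - X (snd z))"
  proof (rule bdd_onI[where C = "M / \<delta>"])
    fix z assume "z \<in> {-M..M} \<times> {0..M'}"
    then have "\<bar>fst z\<bar> / \<delta> \<le> M / \<delta>" using \<delta> by (intro divide_right_mono) auto
    then show "\<bar>\<xi> z - X (snd z)\<bar> \<le> M / \<delta>" using \<xi>_near_X[of "fst z" "snd z"] by simp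
  qed
  from bdd_on_add[OF this bdd_on_snd[OF X_cont]] show ?thesis by simp
qed

lemma B_bdd: "bdd_on ({-M..M} \<times> {0..M'}) B"
proof (rule bdd_onI[where C = "A * V * M'"])
  fix z assume "z \<in> {-M..M} \<times> {0..M'}"
  then have "0 \<le> snd z" "A * V * snd z \<le> A * V * M'"
    using A_nonneg V_nonneg by (auto intro!: mult_left_mono)
  then show "\<bar>B z\<bar> \<le> A * V * M'" using B_le[of "snd z" "fst z"] by simp
qed

lemma E_bdd: "bdd_on ({-M..M} \<times> {0..M'}) E"
  unfolding E_def by (intro bdd_on_intros \<xi>_bdd B_bdd bdd_on_fst x0_cont)

end

locale lagrangian_solution = lagrangian +
  assumes weak: "\<And>\<phi>. test_fun \<phi> \<Longrightarrow>
      (LINT z:UNIV \<times> {0..}|lborel. dt \<phi> z * (1 / U z) - dx \<phi> z * b z) + (LBINT y. \<phi> (y, 0) * (1 / U0 y)) = 0"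
    and trace: "\<And>\<tau>. \<tau> > 0 \<Longrightarrow>
      ((\<lambda>\<epsilon>. (1 / \<epsilon>) * (LINT p:{0..\<tau>} \<times> {0..\<epsilon>}|lborel. \<bar>vb (U (\<sigma> * snd p, fst p)) - w (fst p)\<bar>)) \<longlongrightarrow> 0) (at_right 0)"
begin

text \<open>Integration by parts trades \<open>1 / U\<close> for \<xi> in the variable y,
  \<open>b\<close> for \<open>B\<close> in time, and \<open>1 / U0\<close> for \<open>x0\<close>.
  The weak equation for the product of \<kappa> and \<theta> thereby becomes a statement on
  \<open>E\<close> in which only the derivatives \<open>\<kappa>'\<close> and
  \<open>\<theta>'\<close> occur.\<close>

lemma weak_tensor:
  assumes \<kappa>: "\<And>k. nsmooth k \<kappa>" "\<And>x. (\<kappa> has_real_derivative \<kappa>' x) (at x)" "continuous_on UNIV \<kappa>'"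
      "\<And>x. \<bar>x\<bar> \<ge> M \<Longrightarrow> \<kappa> x = 0" "\<And>x. \<bar>x\<bar> \<ge> M \<Longrightarrow> \<kappa>' x = 0"
    and \<theta>: "\<And>k. nsmooth k \<theta>" "\<And>x. (\<theta> has_real_derivative \<theta>' x) (at x)" "continuous_on UNIV \<theta>'"
      "\<And>x. \<bar>x\<bar> \<ge> M \<Longrightarrow> \<theta> x = 0" "\<And>x. \<bar>x\<bar> \<ge> M \<Longrightarrow> \<theta>' x = 0"
    and "M \<ge> 0"
  shows "(LINT z:{-M..M} \<times> {0..M}|lborel. \<theta>' (snd z) * \<kappa>' (fst z) * E z) = 0"
proof -
  let ?K = "{-M..M} \<times> {0..M}"
  have c: "continuous_on UNIV \<kappa>" "continuous_on UNIV \<theta>"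
    using \<kappa>(1)[of 0] \<theta>(1)[of 0] by auto
  note [measurable] = c[THEN borel_measurable_continuous_onI] \<kappa>(3)[THEN borel_measurable_continuous_onI]
    \<theta>(3)[THEN borel_measurable_continuous_onI]
  note bdds = bdd_on_fst[OF c(1)] bdd_on_fst[OF \<kappa>(3)] bdd_on_snd[OF c(2)] bdd_on_snd[OF \<theta>(3)]
    \<xi>_bdd B_bdd bdd_on_fst[OF x0_cont] bdd_onI[OF abs_inverse_U] bdd_onI[OF b_le]
  \<comment> \<open>Pointwise, \<open>f1 - f2 - f3 - f4\<close> is
    \<open>\<theta>' \<kappa>' E\<close>. The integral of \<open>f1\<close> vanishes by parts in y,
    that of \<open>f2\<close> by parts in time. \<open>f4\<close> is the integrand of the weak
    equation, and the initial terms left by \<open>f3\<close> and \<open>f4\<close> cancel.\<close>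
  define f1 where "f1 z = \<theta>' (snd z) * (\<kappa>' (fst z) * \<xi> z + \<kappa> (fst z) * (1 / U z))" for z
  define f2 where "f2 z = \<kappa>' (fst z) * (\<theta>' (snd z) * B z + \<theta> (snd z) * b z)" for z
  define f3 where "f3 z = (\<kappa>' (fst z) * x0 (fst z)) * \<theta>' (snd z)" for z
  define f4 where "f4 z = \<kappa> (fst z) * \<theta>' (snd z) * (1 / U z) - \<kappa>' (fst z) * \<theta> (snd z) * b z" for z
  have m: "f1 \<in> borel_measurable borel" "f2 \<in> borel_measurable borel"
      "f3 \<in> borel_measurable borel" "f4 \<in> borel_measurable borel"
    unfolding f1_def[abs_def] f2_def[abs_def] f3_def[abs_def] f4_def[abs_def] by measurable
  have bd: "bdd_on ?K f1" "bdd_on ?K f2" "bdd_on ?K f3" "bdd_on ?K f4"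
    unfolding f1_def[abs_def] f2_def[abs_def] f3_def[abs_def] f4_def[abs_def]
    by (intro bdd_on_add bdd_on_diff bdd_on_mult bdds)+
  note F1 = box_Fubini_bdd_on[OF m(1) bd(1)] and F2 = box_Fubini_bdd_on[OF m(2) bd(2)]
    and F3 = box_Fubini_bdd_on[OF m(3) bd(3)] and F4 = box_Fubini_bdd_on[OF m(4) bd(4)]
  have "(LBINT y:{-M..M}. f1 (y, t)) = 0" for t
  proof -
    have "(LBINT y:{-M..M}. \<kappa>' y * \<xi> (y, t) + \<kappa> y * (1 / U (y, t))) = \<kappa> M * \<xi> (M, t) - \<kappa> (- M) * \<xi> (- M, t)"
    proof (rule integral_by_parts_bounded[where b = "\<lambda>y. 1 / U (y, t)" and C = "1 / \<delta>"])
      show "\<xi> (y, t) = \<xi> (- M, t) + (LBINT s:{- M..y}. 1 / U (s, t))" if "- M \<le> y" for y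
        using \<xi>_bounds(1)[OF that, of t] by linarith
      show "\<bar>1 / U (s, t)\<bar> \<le> 1 / \<delta>" for s by (rule abs_inverse_U)
    qed (use \<open>M \<ge> 0\<close> in \<open>simp_all add: \<kappa>(2,3) inverse_U(1)\<close>)
    then show ?thesis using \<kappa>(4) \<open>M \<ge> 0\<close> by (simp add: f1_def)
  qed
  then have I1: "(LINT z:?K|lborel. f1 z) = 0" unfolding F1(3) by (simp add: set_lebesgue_integral_def)
  have "(LBINT t:{0..M}. f2 (y, t)) = 0" for y
  proof -
    \<comment> \<open>The last factor 0 is the initial value of \<open>B (y, t)\<close>, so no
      initial term arises even if \<theta> is nonzero at time 0.\<close>
    have "(LBINT t:{0..M}. \<theta>' t * B (y, t) + \<theta> t * b (y, t)) = \<theta> M * B (y, M) - \<theta> 0 * 0"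
      by (rule integral_by_parts_bounded[where b = "\<lambda>t. b (y, t)" and C = "A * V"])
        (use \<open>M \<ge> 0\<close> in \<open>simp_all add: \<theta>(2,3) b_le B_def\<close>)
    then show ?thesis using \<theta>(4) \<open>M \<ge> 0\<close> by (simp add: f2_def)
  qed
  then have I2: "(LINT z:?K|lborel. f2 z) = 0" unfolding F2(2) by (simp add: set_lebesgue_integral_def)
  have T: "(LBINT t:{0..M}. \<theta>' t) = - \<theta> 0"
  proof -
    have "(LBINT t:{0..M}. \<theta>' t) = \<theta> M - \<theta> 0"
      using integral_FTC_Icc[OF \<open>M \<ge> 0\<close>, of \<theta> \<theta>'] \<theta>(2) continuous_on_subset[OF \<theta>(3)]
      by (simp add: set_lebesgue_integral_def has_field_derivative_at_within
          flip: has_real_derivative_iff_has_vector_derivative)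
    then show ?thesis using \<theta>(4) \<open>M \<ge> 0\<close> by simp
  qed
  have I3: "(LINT z:?K|lborel. f3 z) = - \<theta> 0 * (LBINT y:{-M..M}. \<kappa>' y * x0 y)"
  proof -
    have "(LBINT t:{0..M}. f3 (y, t)) = - \<theta> 0 * (\<kappa>' y * x0 y)" for y
      unfolding T[symmetric] by (simp add: f3_def)
    then show ?thesis unfolding F3(2) by (simp only: set_integral_mult_right)
  qed
  have K0: "set_integrable lborel {-M..M} (\<lambda>y. \<kappa>' y * x0 y)" "set_integrable lborel {-M..M} (\<lambda>y. \<kappa> y * (1 / U0 y))"
  proof -
    show "set_integrable lborel {-M..M} (\<lambda>y. \<kappa>' y * x0 y)"
      by (intro borel_integrable_atLeastAtMost' continuous_on_subset[OF continuous_on_mult[OF \<kappa>(3) x0_cont]]) auto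
    have "bdd_on {-M..M} (\<lambda>y. \<kappa> y * (1 / U0 y))"
      by (intro bdd_on_mult bdd_on_continuous bdd_onI[OF abs_inverse_U0] continuous_on_subset[OF c(1)]) auto
    then obtain C where "\<And>y. y \<in> {-M..M} \<Longrightarrow> \<bar>\<kappa> y * (1 / U0 y)\<bar> \<le> C"
      unfolding bdd_on_def by blast
    then show "set_integrable lborel {-M..M} (\<lambda>y. \<kappa> y * (1 / U0 y))"
      unfolding set_integrable_def by (intro integrable_bounded_support[of _ "-M" M C]) auto
  qed
  have P0: "(LBINT y:{-M..M}. \<kappa>' y * x0 y) + (LBINT y:{-M..M}. \<kappa> y * (1 / U0 y)) = 0"
  proof -
    have "(LBINT y:{-M..M}. \<kappa>' y * x0 y + \<kappa> y * (1 / U0 y)) = \<kappa> M * x0 M - \<kappa> (- M) * x0 (- M)"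
    proof (rule integral_by_parts_bounded[where b = "\<lambda>y. 1 / U0 y" and C = "1 / \<delta>"])
      show "x0 y = x0 (- M) + (LBINT s:{- M..y}. 1 / U0 s)" if "- M \<le> y" for y
        using x0_bounds(1)[OF that] by linarith
      show "\<bar>1 / U0 s\<bar> \<le> 1 / \<delta>" for s by (rule abs_inverse_U0)
    qed (use \<open>M \<ge> 0\<close> in \<open>simp_all add: \<kappa>(2,3) inverse_U0(1)\<close>)
    then show ?thesis
      unfolding set_integral_add(2)[OF K0] using \<kappa>(4) \<open>M \<ge> 0\<close> by simp
  qed
  have I4: "(LINT z:?K|lborel. f4 z) + \<theta> 0 * (LBINT y:{-M..M}. \<kappa> y * (1 / U0 y)) = 0"
  proof -
    have "test_fun (\<lambda>z. \<kappa> (fst z) * \<theta> (snd z))"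
      using \<kappa>(1,4) \<theta>(1,4) by (intro test_fun_tensor[of _ _ M]) auto
    from weak[OF this]
    have "(LINT z:UNIV \<times> {0..}|lborel. f4 z) + (LBINT y. \<kappa> y * \<theta> 0 * (1 / U0 y)) = 0"
      by (simp add: tensor_partial_derivatives[OF \<kappa>(2) \<theta>(2)] f4_def)
    moreover have "(LINT z:UNIV \<times> {0..}|lborel. f4 z) = (LINT z:?K|lborel. f4 z)"
      unfolding set_lebesgue_integral_def
    proof (rule Bochner_Integration.integral_cong)
      fix z :: "real \<times> real"
      have "f4 z = 0" if "\<bar>fst z\<bar> > M \<or> \<bar>snd z\<bar> > M"
        using that \<kappa>(4,5)[of "fst z"] \<theta>(4,5)[of "snd z"] by (auto simp: f4_def)
      then show "indicator (UNIV \<times> {0..}) z *\<^sub>R f4 z = indicator ?K z *\<^sub>R f4 z"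
        by (cases z) (force simp: indicator_def)
    qed simp
    moreover have "(LBINT y. \<kappa> y * \<theta> 0 * (1 / U0 y)) = \<theta> 0 * (LBINT y:{-M..M}. \<kappa> y * (1 / U0 y))"
    proof -
      have "(LBINT y. \<kappa> y * \<theta> 0 * (1 / U0 y)) = (LBINT y. \<theta> 0 * (indicator {-M..M} y * (\<kappa> y * (1 / U0 y))))"
      proof (rule Bochner_Integration.integral_cong)
        fix y
        show "\<kappa> y * \<theta> 0 * (1 / U0 y) = \<theta> 0 * (indicator {-M..M} y * (\<kappa> y * (1 / U0 y)))"
          using \<kappa>(4)[of y] by (cases "\<bar>y\<bar> \<ge> M") (auto simp: indicator_def abs_le_iff)
      qed simp
      then show ?thesis
        unfolding set_lebesgue_integral_def real_scaleR_def by (simp only: integral_mult_right_zero)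
    qed
    ultimately show ?thesis by simp
  qed
  have "(LINT z:?K|lborel. \<theta>' (snd z) * \<kappa>' (fst z) * E z) = (LINT z:?K|lborel. f1 z - f2 z - f3 z - f4 z)"
    by (rule arg_cong[of _ _ "set_lebesgue_integral lborel ?K"])
      (auto simp: f1_def f2_def f3_def f4_def E_def algebra_simps)
  also have "\<dots> = (LINT z:?K|lborel. f1 z) - (LINT z:?K|lborel. f2 z) - (LINT z:?K|lborel. f3 z) - (LINT z:?K|lborel. f4 z)"
    using F1(1) F2(1) F3(1) F4(1) by (simp add: set_integral_diff)
  also have "\<dots> = \<theta> 0 * ((LBINT y:{-M..M}. \<kappa>' y * x0 y) + (LBINT y:{-M..M}. \<kappa> y * (1 / U0 y)))"
    using I4 unfolding I1 I2 I3 by (simp add: algebra_simps)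
  also have "\<dots> = 0" unfolding P0 by simp
  finally show ?thesis .
qed

end

section \<open>Vanishing of the defect \<open>E\<close>\<close>

context lagrangian_solution
begin

text \<open>Since the identity involves only \<open>\<kappa>'\<close> and \<open>\<theta>'\<close>,
  bounded pointwise convergence of these derivatives suffices to pass from smooth to piecewise
  linear test functions.\<close>

lemma weak_ramps:
  assumes xs: "(\<Sum>(c, p)\<leftarrow>xs. c) = 0" "(\<Sum>(c, p)\<leftarrow>xs. c * p) = 0"
    "\<And>c p. (c, p) \<in> set xs \<Longrightarrow> \<bar>p\<bar> + 1 \<le> M"
  and ts: "(\<Sum>(c, p)\<leftarrow>ts. c) = 0" "(\<Sum>(c, p)\<leftarrow>ts. c * p) = 0"
    "\<And>c p. (c, p) \<in> set ts \<Longrightarrow> \<bar>p\<bar> + 1 \<le> M"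
  and "M \<ge> 0"
  shows "(LINT z:{-M..M} \<times> {0..M}|lborel. (\<Sum>(c, p)\<leftarrow>ts. c * of_bool (p < snd z)) *
      (\<Sum>(c, p)\<leftarrow>xs. c * of_bool (p < fst z)) * E z) = 0"
proof -
  obtain \<kappa> \<kappa>' where \<kappa>: "\<And>n k. nsmooth k (\<kappa> n)" "\<And>n x. (\<kappa> n has_real_derivative \<kappa>' n x) (at x)"
    "\<And>n. continuous_on UNIV (\<kappa>' n)"
    "\<And>n x. \<bar>x\<bar> \<ge> M \<Longrightarrow> \<kappa> n x = 0" "\<And>n x. \<bar>x\<bar> \<ge> M \<Longrightarrow> \<kappa>' n x = 0"
    "\<And>n x. \<bar>\<kappa>' n x\<bar> \<le> (\<Sum>(c, p)\<leftarrow>xs. \<bar>c\<bar>)"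
    "\<And>x. (\<lambda>n::nat. \<kappa>' n x) \<longlonglongrightarrow> (\<Sum>(c, p)\<leftarrow>xs. c * of_bool (p < x))"
    by (rule smooth_approx_of_ramps[OF xs(1,2), of M], erule xs(3), rule that)
  obtain \<theta> \<theta>' where \<theta>: "\<And>n k. nsmooth k (\<theta> n)" "\<And>n x. (\<theta> n has_real_derivative \<theta>' n x) (at x)"
    "\<And>n. continuous_on UNIV (\<theta>' n)"
    "\<And>n x. \<bar>x\<bar> \<ge> M \<Longrightarrow> \<theta> n x = 0" "\<And>n x. \<bar>x\<bar> \<ge> M \<Longrightarrow> \<theta>' n x = 0"
    "\<And>n x. \<bar>\<theta>' n x\<bar> \<le> (\<Sum>(c, p)\<leftarrow>ts. \<bar>c\<bar>)"
    "\<And>x. (\<lambda>n::nat. \<theta>' n x) \<longlonglongrightarrow> (\<Sum>(c, p)\<leftarrow>ts. c * of_bool (p < x))"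
    by (rule smooth_approx_of_ramps[OF ts(1,2), of M], erule ts(3), rule that)
  let ?K = "{-M..M} \<times> {0..M}"
  let ?k = "\<lambda>y. \<Sum>(c, p)\<leftarrow>xs. c * of_bool (p < y)" and ?t = "\<lambda>y. \<Sum>(c, p)\<leftarrow>ts. c * of_bool (p < y)"
  have K: "?K = cbox (-M, 0) (M, M)" by (auto simp: cbox_Pair_eq)
  have [measurable]: "?K \<in> sets borel" unfolding K by simp
  note [measurable] = \<kappa>(3)[THEN borel_measurable_continuous_onI] \<theta>(3)[THEN borel_measurable_continuous_onI]
  have [measurable]: "?k \<in> borel_measurable borel" "?t \<in> borel_measurable borel"
    by (rule borel_measurable_LIMSEQ_real[OF \<kappa>(7)], measurable)
      (rule borel_measurable_LIMSEQ_real[OF \<theta>(7)], measurable)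
  obtain C where C: "\<And>z. z \<in> ?K \<Longrightarrow> \<bar>E z\<bar> \<le> C" using E_bdd unfolding bdd_on_def by blast
  let ?Ck = "\<Sum>(c, p)\<leftarrow>xs. \<bar>c\<bar>" and ?Ct = "\<Sum>(c, p)\<leftarrow>ts. \<bar>c\<bar>"
  have "(\<lambda>n. LINT z:?K|lborel. \<theta>' n (snd z) * \<kappa>' n (fst z) * E z) \<longlonglongrightarrow>
      (LINT z:?K|lborel. ?t (snd z) * ?k (fst z) * E z)"
    unfolding set_lebesgue_integral_def real_scaleR_def
  proof (rule integral_tendsto_bounded_support[where a = "(-M, 0)" and b = "(M, M)" and C = "?Ct * ?Ck * C"])
    fix n z assume "z \<in> cbox (- M, 0) (M, M)"
    then have "z \<in> ?K" by (simp add: K)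
    have "\<bar>\<theta>' n (snd z) * \<kappa>' n (fst z) * E z\<bar> \<le> ?Ct * ?Ck * C"
      unfolding abs_mult
      by (intro mult_mono \<kappa>(6) \<theta>(6) C \<open>z \<in> ?K\<close> mult_nonneg_nonneg abs_ge_zero
          order_trans[OF abs_ge_zero \<kappa>(6)] order_trans[OF abs_ge_zero \<theta>(6)])
    then show "\<bar>indicator ?K z * (\<theta>' n (snd z) * \<kappa>' n (fst z) * E z)\<bar> \<le> ?Ct * ?Ck * C"
      using \<open>z \<in> ?K\<close> by simp
  next
    show "AE z in lborel. (\<lambda>n. indicator ?K z * (\<theta>' n (snd z) * \<kappa>' n (fst z) * E z))
        \<longlonglongrightarrow> indicator ?K z * (?t (snd z) * ?k (fst z) * E z)"
      by (intro AE_I2 tendsto_mult tendsto_const \<kappa>(7) \<theta>(7))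
  qed (simp_all flip: K)
  moreover have "(LINT z:?K|lborel. \<theta>' n (snd z) * \<kappa>' n (fst z) * E z) = 0" for n
    by (rule weak_tensor[OF \<kappa>(1-5) \<theta>(1-5) \<open>M \<ge> 0\<close>])
  ultimately show ?thesis by (simp add: LIMSEQ_const_iff)
qed

text \<open>\<open>E\<close> splits into \<open>\<xi> - X\<close>, \<open>x0 - X 0\<close> and
  \<open>X t - X 0 - B\<close>. The first two are at most \<open>r / \<delta>\<close> each. In the
  third, the Lipschitz bound of \<open>a\<close> over the distance \<open>r / \<delta>\<close> costs
  \<open>L V r / \<delta>\<close> per unit time, and replacing the speed factor \<open>w\<close> by
  \<open>vb (U (\<sigma> * r, s))\<close> costs at most \<open>A\<close> times their
  difference.\<close>

lemma abs_E_near_curve: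
  assumes "0 \<le> t" "t \<le> \<tau>" "0 \<le> r"
  shows "\<bar>E (\<sigma> * r, t)\<bar> \<le> (2 / \<delta> + \<tau> * (L * V) / \<delta>) * r
      + A * (LBINT s:{0..\<tau>}. \<bar>vb (U (\<sigma> * r, s)) - w s\<bar>)"
proof -
  have \<sigma>r: "\<bar>\<sigma> * r\<bar> = r" using \<sigma> \<open>0 \<le> r\<close> by (auto simp: abs_mult)
  let ?q = "\<lambda>s. \<bar>vb (U (\<sigma> * r, s)) - w s\<bar>"
  have q_le: "\<bar>?q s\<bar> \<le> V + V" for s using vb_le[of "U (\<sigma> * r, s)"] w_le[of s] by simp
  have q_int: "set_integrable lborel {x..y} ?q" for x y
    by (rule set_integrable_Icc_bounded[OF _ q_le]) measurable
  have const: "set_integrable lborel {x..y} (\<lambda>_. k)" for x y k :: real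
    by (rule set_integrable_Icc_bounded[of _ "\<bar>k\<bar>"]) auto
  have aw: "\<bar>a (X s) * w s\<bar> \<le> A * V" for s
    unfolding abs_mult using a_le w_le A_nonneg by (intro mult_mono) auto
  have speed: "\<bar>a (X s) * w s - b (\<sigma> * r, s)\<bar> \<le> A * ?q s + L * V * (r / \<delta>)" for s
  proof -
    have "a (X s) * w s - b (\<sigma> * r, s)
        = (a (X s) - a (\<xi> (\<sigma> * r, s))) * w s + a (\<xi> (\<sigma> * r, s)) * (w s - vb (U (\<sigma> * r, s)))"
      by (simp add: b_def algebra_simps)
    moreover have "\<bar>(a (X s) - a (\<xi> (\<sigma> * r, s))) * w s\<bar> \<le> L * (r / \<delta>) * V"
    proof -
      have "\<bar>a (X s) - a (\<xi> (\<sigma> * r, s))\<bar> \<le> L * \<bar>\<xi> (\<sigma> * r, s) - X s\<bar>"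
        using a_lip[of "X s" "\<xi> (\<sigma> * r, s)"] by (simp add: abs_minus_commute)
      also have "\<dots> \<le> L * (r / \<delta>)"
        using \<xi>_near_X[of "\<sigma> * r" s] L_nonneg unfolding \<sigma>r by (intro mult_left_mono)
      finally show ?thesis
        unfolding abs_mult using w_le L_nonneg \<delta> \<open>0 \<le> r\<close> by (intro mult_mono) auto
    qed
    moreover have "\<bar>a (\<xi> (\<sigma> * r, s)) * (w s - vb (U (\<sigma> * r, s)))\<bar> \<le> A * ?q s"
      unfolding abs_mult by (intro mult_mono a_le A_nonneg) (auto simp: abs_minus_commute)
    ultimately show ?thesis by (simp add: mult.commute mult.left_commute)
  qed
  have i1: "set_integrable lborel {0..t} (\<lambda>s. a (X s) * w s)"
    by (rule set_integrable_Icc_bounded[OF _ aw]) measurable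
  have i2: "set_integrable lborel {0..t} (\<lambda>s. b (\<sigma> * r, s))"
    by (rule set_integrable_Icc_bounded[OF _ b_le]) measurable
  have "\<bar>X t - X 0 - B (\<sigma> * r, t)\<bar> = \<bar>LBINT s:{0..t}. a (X s) * w s - b (\<sigma> * r, s)\<bar>"
    using X_eq[OF \<open>0 \<le> t\<close>] by (simp add: B_def set_integral_diff(2)[OF i1 i2])
  also have "\<dots> \<le> (LBINT s:{0..t}. \<bar>a (X s) * w s - b (\<sigma> * r, s)\<bar>)"
    using set_integral_norm_bound[OF set_integral_diff(1)[OF i1 i2]] by simp
  also have "\<dots> \<le> (LBINT s:{0..t}. A * ?q s + L * V * (r / \<delta>))"
    using set_integrable_abs[OF set_integral_diff(1)[OF i1 i2]] speed
    by (intro set_integral_mono set_integral_add(1) set_integrable_mult_right q_int const) auto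
  also have "\<dots> \<le> (LBINT s:{0..\<tau>}. A * ?q s + L * V * (r / \<delta>))"
  proof -
    have "set_integrable lborel {0..x} (\<lambda>s. A * ?q s + L * V * (r / \<delta>))" for x
      by (intro set_integral_add(1) set_integrable_mult_right q_int const)
    moreover have "0 \<le> A * ?q s + L * V * (r / \<delta>)" for s
      using A_nonneg L_nonneg V_nonneg \<delta> \<open>0 \<le> r\<close> by (intro add_nonneg_nonneg mult_nonneg_nonneg) auto
    ultimately show ?thesis
      using \<open>t \<le> \<tau>\<close> unfolding set_lebesgue_integral_def set_integrable_def
      by (intro integral_mono) (auto simp: indicator_def)
  qed
  also have "\<dots> = A * (LBINT s:{0..\<tau>}. ?q s) + \<tau> * (L * V * (r / \<delta>))"
    using q_int const assms by (simp add: set_integral_add(2) set_integral_const)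
  finally have "\<bar>X t - X 0 - B (\<sigma> * r, t)\<bar> \<le> A * (LBINT s:{0..\<tau>}. ?q s) + \<tau> * (L * V * (r / \<delta>))" .
  moreover have "E (\<sigma> * r, t) = (\<xi> (\<sigma> * r, t) - X t) - (x0 (\<sigma> * r) - X 0) + (X t - X 0 - B (\<sigma> * r, t))"
    by (simp add: E_def)
  ultimately have "\<bar>E (\<sigma> * r, t)\<bar> \<le> r / \<delta> + r / \<delta> + (A * (LBINT s:{0..\<tau>}. ?q s) + \<tau> * (L * V * (r / \<delta>)))"
    using \<xi>_near_X[of "\<sigma> * r" t] x0_near_X[of "\<sigma> * r"] unfolding \<sigma>r by linarith
  then show ?thesis by (simp add: algebra_simps add_divide_distrib)
qed

text \<open>The estimate near the curve is averaged over the strip. Its part linear in the distance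
  contributes a multiple of \<epsilon>, and the remaining part is the averaged speed difference,
  which tends to 0 by \<open>trace\<close>; since that part does not depend on t, the integration in
  time yields the factor \<tau>.\<close>

lemma E_trace:
  assumes "\<tau> > 0"
  shows "((\<lambda>\<epsilon>. (1 / \<epsilon>) * (LINT p:{0..\<tau>} \<times> {0..\<epsilon>}|lborel. \<bar>E (\<sigma> * snd p, fst p)\<bar>)) \<longlongrightarrow> 0) (at_right 0)"
proof -
  let ?q = "\<lambda>p. \<bar>vb (U (\<sigma> * snd p, fst p)) - w (fst p)\<bar>"
  let ?e = "\<lambda>p. \<bar>E (\<sigma> * snd p, fst p)\<bar>"
  let ?Q = "\<lambda>r. LBINT s:{0..\<tau>}. \<bar>vb (U (\<sigma> * r, s)) - w s\<bar>"
  define k where "k = 2 / \<delta> + \<tau> * (L * V) / \<delta>"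
  have k: "k \<ge> 0" using \<delta> L_nonneg V_nonneg assms by (simp add: k_def)
  have q_bdd: "\<bar>?q p\<bar> \<le> V + V" for p
    using vb_le[of "U (\<sigma> * snd p, fst p)"] w_le[of "fst p"] by simp
  have qm: "?q \<in> borel_measurable borel" by measurable
  have Qm: "?Q \<in> borel_measurable borel"
  proof -
    have "case_prod (\<lambda>r s. if 0 \<le> s \<and> s \<le> \<tau> then \<bar>vb (U (\<sigma> * r, s)) - w s\<bar> else 0)
        \<in> borel_measurable (borel \<Otimes>\<^sub>M lborel)"
      by measurable
    from lborel.borel_measurable_lebesgue_integral[OF this]
    show ?thesis
      by (rule measurable_cong[THEN iffD1, rotated])
        (auto simp: set_lebesgue_integral_def indicator_def intro!: Bochner_Integration.integral_cong)
  qed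
  have Q_le: "\<bar>?Q r\<bar> \<le> (V + V) * \<tau>" for r
    using abs_set_integral_Icc_le[of "\<lambda>s. \<bar>vb (U (\<sigma> * r, s)) - w s\<bar>" 0 \<tau> "V + V"] q_bdd[of "(_, r)"] assms
    by simp
  have em: "?e \<in> borel_measurable borel" by measurable
  have bound: "(1 / \<epsilon>) * (LINT p:{0..\<tau>} \<times> {0..\<epsilon>}|lborel. ?e p)
      \<le> \<tau> * k * \<epsilon> + \<tau> * A * ((1 / \<epsilon>) * (LINT p:{0..\<tau>} \<times> {0..\<epsilon>}|lborel. ?q p))" if "\<epsilon> > 0" for \<epsilon>
  proof -
    let ?K = "{0..\<tau>} \<times> {0..\<epsilon>}"
    let ?g = "\<lambda>p :: real \<times> real. k * \<epsilon> + A * ?Q (snd p)"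
    have gm: "?g \<in> borel_measurable borel"
      using measurable_compose[OF borel_measurable_fst_snd(2) Qm]
      by (intro borel_measurable_add borel_measurable_times borel_measurable_const)
    have g_bdd: "bdd_on ?K ?g"
      by (intro bdd_on_add bdd_on_mult bdd_on_const bdd_onI[OF Q_le])
    have e_g: "?e p \<le> ?g p" if "p \<in> ?K" for p
    proof -
      have p: "0 \<le> fst p" "fst p \<le> \<tau>" "0 \<le> snd p" "snd p \<le> \<epsilon>" using that by auto
      have "k * snd p \<le> k * \<epsilon>" using p k by (intro mult_left_mono)
      then show ?thesis using abs_E_near_curve[OF p(1-3)] unfolding k_def by linarith
    qed
    have e_bdd: "bdd_on ?K ?e"
    proof -
      obtain C where C: "\<And>z. z \<in> ?K \<Longrightarrow> \<bar>?g z\<bar> \<le> C" using g_bdd unfolding bdd_on_def by blast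
      have "\<bar>?e p\<bar> \<le> C" if "p \<in> ?K" for p
        using e_g[OF that] C[OF that] by linarith
      then show ?thesis by (rule bdd_onI)
    qed
    have "(LINT p:?K|lborel. ?e p) \<le> (LINT p:?K|lborel. ?g p)"
      by (intro set_integral_mono box_Fubini_bdd_on(1) em gm e_bdd g_bdd e_g)
    also have "\<dots> = (LBINT r:{0..\<epsilon>}. LBINT s:{0..\<tau>}. k * \<epsilon> + A * ?Q r)"
      using box_Fubini_bdd_on(3)[OF gm g_bdd] by simp
    also have "\<dots> = (LBINT r:{0..\<epsilon>}. \<tau> * (k * \<epsilon>) + \<tau> * A * ?Q r)"
      using assms by (simp add: set_integral_const algebra_simps)
    also have "\<dots> = \<epsilon> * (\<tau> * (k * \<epsilon>)) + \<tau> * A * (LBINT r:{0..\<epsilon>}. ?Q r)"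
      using that set_integrable_Icc_bounded[OF Qm Q_le] set_integrable_Icc_bounded[of "\<lambda>_. \<tau> * (k * \<epsilon>)" "\<bar>\<tau> * (k * \<epsilon>)\<bar>"]
      by (subst set_integral_add(2)) (simp_all add: set_integral_const)
    also have "(LBINT r:{0..\<epsilon>}. ?Q r) = (LINT p:?K|lborel. ?q p)"
      using box_Fubini_bdd_on(3)[OF qm bdd_onI[OF q_bdd], of 0 \<tau> 0 \<epsilon>] by simp
    finally have "(1 / \<epsilon>) * (LINT p:?K|lborel. ?e p)
        \<le> (1 / \<epsilon>) * (\<epsilon> * (\<tau> * (k * \<epsilon>)) + \<tau> * A * (LINT p:?K|lborel. ?q p))"
      using that by (intro mult_left_mono) auto
    then show ?thesis using that by (simp add: field_simps)
  qed
  have "((\<lambda>\<epsilon>. \<tau> * k * \<epsilon> + \<tau> * A * ((1 / \<epsilon>) * (LINT p:{0..\<tau>} \<times> {0..\<epsilon>}|lborel. ?q p)))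
      \<longlongrightarrow> \<tau> * k * 0 + \<tau> * A * 0) (at_right 0)"
    by (intro tendsto_add tendsto_mult tendsto_const trace[OF assms] tendsto_ident_at)
  then have lim: "((\<lambda>\<epsilon>. \<tau> * k * \<epsilon> + \<tau> * A * ((1 / \<epsilon>) * (LINT p:{0..\<tau>} \<times> {0..\<epsilon>}|lborel. ?q p))) \<longlongrightarrow> 0) (at_right 0)"
    by simp
  show ?thesis
  proof (rule tendsto_sandwich[OF _ _ tendsto_const lim])
    show "\<forall>\<^sub>F \<epsilon> in at_right 0. 0 \<le> (1 / \<epsilon>) * (LINT p:{0..\<tau>} \<times> {0..\<epsilon>}|lborel. ?e p)"
      using eventually_at_right_less[of "0::real"]
    proof eventually_elim
      case (elim \<epsilon>)
      have "0 \<le> (LINT p:{0..\<tau>} \<times> {0..\<epsilon>}|lborel. ?e p)"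
        unfolding set_lebesgue_integral_def by (intro integral_nonneg_AE AE_I2) simp
      then show ?case using elim by simp
    qed
    show "\<forall>\<^sub>F \<epsilon> in at_right 0. (1 / \<epsilon>) * (LINT p:{0..\<tau>} \<times> {0..\<epsilon>}|lborel. ?e p)
        \<le> \<tau> * k * \<epsilon> + \<tau> * A * ((1 / \<epsilon>) * (LINT p:{0..\<tau>} \<times> {0..\<epsilon>}|lborel. ?q p))"
      using eventually_at_right_less[of "0::real"] by eventually_elim (rule bound)
  qed
qed

text \<open>Let \<open>\<kappa>'\<close> be the indicator of \<open>(p1, p2]\<close> minus an equal
  mass spread over a strip of width \<epsilon> at \<open>y = 0\<close>. Then the integral of
  \<open>E\<close> over the rectangle equals \<open>P / \<epsilon>\<close> times its integral over
  the strip, and the latter product tends to 0 by \<open>E_trace\<close>.\<close>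

lemma E_box_integral_zero:
  assumes p: "p1 < p2" "\<bar>p1\<bar> + 1 \<le> M" "\<bar>p2\<bar> + 1 \<le> M"
    and t: "0 \<le> t1" "t1 < t2" "t2 + 1 \<le> M" and "3 \<le> M"
  shows "(LINT z:{-M..M} \<times> {0..M}|lborel.
      of_bool (t1 < snd z \<and> snd z \<le> t2) * of_bool (p1 < fst z \<and> fst z \<le> p2) * E z) = 0" (is "?J = 0")
proof -
  let ?K = "{-M..M} \<times> {0..M}"
  let ?e = "\<lambda>p. \<bar>E (\<sigma> * snd p, fst p)\<bar>"
  let ?f = "\<lambda>z. of_bool (t1 < snd z \<and> snd z \<le> t2) * of_bool (p1 < fst z \<and> fst z \<le> p2) * E z"
  define P where "P = p2 - p1"
  have K: "?K = cbox (-M, 0) (M, M)" by (auto simp: cbox_Pair_eq)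
  have [measurable]: "?K \<in> sets borel" unfolding K by simp
  have of_bool_bdd: "bdd_on k (\<lambda>z. of_bool (Q z))" for k :: "(real \<times> real) set" and Q
    by (rule bdd_onI[where C = 1]) simp
  have bound: "\<bar>?J\<bar> \<le> P * ((1 / \<epsilon>) * (LINT p:{0..M} \<times> {0..\<epsilon>}|lborel. ?e p))"
    if \<epsilon>: "0 < \<epsilon>" "\<epsilon> < 1" for \<epsilon>
  proof -
    \<comment> \<open>The strip lies on the side of the trace: \<open>(0, \<epsilon>]\<close> if
      \<sigma> = 1, and \<open>(-\<epsilon>, 0]\<close> if \<sigma> = -1.\<close>
    define q where "q = (if \<sigma> = 1 then 0 else - \<epsilon>)"
    define g where "g z = of_bool (t1 < snd z \<and> snd z \<le> t2) * (of_bool (q < fst z \<and> fst z \<le> q + \<epsilon>) * E z)" for z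
    define h where "h z = of_bool (q < fst z \<and> fst z \<le> q + \<epsilon>) * \<bar>E z\<bar>" for z
    have m: "?f \<in> borel_measurable borel" "g \<in> borel_measurable borel" "h \<in> borel_measurable borel"
      unfolding g_def[abs_def] h_def[abs_def] by measurable
    have bd: "bdd_on ?K ?f" "bdd_on ?K g" "bdd_on ?K h"
      unfolding g_def[abs_def] h_def[abs_def] by (intro bdd_on_mult of_bool_bdd bdd_on_abs E_bdd)+
    note F1 = box_Fubini_bdd_on[OF m(1) bd(1)] and F2 = box_Fubini_bdd_on[OF m(2) bd(2)]
      and F3 = box_Fubini_bdd_on[OF m(3) bd(3)]
    \<comment> \<open>Height \<open>P / \<epsilon>\<close> on width \<epsilon> balances the mass
      \<open>P\<close> of the indicator; this is the vanishing of the first moment.\<close>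
    define xs where "xs = [(1, p1), (-1, p2), (- P / \<epsilon>, q), (P / \<epsilon>, q + \<epsilon>)]"
    \<comment> \<open>\<open>\<theta>'\<close> is -1 on \<open>(t1, t2]\<close>, and the
      compensating mass sits on \<open>(-2, -1]\<close>, outside the half-plane, so it does not
      enter the integral. The node -2 accounts for \<open>3 \<le> M\<close>.\<close>
    define ts where "ts = [(-1, t1), (1, t2), (t2 - t1, -2), (- (t2 - t1), -1)]"
    have "(LINT z:?K|lborel. (\<Sum>(c, p)\<leftarrow>ts. c * of_bool (p < snd z)) *
        (\<Sum>(c, p)\<leftarrow>xs. c * of_bool (p < fst z)) * E z) = 0"
    proof (rule weak_ramps)
      show "\<bar>y\<bar> + 1 \<le> M" if "(c, y) \<in> set xs" for c y
        using that p \<epsilon> \<open>3 \<le> M\<close> by (auto simp: xs_def q_def split: if_splits)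
      show "\<bar>y\<bar> + 1 \<le> M" if "(c, y) \<in> set ts" for c y
        using that t \<open>3 \<le> M\<close> by (auto simp: ts_def)
    qed (use \<epsilon> \<open>3 \<le> M\<close> in \<open>auto simp: xs_def ts_def P_def field_simps\<close>)
    moreover have "(LINT z:?K|lborel. (\<Sum>(c, p)\<leftarrow>ts. c * of_bool (p < snd z)) *
        (\<Sum>(c, p)\<leftarrow>xs. c * of_bool (p < fst z)) * E z) = (LINT z:?K|lborel. (P / \<epsilon>) * g z - ?f z)"
    proof (rule set_lebesgue_integral_cong)
      have T: "(\<Sum>(c, p)\<leftarrow>ts. c * of_bool (p < snd z)) = - of_bool (t1 < snd z \<and> snd z \<le> t2)" if "z \<in> ?K" for z
        using that t by (auto simp: ts_def)
      have S: "(\<Sum>(c, p)\<leftarrow>xs. c * of_bool (p < y))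
          = of_bool (p1 < y \<and> y \<le> p2) - (P / \<epsilon>) * of_bool (q < y \<and> y \<le> q + \<epsilon>)" for y
        using p \<epsilon> by (auto simp: xs_def)
      have alg: "- A1 * (A2 - k * A3) * e = k * (A1 * (A3 * e)) - A1 * A2 * e" for A1 A2 A3 k e :: real
        by (simp add: algebra_simps)
      show "\<forall>z. z \<in> ?K \<longrightarrow> (\<Sum>(c, p)\<leftarrow>ts. c * of_bool (p < snd z)) *
          (\<Sum>(c, p)\<leftarrow>xs. c * of_bool (p < fst z)) * E z = (P / \<epsilon>) * g z - ?f z"
        by (intro allI impI) (simp only: T S g_def alg)
    qed simp
    ultimately have "?J = (P / \<epsilon>) * (LINT z:?K|lborel. g z)"
      using F1(1) F2(1) by (simp add: set_integral_diff)
    \<comment> \<open>The time cutoff is dropped here: the trace estimate controls the absolute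
      value of \<open>E\<close> on the full strip.\<close>
    moreover have "\<bar>LINT z:?K|lborel. g z\<bar> \<le> (LINT z:?K|lborel. h z)"
    proof -
      have "\<bar>LINT z:?K|lborel. g z\<bar> \<le> (LINT z:?K|lborel. \<bar>g z\<bar>)"
        using set_integral_norm_bound[OF F2(1)] by simp
      also have "\<dots> \<le> (LINT z:?K|lborel. h z)"
        by (intro set_integral_mono F3(1) set_integrable_abs F2(1)) (auto simp: g_def h_def abs_mult)
      finally show ?thesis .
    qed
    moreover have "(LINT z:?K|lborel. h z) = (LINT p:{0..M} \<times> {0..\<epsilon>}|lborel. ?e p)"
    proof -
      have "(LBINT y:{-M..M}. h (y, t)) = (LBINT r:{0..\<epsilon>}. \<bar>E (\<sigma> * r, t)\<bar>)" for t
      proof -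
        have "(LBINT y:{-M..M}. h (y, t)) = (LBINT y. h (y, t))"
          unfolding set_lebesgue_integral_def
          using \<epsilon> \<open>3 \<le> M\<close> by (intro Bochner_Integration.integral_cong) (auto simp: h_def q_def indicator_def split: if_splits)
        also have "\<dots> = (LBINT r. h (\<sigma> * r, t))"
          using \<sigma> lborel_integral_real_affine[of \<sigma> "\<lambda>y. h (y, t)" 0] by auto
        also have "\<dots> = (LBINT r:{0..\<epsilon>}. \<bar>E (\<sigma> * r, t)\<bar>)"
          unfolding set_lebesgue_integral_def
        proof (rule integral_cong_AE)
          show "AE r in lborel. h (\<sigma> * r, t) = indicator {0..\<epsilon>} r *\<^sub>R \<bar>E (\<sigma> * r, t)\<bar>"
            using AE_lborel_singleton[of 0] AE_lborel_singleton[of \<epsilon>]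
          proof eventually_elim
            case (elim r)
            then show ?case using \<sigma> by (auto simp: h_def q_def indicator_def)
          qed
        qed (use m in measurable)
        finally show ?thesis .
      qed
      moreover have "bdd_on ({0..M} \<times> {0..\<epsilon>}) ?e"
      proof -
        obtain C where C: "\<And>z. z \<in> {-\<epsilon>..\<epsilon>} \<times> {0..M} \<Longrightarrow> \<bar>E z\<bar> \<le> C"
          using E_bdd unfolding bdd_on_def by blast
        show ?thesis
          using \<sigma> by (intro bdd_onI[where C = C]) (auto intro!: C)
      qed
      moreover have "?e \<in> borel_measurable borel" by measurable
      ultimately show ?thesis
        unfolding F3(3) by (subst box_Fubini_bdd_on(2)) simp_all
    qed
    moreover have "P > 0" using p by (simp add: P_def)
    ultimately show ?thesis using \<epsilon> by (simp add: abs_mult divide_right_mono mult_left_mono)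
  qed
  have "((\<lambda>\<epsilon>. P * ((1 / \<epsilon>) * (LINT p:{0..M} \<times> {0..\<epsilon>}|lborel. ?e p))) \<longlongrightarrow> P * 0) (at_right 0)"
    using \<open>3 \<le> M\<close> by (intro tendsto_mult tendsto_const E_trace) auto
  moreover have "\<forall>\<^sub>F \<epsilon> in at_right 0. \<bar>?J\<bar> \<le> P * ((1 / \<epsilon>) * (LINT p:{0..M} \<times> {0..\<epsilon>}|lborel. ?e p))"
  proof -
    have "\<forall>\<^sub>F \<epsilon> in at_right 0. \<epsilon> \<in> {0<..<1::real}" by (rule eventually_at_right_real) simp
    then show ?thesis by eventually_elim (rule bound, auto)
  qed
  ultimately have "\<bar>?J\<bar> \<le> P * 0"
    by (intro tendsto_lowerbound) auto
  then show ?thesis by simp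
qed

text \<open>The criterion by box integrals asks for a bounded integrable function on the plane, so
  \<open>E\<close> is cut off to growing rectangles in positive time; intersecting a box with such a
  rectangle gives a rectangle again, on which the integral vanishes.\<close>

lemma AE_E_zero: "AE z in lborel. 0 < snd z \<longrightarrow> E z = 0"
proof -
  have "AE z in lborel. indicator ({- real N..real N} \<times> {0<..real N}) z * E z = 0" for N :: nat
  proof -
    define f where "f z = indicator ({- real N..real N} \<times> {0<..real N}) z * E z" for z
    obtain C where C: "\<And>z. z \<in> {- real N..real N} \<times> {0..real N} \<Longrightarrow> \<bar>E z\<bar> \<le> C"
      using E_bdd unfolding bdd_on_def by blast
    have "C \<ge> 0" using C[of "(0, 0)"] by simp
    have f_alt: "f z = of_bool (- real N \<le> fst z \<and> fst z \<le> real N \<and> 0 < snd z \<and> snd z \<le> real N) * E z" for z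
      by (cases z) (auto simp: f_def indicator_def)
    have fm: "f \<in> borel_measurable borel" unfolding f_alt[abs_def] by measurable
    have "AE z in lborel. f z = 0"
    proof (rule AE_zero_if_box_integrals_zero[OF fm])
      show fC: "\<bar>f z\<bar> \<le> C" for z using C[of z] \<open>C \<ge> 0\<close> by (cases z) (auto simp: f_alt)
      show "integrable lborel f"
        using fC by (intro integrable_bounded_support[OF fm, of "(- real N, 0)" "(real N, real N)" C])
          (auto simp: f_alt cbox_Pair_eq)
    next
      fix l u :: "real \<times> real"
      define p1 where "p1 = max (fst l) (- real N)"
      define p2 where "p2 = min (fst u) (real N)"
      define t1 where "t1 = max (snd l) 0"
      define t2 where "t2 = min (snd u) (real N)"
      define M where "M = real N + 3"
      let ?K = "{-M..M} \<times> {0..M}"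
      have [measurable]: "?K \<in> sets borel"
        using borel_closed[OF closed_cbox[of "(-M, 0)" "(M, M)"]] by (simp add: cbox_Pair_eq)
      let ?g = "\<lambda>z. of_bool (t1 < snd z \<and> snd z \<le> t2) * of_bool (p1 < fst z \<and> fst z \<le> p2) * E z"
      have inbox: "z \<in> box l u \<longleftrightarrow> fst l < fst z \<and> fst z < fst u \<and> snd l < snd z \<and> snd z < snd u" for z
        by (auto simp: mem_box Basis_prod_def inner_prod_def ball_Un)
      have "(LINT z:box l u|lborel. f z) = (LINT z:?K|lborel. ?g z)"
        unfolding set_lebesgue_integral_def
      proof (rule integral_cong_AE)
        \<comment> \<open>An open box meets half-open rectangles here; the two sides can differ only
          on the lines through \<open>p1\<close>, \<open>p2\<close>, \<open>t1\<close> and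
          \<open>t2\<close>, which are null.\<close>
        show "AE z in lborel. indicator (box l u) z *\<^sub>R f z = indicator ?K z *\<^sub>R ?g z"
          using AE_lborel_fst_snd(2)[OF AE_lborel_singleton[of p1]] AE_lborel_fst_snd(2)[OF AE_lborel_singleton[of p2]] AE_lborel_fst_snd(1)[OF AE_lborel_singleton[of t1]] AE_lborel_fst_snd(1)[OF AE_lborel_singleton[of t2]]
        proof eventually_elim
          case (elim z)
          have "z \<in> box l u \<and> - real N \<le> fst z \<and> fst z \<le> real N \<and> 0 < snd z \<and> snd z \<le> real N
              \<longleftrightarrow> z \<in> ?K \<and> t1 < snd z \<and> snd z \<le> t2 \<and> p1 < fst z \<and> fst z \<le> p2"
            unfolding inbox using elim by (cases z) (auto simp: p1_def p2_def t1_def t2_def M_def)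
          then show ?case unfolding f_alt by (auto simp: indicator_def)
        qed
      qed (use fm in measurable)
      also have "\<dots> = 0"
      proof (cases "p1 < p2 \<and> t1 < t2")
        case True
        then have "\<bar>p1\<bar> + 1 \<le> M" "\<bar>p2\<bar> + 1 \<le> M" "0 \<le> t1" "t2 + 1 \<le> M" "3 \<le> M"
          by (auto simp: p1_def p2_def t1_def t2_def M_def)
        then show ?thesis using True by (intro E_box_integral_zero) auto
      next
        case False
        then have "?g = (\<lambda>z. 0)" by auto
        then show ?thesis by (simp only: set_lebesgue_integral_def scaleR_zero_right integral_zero)
      qed
      finally show "(LINT z:box l u|lborel. f z) = 0" .
    qed
    then show ?thesis by (simp add: f_def)
  qed
  then have "AE z in lborel. \<forall>N :: nat. indicator ({- real N..real N} \<times> {0<..real N}) z * E z = 0"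
    unfolding AE_all_countable by blast
  then show ?thesis
  proof eventually_elim
    case (elim z)
    show ?case
    proof
      assume "0 < snd z"
      obtain N :: nat where "max \<bar>fst z\<bar> (snd z) \<le> real N" using real_arch_simple by blast
      then have "z \<in> {- real N..real N} \<times> {0<..real N}" using \<open>0 < snd z\<close> by (cases z) auto
      then show "E z = 0" using elim[rule_format, of N] by simp
    qed
  qed
qed

end

section \<open>Inverse of the position map, and the trace in Eulerian coordinates\<close>

context lagrangian
begin

lemma \<xi>_strict_mono: "x < y \<Longrightarrow> \<xi> (x, t) < \<xi> (y, t)"
  using \<xi>_bounds(2)[of x y t] by simp

definition \<Upsilon> :: "real \<times> real \<Rightarrow> real" where
  "\<Upsilon> z = (THE y. \<xi> (y, snd z) = fst z)"

lemma \<Upsilon>_\<xi>: "\<Upsilon> (\<xi> (y, t), t) = y"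
  unfolding \<Upsilon>_def
  by (rule the_equality) (use \<xi>_strict_mono in \<open>auto, metis linorder_neqE_linordered_idom less_irrefl\<close>)

lemma \<xi>_\<Upsilon>: "\<xi> (\<Upsilon> (x, t), t) = x"
proof -
  have "\<exists>y. \<xi> (y, t) = x"
    by (rule indefinite_integral_surj[OF inverse_U zero_less_one \<xi>_section])
  then obtain y where "\<xi> (y, t) = x" by blast
  then show ?thesis using \<Upsilon>_\<xi>[of y t] by simp
qed

lemma \<Upsilon>_less_iff: "\<Upsilon> (x, t) < c \<longleftrightarrow> x < \<xi> (c, t)"
  using \<xi>_strict_mono[of "\<Upsilon> (x, t)" c t] \<xi>_strict_mono[of c "\<Upsilon> (x, t)" t]
  by (cases "\<Upsilon> (x, t)" c rule: linorder_cases) (auto simp: \<xi>_\<Upsilon>)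

text \<open>By monotonicity in y, the condition \<open>\<Upsilon> z < c\<close> says that the point
  lies to the left of the vehicle \<open>c\<close>, which is a condition on the measurable map
  \<xi>.\<close>

lemma \<Upsilon>_meas [measurable]: "\<Upsilon> \<in> borel_measurable borel"
proof (rule borel_measurableI_less)
  fix c
  have "{z \<in> space borel. \<Upsilon> z < c} = {z \<in> space borel. fst z < \<xi> (c, snd z)}"
    using \<Upsilon>_less_iff by auto
  also have "\<dots> \<in> sets borel" by measurable
  finally show "{z \<in> space borel. \<Upsilon> z < c} \<in> sets borel" .
qed

text \<open>A Borel representative of the Eulerian density that refers to \<xi> and \<open>U\<close>
  only, hence not to the pointwise choice of \<rho>.\<close>

definition P :: "real \<times> real \<Rightarrow> real" where
  "P z = U (\<Upsilon> z, snd z)"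

lemma P_meas [measurable]: "P \<in> borel_measurable borel"
  unfolding P_def[abs_def] by measurable

lemma P_ge: "\<delta> \<le> P z" and P_le: "P z \<le> 1"
  using U_ge U_le by (auto simp: P_def)

lemma P_\<xi>: "P (\<xi> (y, t), t) = U (y, t)"
  by (simp add: P_def \<Upsilon>_\<xi>)

lemma integral_\<xi>:
  fixes f :: "real \<Rightarrow> real"
  assumes [measurable]: "f \<in> borel_measurable borel"
  shows "(LBINT y. f (\<xi> (y, t)) * (1 / U (y, t))) = (LBINT x. f x)"
proof -
  have nn: "AE y in lborel. 0 \<le> 1 / U (y, t)"
    using order_trans[OF zero_le_one inverse_U(2)] by (intro AE_I2)
  have "(LBINT x. f x) = integral\<^sup>L (distr (density lborel (\<lambda>y. ennreal (1 / U (y, t)))) borel (\<lambda>y. \<xi> (y, t))) f"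
    by (simp only: distr_indefinite_integral[OF inverse_U zero_less_one \<xi>_section])
  also have "\<dots> = (LBINT y. f (\<xi> (y, t)) * (1 / U (y, t)))"
    by (subst integral_distr, measurable, subst integral_density) (use nn in \<open>simp_all add: mult.commute\<close>)
  finally show ?thesis ..
qed

text \<open>\<xi> stretches the distance to the curve by a factor between 1 and
  \<open>1 / \<delta>\<close> and preserves sides, so the Lagrangian strip of width \<epsilon> is
  carried into the Eulerian one of width \<open>\<epsilon> / \<delta>\<close>. The Jacobian
  \<open>1 / U\<close> is at least 1 and can only enlarge the integral.\<close>

lemma trace_Eulerian_bound:
  assumes "\<epsilon> > 0" "\<tau> > 0"
  shows "(LINT p:{0..\<tau>} \<times> {0..\<epsilon>}|lborel. \<bar>vb (U (\<sigma> * snd p, fst p)) - w (fst p)\<bar>)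
    \<le> (LINT p:{0..\<tau>} \<times> {0..\<epsilon> / \<delta>}|lborel. \<bar>vb (P (X (fst p) + \<sigma> * snd p, fst p)) - w (fst p)\<bar>)"
proof -
  let ?q = "\<lambda>p. \<bar>vb (U (\<sigma> * snd p, fst p)) - w (fst p)\<bar>"
  let ?r = "\<lambda>p. \<bar>vb (P (X (fst p) + \<sigma> * snd p, fst p)) - w (fst p)\<bar>"
  have \<sigma>2: "\<sigma> * \<sigma> = 1" "\<bar>\<sigma>\<bar> = 1" "\<sigma> \<noteq> 0" using \<sigma> by auto
  have le: "\<bar>\<bar>vb r - w t\<bar>\<bar> \<le> V + V" for r t
    using vb_le[of r] w_le[of t] by simp
  have qm: "?q \<in> borel_measurable borel" "?r \<in> borel_measurable borel" by measurable
  have q_bdd: "bdd_on k ?q" "bdd_on k ?r" for k by (rule bdd_onI, rule le)+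
  have sec: "(LBINT r:{0..\<epsilon>}. ?q (t, r)) \<le> (LBINT s:{0..\<epsilon> / \<delta>}. ?r (t, s))" for t
  proof -
    define f where "f x = indicator {0..\<epsilon> / \<delta>} (\<sigma> * (x - X t)) * \<bar>vb (P (x, t)) - w t\<bar>" for x
    have fm [measurable]: "f \<in> borel_measurable borel" unfolding f_def[abs_def] by measurable
    have aff: "(LBINT y. g y) = (LBINT r. g (k + \<sigma> * r))" for g :: "real \<Rightarrow> real" and k
      using lborel_integral_real_affine[OF \<sigma>2(3), of g k] \<sigma>2 by simp
    have "(LBINT r:{0..\<epsilon>}. ?q (t, r)) = (LBINT y. indicator {0..\<epsilon>} (\<sigma> * y) * \<bar>vb (U (y, t)) - w t\<bar>)"
      unfolding set_lebesgue_integral_def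
      by (subst (2) aff[of _ 0]) (simp add: mult.assoc[symmetric] \<sigma>2)
    also have "\<dots> \<le> (LBINT y. f (\<xi> (y, t)) * (1 / U (y, t)))"
    proof (rule integral_mono)
      show "integrable lborel (\<lambda>y. indicator {0..\<epsilon>} (\<sigma> * y) * \<bar>vb (U (y, t)) - w t\<bar>)"
      proof (rule integrable_bounded_support[of _ "- \<epsilon>" \<epsilon> "V + V"])
        show "(\<lambda>y. indicator {0..\<epsilon>} (\<sigma> * y) * \<bar>vb (U (y, t)) - w t\<bar>) \<in> borel_measurable borel"
          by measurable
      qed (use le \<sigma> V_nonneg in \<open>auto simp: indicator_def\<close>)
      have far: "indicator {0..\<epsilon> / \<delta>} (\<sigma> * (\<xi> (y, t) - X t)) = (0 :: real)" if "y \<notin> cbox (- (\<epsilon> / \<delta>)) (\<epsilon> / \<delta>)" for y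
      proof -
        have "\<epsilon> / \<delta> < \<bar>y\<bar>" using that by auto
        also have "\<dots> \<le> \<bar>\<sigma> * (\<xi> (y, t) - X t)\<bar>" using \<xi>_far_X[of y t] \<sigma>2 by (simp add: abs_mult)
        finally show ?thesis by (auto simp: indicator_def)
      qed
      show "integrable lborel (\<lambda>y. f (\<xi> (y, t)) * (1 / U (y, t)))"
      proof (rule integrable_bounded_support[of _ "- (\<epsilon> / \<delta>)" "\<epsilon> / \<delta>" "(V + V) * (1 / \<delta>)"])
        show "(\<lambda>y. f (\<xi> (y, t)) * (1 / U (y, t))) \<in> borel_measurable borel" by measurable
        show "\<bar>f (\<xi> (y, t)) * (1 / U (y, t))\<bar> \<le> (V + V) * (1 / \<delta>)" for y
          unfolding abs_mult
        proof (rule mult_mono)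
          show "\<bar>f (\<xi> (y, t))\<bar> \<le> V + V" using le V_nonneg by (auto simp: f_def indicator_def)
        qed (use abs_inverse_U V_nonneg in auto)
      qed (simp add: f_def far)
      show "indicator {0..\<epsilon>} (\<sigma> * y) * \<bar>vb (U (y, t)) - w t\<bar> \<le> f (\<xi> (y, t)) * (1 / U (y, t))" for y
      proof (cases "\<sigma> * y \<in> {0..\<epsilon>}")
        case True
        have "\<sigma> * (\<xi> (y, t) - X t) \<in> {0..\<epsilon> / \<delta>}"
        proof -
          have "0 \<le> \<sigma> * (\<xi> (y, t) - X t)"
            using \<sigma> True \<xi>_bounds(2)[of 0 y t] \<xi>_bounds(2)[of y 0 t] by (auto simp: \<xi>_0)
          moreover have "\<sigma> * (\<xi> (y, t) - X t) \<le> \<epsilon> / \<delta>"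
          proof -
            have "\<bar>y\<bar> / \<delta> \<le> \<epsilon> / \<delta>" using True \<sigma> \<delta> by (intro divide_right_mono) auto
            then show ?thesis using \<xi>_near_X[of y t] \<sigma> by auto
          qed
          ultimately show ?thesis by simp
        qed
        then have "f (\<xi> (y, t)) = \<bar>vb (U (y, t)) - w t\<bar>" by (simp add: f_def P_\<xi>)
        then show ?thesis
          using True mult_left_mono[OF inverse_U(2)[of "(y, t)"], of "\<bar>vb (U (y, t)) - w t\<bar>"] by simp
      next
        case False
        have "0 \<le> f (\<xi> (y, t))" by (simp add: f_def)
        then show ?thesis
          using False order_trans[OF zero_le_one inverse_U(2)[of "(y, t)"]] by simp
      qed
    qed
    also have "\<dots> = (LBINT x. f x)" by (rule integral_\<xi>) measurable
    also have "\<dots> = (LBINT s:{0..\<epsilon> / \<delta>}. ?r (t, s))"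
      unfolding set_lebesgue_integral_def
      by (subst aff[of _ "X t"]) (simp add: f_def mult.assoc[symmetric] \<sigma>2)
    finally show ?thesis .
  qed
  have int: "set_integrable lborel {0..\<tau>} (\<lambda>t. LBINT s:{0..y}. g (t, s))"
    if "g \<in> borel_measurable borel" "\<And>z. \<bar>g z\<bar> \<le> V + V" "y \<ge> 0" for y and g :: "real \<times> real \<Rightarrow> real"
  proof (rule set_integrable_Icc_bounded)
    note [measurable] = that(1)
    have "case_prod (\<lambda>t s. indicator {0..y} s * g (t, s)) \<in> borel_measurable (borel \<Otimes>\<^sub>M lborel)"
      by measurable
    from lborel.borel_measurable_lebesgue_integral[OF this]
    show "(\<lambda>t. LBINT s:{0..y}. g (t, s)) \<in> borel_measurable borel"
      by (simp add: set_lebesgue_integral_def)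
    show "\<bar>LBINT s:{0..y}. g (t, s)\<bar> \<le> (V + V) * (y - 0)" for t
      using that by (intro abs_set_integral_Icc_le) auto
  qed
  show ?thesis
    unfolding box_Fubini_bdd_on(2)[OF qm(1) q_bdd(1)] box_Fubini_bdd_on(2)[OF qm(2) q_bdd(2)]
    using assms \<delta> by (intro set_integral_mono int qm sec le) auto
qed

end

section \<open>Integration along the trajectories\<close>

context lagrangian_solution
begin

text \<open>The factor \<open>P\<close> of the Eulerian weak form arises in the second identity: the
  integrand is multiplied and divided by \<open>U\<close>, and the weight \<open>1 / U\<close> is
  the Jacobian of \<xi> at fixed time. The first identity is the telescoped time integral along
  almost every trajectory.\<close>

lemma Lagrangian_transport:
  assumes "test_fun \<phi>"
  shows "(LINT z:UNIV \<times> {0..}|lborel. dt \<phi> (\<xi> z, snd z) + dx \<phi> (\<xi> z, snd z) * b z)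
      + (LBINT y. \<phi> (x0 y, 0)) = 0"
    and "(LINT z:UNIV \<times> {0..}|lborel. dt \<phi> (\<xi> z, snd z) + dx \<phi> (\<xi> z, snd z) * b z)
      = (LINT z:UNIV \<times> {0..}|lborel. (dt \<phi> z + dx \<phi> z * (a (fst z) * vb (P z))) * P z)"
proof -
  note \<phi> = test_fun_has_derivative[OF assms]
  note c = test_fun_continuous[OF assms]
  note [measurable] = c[THEN borel_measurable_continuous_onI]
  obtain R where R: "R > 0" and supp: "\<And>x t. \<bar>x\<bar> > R \<or> \<bar>t\<bar> > R \<Longrightarrow> \<phi> (x, t) = 0 \<and> dx \<phi> (x, t) = 0 \<and> dt \<phi> (x, t) = 0"
    by (rule test_fun_support[OF assms]) blast
  obtain XM where XM: "\<And>t. t \<in> {0..R} \<Longrightarrow> \<bar>X t\<bar> \<le> XM"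
    using bdd_on_continuous[OF compact_Icc continuous_on_subset[OF X_cont subset_UNIV]] unfolding bdd_on_def by blast
  \<comment> \<open>For times in \<open>[0, R]\<close>, a label with \<open>|y| > M\<close> is at
    distance greater than \<open>M\<close> from \<open>X t\<close>, hence outside
    \<open>[-R, R]\<close>. So one rectangle contains the supports in both coordinate
    systems.\<close>
  define M where "M = R + XM + 1"
  have "XM \<ge> 0" using XM[of 0] R by auto
  then have M: "M > R" "M > 0" using R by (auto simp: M_def)
  let ?K = "{-M..M} \<times> {0..M}"
  have K: "?K = cbox (-M, 0) (M, M)" by (auto simp: cbox_Pair_eq)
  have bdd_\<phi>: "bdd_on UNIV (dx \<phi>)" "bdd_on UNIV (dt \<phi>)"
  proof -
    have K': "compact ({-R..R} \<times> {-R..R})" by (intro compact_Times compact_Icc)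
    have "bdd_on UNIV f" if f: "continuous_on UNIV f" "\<And>x t. \<bar>x\<bar> > R \<or> \<bar>t\<bar> > R \<Longrightarrow> f (x, t) = 0"
      for f :: "real \<times> real \<Rightarrow> real"
    proof -
      have "bdd_on ({-R..R} \<times> {-R..R}) f" by (rule bdd_on_continuous[OF K' continuous_on_subset[OF f(1) subset_UNIV]])
      then obtain C where C: "\<And>z. z \<in> {-R..R} \<times> {-R..R} \<Longrightarrow> \<bar>f z\<bar> \<le> C" unfolding bdd_on_def by blast
      have "0 \<le> C" using C[of "(0, 0)"] R by simp
      have "\<bar>f z\<bar> \<le> C" for z
      proof (cases "z \<in> {-R..R} \<times> {-R..R}")
        case False
        then have "\<bar>fst z\<bar> > R \<or> \<bar>snd z\<bar> > R" by (cases z) auto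
        then show ?thesis using f(2)[of "fst z" "snd z"] \<open>0 \<le> C\<close> by simp
      qed (rule C)
      then show ?thesis by (rule bdd_onI)
    qed
    then show "bdd_on UNIV (dx \<phi>)" "bdd_on UNIV (dt \<phi>)" using c supp by blast+
  qed
  have bdd_comp: "bdd_on k (\<lambda>z. f (g z))" if "bdd_on UNIV f" for k :: "(real \<times> real) set" and f :: "real \<times> real \<Rightarrow> real" and g
    using that unfolding bdd_on_def by blast
  define F where "F z = dt \<phi> (\<xi> z, snd z) + dx \<phi> (\<xi> z, snd z) * b z" for z
  define G where "G z = (dt \<phi> z + dx \<phi> z * (a (fst z) * vb (P z))) * P z" for z
  have m: "F \<in> borel_measurable borel" "G \<in> borel_measurable borel"
    unfolding F_def[abs_def] G_def[abs_def] by measurable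
  have bd: "bdd_on ?K F" "bdd_on ?K G"
  proof -
    have 1: "\<bar>P z\<bar> \<le> 1" for z using P_ge[of z] P_le[of z] \<delta> by simp
    show "bdd_on ?K F" "bdd_on ?K G" unfolding F_def[abs_def] G_def[abs_def]
      by (intro bdd_on_add bdd_on_mult bdd_comp[OF bdd_\<phi>(1)] bdd_comp[OF bdd_\<phi>(2)] bdd_onI[OF b_le]
          bdd_onI[OF a_le] bdd_onI[OF vb_le] bdd_onI[OF 1])+
  qed
  note F = box_Fubini_bdd_on[OF m(1) bd(1)] and G = box_Fubini_bdd_on[OF m(2) bd(2)]
  have far: "R < \<bar>\<xi> (y, t)\<bar>" if "t \<in> {0..R}" "\<bar>y\<bar> > M" for y t
    using \<xi>_far_X[of y t] XM[OF that(1)] that(2) by (auto simp: M_def)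
  have far0: "R < \<bar>x0 y\<bar>" if "\<bar>y\<bar> > M" for y
    using x0_far_X[of y] XM[of 0] that R by (auto simp: M_def)
  have F0: "F (y, t) = 0" if "t \<ge> 0" "\<bar>y\<bar> > M \<or> t > M" for y t
    using that far[of t y] supp[of "\<xi> (y, t)" t] M by (cases "t \<le> R") (auto simp: F_def)
  have G0: "G (x, t) = 0" if "\<bar>x\<bar> > M \<or> t > M" for x t
    using that supp[of x t] M by (auto simp: G_def)
  have restrict: "(LINT z:UNIV \<times> {0..}|lborel. H z) = (LINT z:?K|lborel. H z)"
    if "\<And>y t. t \<ge> 0 \<Longrightarrow> \<bar>y\<bar> > M \<or> t > M \<Longrightarrow> H (y, t) = 0" for H :: "real \<times> real \<Rightarrow> real"
    unfolding set_lebesgue_integral_def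
  proof (rule Bochner_Integration.integral_cong)
    fix z :: "real \<times> real"
    show "indicator (UNIV \<times> {0..}) z *\<^sub>R H z = indicator ?K z *\<^sub>R H z"
    proof (cases "z \<in> ?K")
      case True
      then have "z \<in> UNIV \<times> {0..}" by auto
      with True show ?thesis by simp
    next
      case False
      show ?thesis
      proof (cases "0 \<le> snd z")
        case True
        moreover from this False have "M < \<bar>fst z\<bar> \<or> M < snd z"
          by (cases z) (auto simp: abs_le_iff not_less not_le)
        ultimately have "H (fst z, snd z) = 0" by (rule that)
        with False show ?thesis by simp
      next
        case False
        then have "z \<notin> UNIV \<times> {0..}" by (cases z) auto
        with \<open>z \<notin> ?K\<close> show ?thesis by simp
      qed
    qed
  qed simp
  have restrict1: "(LBINT y:{-M..M}. h y) = (LBINT y. h y)"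
    if "\<And>y. \<bar>y\<bar> > M \<Longrightarrow> h y = 0" for h :: "real \<Rightarrow> real"
    unfolding set_lebesgue_integral_def
  proof (rule Bochner_Integration.integral_cong)
    fix y
    show "indicator {-M..M} y *\<^sub>R h y = h y"
      using that[of y] by (cases "\<bar>y\<bar> > M") (auto simp: indicator_def abs_le_iff)
  qed simp
  have "AE y in lborel. AE t in lborel. 0 < t \<longrightarrow> E (y, t) = 0"
    using AE_lborel_sections(1)[OF AE_E_zero] by simp
  then have "AE y in lborel. (LBINT t:{0..M}. F (y, t)) = - \<phi> (x0 y, 0)"
  proof eventually_elim
    case (elim y)
    \<comment> \<open>\<xi> agrees with this curve only for almost every time, while the chain rule
      asks for the integral representation at all times of the interval.\<close>
    define g where "g t = x0 y + B (y, t)" for t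
    have gm [measurable]: "g \<in> borel_measurable borel" unfolding g_def[abs_def] by measurable
    have "(LBINT t:{0..M}. F (y, t)) = (LBINT t:{0..M}. dt \<phi> (g t, t) + dx \<phi> (g t, t) * b (y, t))"
      unfolding set_lebesgue_integral_def
    proof (rule integral_cong_AE)
      show "AE t in lborel. indicator {0..M} t *\<^sub>R F (y, t) =
          indicator {0..M} t *\<^sub>R (dt \<phi> (g t, t) + dx \<phi> (g t, t) * b (y, t))"
        using elim AE_lborel_singleton[of 0]
      proof eventually_elim
        case (elim t)
        show ?case
        proof (cases "t \<in> {0..M}")
          case True
          with elim have "\<xi> (y, t) = g t" by (auto simp: E_def g_def)
          then show ?thesis by (simp add: F_def)
        qed simp
      qed
    qed (use m(1) in measurable)
    also have "\<dots> = \<phi> (g M, M) - \<phi> (x0 y, 0)"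
      by (rule integral_chain_rule[where b = "\<lambda>t. b (y, t)" and C = "A * V"])
        (use M \<phi> c b_le in \<open>auto simp: g_def B_def\<close>)
    also have "\<phi> (g M, M) = 0" using supp[of "g M" M] M by simp
    finally show ?case by simp
  qed
  then have "(LBINT y:{-M..M}. LBINT t:{0..M}. F (y, t)) = (LBINT y. - \<phi> (x0 y, 0))"
    unfolding set_lebesgue_integral_def[of lborel "{-M..M}"]
  proof (intro integral_cong_AE)
    show "(\<lambda>y. indicator {- M..M} y *\<^sub>R (LBINT t:{0..M}. F (y, t))) \<in> borel_measurable lborel"
    proof -
      note [measurable] = m(1)
      have "case_prod (\<lambda>t s. indicator {0..M} s * F (t, s)) \<in> borel_measurable (borel \<Otimes>\<^sub>M lborel)"
        by measurable
      from lborel.borel_measurable_lebesgue_integral[OF this]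
      show ?thesis by (simp add: set_lebesgue_integral_def)
    qed
    show "(\<lambda>y. - \<phi> (x0 y, 0)) \<in> borel_measurable lborel" by measurable
  next
    assume "AE y in lborel. (LBINT t:{0..M}. F (y, t)) = - \<phi> (x0 y, 0)"
    then show "AE y in lborel. indicator {- M..M} y *\<^sub>R (LBINT t:{0..M}. F (y, t)) = - \<phi> (x0 y, 0)"
    proof eventually_elim
      case (elim y)
      have "\<phi> (x0 y, 0) = 0" if "y \<notin> {-M..M}"
        using far0[of y] supp[of "x0 y" 0] that by auto
      then show ?case using elim by (cases "y \<in> {-M..M}") auto
    qed
  qed
  then show "(LINT z:UNIV \<times> {0..}|lborel. dt \<phi> (\<xi> z, snd z) + dx \<phi> (\<xi> z, snd z) * b z)
      + (LBINT y. \<phi> (x0 y, 0)) = 0"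
    using restrict[of F, OF F0] unfolding F(2) by (simp add: F_def)
  have "(LBINT y:{-M..M}. F (y, t)) = (LBINT x:{-M..M}. G (x, t))" if "t \<in> {0..M}" for t
  proof -
    have "(LBINT y:{-M..M}. F (y, t)) = (LBINT y. F (y, t))"
      using that by (intro restrict1 F0) auto
    also have "\<dots> = (LBINT y. G (\<xi> (y, t), t) * (1 / U (y, t)))"
    proof (rule Bochner_Integration.integral_cong)
      fix y
      have "U (y, t) \<noteq> 0" using U_ge[of "(y, t)"] \<delta> by linarith
      then show "F (y, t) = G (\<xi> (y, t), t) * (1 / U (y, t))"
        by (simp add: F_def G_def P_\<xi> b_def)
    qed simp
    also have "\<dots> = (LBINT x. G (x, t))" by (rule integral_\<xi>) (use m(2) in measurable)
    also have "\<dots> = (LBINT x:{-M..M}. G (x, t))"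
      by (intro restrict1[symmetric] G0) auto
    finally show ?thesis .
  qed
  then have "(LINT z:?K|lborel. F z) = (LINT z:?K|lborel. G z)"
    unfolding F(3) G(3) by (intro set_lebesgue_integral_cong) auto
  then show "(LINT z:UNIV \<times> {0..}|lborel. dt \<phi> (\<xi> z, snd z) + dx \<phi> (\<xi> z, snd z) * b z)
      = (LINT z:UNIV \<times> {0..}|lborel. (dt \<phi> z + dx \<phi> z * (a (fst z) * vb (P z))) * P z)"
    using restrict[of F, OF F0] restrict[of G] G0 by (simp add: F_def G_def)
qed

end

section \<open>From Lagrangian to Eulerian coordinates\<close>

lemma half_plane_borel [measurable]: "UNIV \<times> {0..} \<in> sets (borel :: (real \<times> real) measure)"
  by (intro borel_closed closed_Times) auto

locale vehicle_flow =
  fixes u_L \<rho> a_L :: "real \<times> real \<Rightarrow> real"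
    and u0_L u0 a v X :: "real \<Rightarrow> real"
    and T :: "real \<times> real \<Rightarrow> real \<times> real"
    and \<delta> :: real
  assumes u_L_Linfty: "Linfty_on (UNIV \<times> {0..}) u_L"
    and u_L_weak: "weak_solution (\<lambda>z. 1 / u_L z) (\<lambda>z. - (a_L z * v (u_L z))) (\<lambda>y. 1 / u0_L y)"
    and u_L_initial: "AE y in lebesgue. u_L (y, 0) = u0_L y"
    and \<rho>_def: "\<rho> = u_L \<circ> T"
    and \<rho>_int: "\<And>t x1 x2. t \<ge> 0 \<Longrightarrow> set_integrable lebesgue {x1..x2} (\<lambda>z. \<rho> (z, t))"
    and T: "\<And>x t. t \<ge> 0 \<Longrightarrow> T (x, t) = (LINT z = X t..x | lebesgue. \<rho> (z, t), t)"
    and X: "vehicle_trajectory a v \<rho> X"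
    and \<delta>: "0 < \<delta>"
    and \<rho>_bounds: "\<And>x t. t \<ge> 0 \<Longrightarrow> \<delta> \<le> \<rho> (x, t) \<and> \<rho> (x, t) \<le> 1"
    and v_lip: "\<exists>L. L-lipschitz_on {\<delta><..1} v"
    and a_Linfty: "Linfty_on UNIV a"
    and a_lip: "\<exists>L. L-lipschitz_on UNIV a"
    and a_pos: "\<And>x. a x > 0"
    and a_L: "\<And>x t. t \<ge> 0 \<Longrightarrow> a_L (T (x, t)) = a x"
    and u0_L: "\<And>x. u0_L (fst (T (x, 0))) = u0 x"
begin

definition Y :: "real \<Rightarrow> real \<Rightarrow> real" where
  "Y t x = fst (T (x, t))"

lemma T_Y: "t \<ge> 0 \<Longrightarrow> T (x, t) = (Y t x, t)"
  by (simp add: Y_def T)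

lemma \<rho>_Y: "t \<ge> 0 \<Longrightarrow> u_L (Y t x, t) = \<rho> (x, t)"
  by (simp add: \<rho>_def T_Y)

lemma profile: "t \<ge> 0 \<Longrightarrow> mass_profile (\<lambda>x. \<rho> (x, t)) (Y t) (X t) \<delta>"
  using \<rho>_int \<rho>_bounds \<delta> by unfold_locales (auto simp: Y_def T)

lemma \<delta>_le_1: "\<delta> \<le> 1"
  using \<rho>_bounds[of 0 0] by simp

text \<open>At each time \<open>t \<ge> 0\<close> the map \<open>Y t\<close> is onto the line, so
  the pointwise bounds of \<rho> reach every label y.\<close>

lemma u_L_bounds: "t \<ge> 0 \<Longrightarrow> \<delta> \<le> u_L (y, t) \<and> u_L (y, t) \<le> 1"
  using mass_profile.Y_surj[OF profile, of t y] \<rho>_bounds \<rho>_Y by metis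

text \<open>
  Only the values of \<open>v\<close> on \<open>[\<delta>, 1]\<close> and of \<open>X\<close> at times \<open>\<ge> 0\<close> are under control; \<open>vb\<close> and \<open>Xb\<close>
  extend them to a bounded Borel and to a continuous function on the line.
\<close>

definition vb :: "real \<Rightarrow> real" where
  "vb r = (if r = \<delta> then v \<delta> else indicator {\<delta><..1} r * v r)"

lemma vb_eq: "\<delta> \<le> r \<Longrightarrow> r \<le> 1 \<Longrightarrow> vb r = v r"
  by (auto simp: vb_def indicator_def)

lemma vb_meas: "vb \<in> borel_measurable borel"
proof -
  have "continuous_on {\<delta><..1} v" using v_lip lipschitz_on_continuous_on by blast
  then have [measurable]: "(\<lambda>r. indicator {\<delta><..1} r * v r) \<in> borel_measurable borel"
    using borel_measurable_continuous_on_indicator[of "{\<delta><..1}" v] by simp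
  show ?thesis unfolding vb_def[abs_def] by measurable
qed

text \<open>On the half-open interval the Lipschitz bound compares with the value at 1. It says
  nothing about the endpoint \<delta>, whose value enters as a separate summand.\<close>

lemma vb_bounded: "\<exists>V. \<forall>r. \<bar>vb r\<bar> \<le> V"
proof -
  obtain L where L: "L-lipschitz_on {\<delta><..1} v" using v_lip by blast
  then have "0 \<le> L" by (simp add: lipschitz_on_def)
  have "\<bar>v r\<bar> \<le> \<bar>v 1\<bar> + L * (1 - \<delta>)" if "\<delta> < r" "r \<le> 1" for r
  proof -
    have "dist (v r) (v 1) \<le> L * dist r 1" using that by (intro lipschitz_onD[OF L]) auto
    also have "\<dots> \<le> L * (1 - \<delta>)"
      using that \<open>0 \<le> L\<close> by (intro mult_left_mono) (auto simp: dist_real_def)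
    finally show ?thesis by (simp add: dist_real_def)
  qed
  then have "\<bar>vb r\<bar> \<le> \<bar>v \<delta>\<bar> + (\<bar>v 1\<bar> + L * (1 - \<delta>))" for r
    using \<open>0 \<le> L\<close> \<delta>_le_1 by (auto simp: vb_def indicator_def intro: add_increasing)
  then show ?thesis by blast
qed

lemma a_cont: "continuous_on UNIV a"
  using a_lip lipschitz_on_continuous_on by blast

text \<open>Continuity upgrades the essential bound: the set where it holds is closed and of full
  measure, hence the whole line.\<close>

lemma a_bounded: "\<exists>A. \<forall>x. \<bar>a x\<bar> \<le> A"
proof -
  obtain C where "AE x in lebesgue_on UNIV. \<bar>a x\<bar> \<le> C" using a_Linfty by (auto simp: Linfty_on_def)
  then have "AE x in lebesgue. x \<in> {x. \<bar>a x\<bar> \<le> C}" unfolding lebesgue_on_UNIV_eq by simp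
  moreover have "closed {x. \<bar>a x\<bar> \<le> C}" by (intro closed_Collect_le continuous_intros a_cont)
  ultimately have "x \<in> {x. \<bar>a x\<bar> \<le> C}" for x by (intro mem_closed_if_AE_lebesgue)
  then show ?thesis by auto
qed

definition Xb :: "real \<Rightarrow> real" where
  "Xb t = X (max 0 t)"

lemma Xb_eq: "t \<ge> 0 \<Longrightarrow> Xb t = X t"
  by (simp add: Xb_def)

lemma Xb_cont: "continuous_on UNIV Xb"
proof (rule continuous_at_imp_continuous_on, safe)
  fix t :: real
  have "\<exists>L. L-lipschitz_on {0..\<bar>t\<bar> + 1} X" using X unfolding vehicle_trajectory_def by (simp add: add_nonneg_pos)
  then have "continuous_on {0..\<bar>t\<bar> + 1} X" using lipschitz_on_continuous_on by blast
  then have "continuous_on {..<\<bar>t\<bar> + 1} Xb"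
    unfolding Xb_def by (rule continuous_on_compose2) (auto intro!: continuous_intros)
  then show "isCont Xb t"
    by (rule continuous_on_interior) (auto simp: interior_open)
qed

lemma ex_U:
  obtains U where "U \<in> borel_measurable borel" "\<And>z. \<delta> \<le> U z" "\<And>z. U z \<le> 1"
    "AE z in lborel. 0 \<le> snd z \<longrightarrow> u_L z = U z"
proof -
  let ?S = "UNIV \<times> {0..} :: (real \<times> real) set"
  have S: "?S \<in> sets lebesgue" using half_plane_borel by simp
  have "u_L \<in> borel_measurable (lebesgue_on ?S)" using u_L_Linfty by (simp add: Linfty_on_def)
  then have "(\<lambda>z. indicator ?S z *\<^sub>R u_L z) \<in> borel_measurable lebesgue"
    using borel_measurable_restrict_space_iff[of ?S lebesgue u_L] S by simp
  then obtain g where g: "g \<in> borel_measurable lborel" "AE z in lborel. indicator ?S z *\<^sub>R u_L z = g z"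
    using completion_ex_borel_measurable_real by blast
  define U where "U z = max \<delta> (min 1 (g z))" for z
  show ?thesis
  proof (rule that[of U])
    show "U \<in> borel_measurable borel" using g(1) unfolding U_def[abs_def] by measurable
    show "\<delta> \<le> U z" "U z \<le> 1" for z using \<delta>_le_1 by (auto simp: U_def)
    show "AE z in lborel. 0 \<le> snd z \<longrightarrow> u_L z = U z"
      using g(2)
    proof eventually_elim
      case (elim z)
      then show ?case using u_L_bounds[of "snd z" "fst z"] by (cases z) (auto simp: U_def)
    qed
  qed
qed

lemma u0_L_initial: "AE y in lborel. u_L (y, 0) = u0_L y"
  using u_L_initial by (simp add: AE_completion_iff)

text \<open>Measurability comes from the local integrability of \<open>1 / u0_L\<close> in the weak
  formulation; the bounds come from \<open>u_L\<close> at time 0, with which \<open>u0_L\<close>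
  agrees almost everywhere.\<close>

lemma ex_U0:
  obtains U0 where "U0 \<in> borel_measurable borel" "\<And>z. \<delta> \<le> U0 z" "\<And>z. U0 z \<le> 1"
    "AE y in lborel. u0_L y = U0 y"
proof -
  have "set_integrable lebesgue {p..q} (\<lambda>y. 1 / u0_L y)" for p q :: real
    using u_L_weak unfolding weak_solution_def loc_integrable_on_def by simp
  then have "(\<lambda>y. 1 / u0_L y) \<in> borel_measurable lebesgue"
    by (rule borel_measurable_lebesgue_if_set_integrable)
  then obtain g where g: "g \<in> borel_measurable lborel" "AE y in lborel. 1 / u0_L y = g y"
    using completion_ex_borel_measurable_real by blast
  define U0 where "U0 y = max \<delta> (min 1 (1 / g y))" for y
  show ?thesis
  proof (rule that[of U0])
    show "U0 \<in> borel_measurable borel" using g(1) unfolding U0_def[abs_def] by measurable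
    show "\<delta> \<le> U0 z" "U0 z \<le> 1" for z using \<delta>_le_1 by (auto simp: U0_def)
    show "AE y in lborel. u0_L y = U0 y"
      using g(2) u0_L_initial
    proof eventually_elim
      case (elim y)
      then have "1 / g y = u0_L y" by (metis div_by_1 divide_divide_eq_right mult_1)
      then show ?case using elim u_L_bounds[of 0 y] by (auto simp: U0_def)
    qed
  qed
qed

text \<open>Measurability of \<open>v (\<rho> (X t, t))\<close> in t is not given. For almost every
  positive time this speed is recovered as a Borel version of the derivative of \<open>X\<close>
  divided by the positive number \<open>a (X t)\<close>, then clamped to
  \<open>[-V, V]\<close>.\<close>

lemma ex_w:
  assumes V: "\<And>r. \<bar>vb r\<bar> \<le> V"
  obtains w where "w \<in> borel_measurable borel" "\<And>t. \<bar>w t\<bar> \<le> V"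
    "AE t in lborel. 0 < t \<longrightarrow> w t = v (\<rho> (X t, t))"
    "\<And>t. t \<ge> 0 \<Longrightarrow> Xb t = Xb 0 + (LBINT s:{0..t}. a (Xb s) * w s)"
proof -
  have lip: "\<And>\<tau>. \<tau> > 0 \<Longrightarrow> \<exists>L. L-lipschitz_on {0..\<tau>} X"
    and der: "AE t in lborel. t > 0 \<longrightarrow> (X has_real_derivative a (X t) * v (\<rho> (X t, t))) (at t)"
    using X unfolding vehicle_trajectory_def by (auto simp: AE_completion_iff)
  obtain g where g: "g \<in> borel_measurable borel" "AE t in lborel. t > 0 \<longrightarrow> g t = a (X t) * v (\<rho> (X t, t))"
    and X_eq: "\<And>\<tau>. \<tau> \<ge> 0 \<Longrightarrow> X \<tau> = X 0 + (LBINT s:{0..\<tau>}. g s)"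
    using lipschitz_eq_integral_of_derivative[OF lip der] by blast
  note [measurable] = g(1) borel_measurable_continuous_onI[OF Xb_cont] borel_measurable_continuous_onI[OF a_cont]
  define w where "w t = max (- V) (min V (g t / a (Xb t)))" for t
  have V0: "0 \<le> V" using V[of 0] by simp
  have wm [measurable]: "w \<in> borel_measurable borel" unfolding w_def[abs_def] by measurable
  have w_eq: "AE t in lborel. 0 < t \<longrightarrow> w t = v (\<rho> (X t, t))"
    using g(2)
  proof eventually_elim
    case (elim t)
    show ?case
    proof
      assume "0 < t"
      then have "g t / a (Xb t) = v (\<rho> (X t, t))" using elim a_pos[of "X t"] by (simp add: Xb_eq)
      moreover have "\<bar>v (\<rho> (X t, t))\<bar> \<le> V"
        using V[of "\<rho> (X t, t)"] vb_eq \<rho>_bounds[of t "X t"] \<open>0 < t\<close> by simp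
      ultimately show "w t = v (\<rho> (X t, t))" by (auto simp: w_def)
    qed
  qed
  have "Xb t = Xb 0 + (LBINT s:{0..t}. a (Xb s) * w s)" if "t \<ge> 0" for t
  proof -
    have "(LBINT s:{0..t}. g s) = (LBINT s:{0..t}. a (Xb s) * w s)"
      unfolding set_lebesgue_integral_def
    proof (rule integral_cong_AE)
      show "AE s in lborel. indicator {0..t} s *\<^sub>R g s = indicator {0..t} s *\<^sub>R (a (Xb s) * w s)"
        using g(2) w_eq AE_lborel_singleton[of 0]
        by eventually_elim (auto simp: indicator_def Xb_eq)
    qed measurable
    then show ?thesis using X_eq[OF that] that by (simp add: Xb_eq)
  qed
  moreover have "\<bar>w t\<bar> \<le> V" for t using V0 by (auto simp: w_def)
  ultimately show ?thesis using that wm w_eq by blast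
qed

end

section \<open>Matching the Borel representatives with the given data\<close>

locale vehicle_flow_borel = vehicle_flow +
  fixes U :: "real \<times> real \<Rightarrow> real" and U0 w :: "real \<Rightarrow> real" and \<sigma> A L V :: real
  assumes U: "U \<in> borel_measurable borel" "\<And>z. \<delta> \<le> U z" "\<And>z. U z \<le> 1"
      "AE z in lborel. 0 \<le> snd z \<longrightarrow> u_L z = U z"
    and U0: "U0 \<in> borel_measurable borel" "\<And>z. \<delta> \<le> U0 z" "\<And>z. U0 z \<le> 1"
      "AE y in lborel. u0_L y = U0 y"
    and w: "w \<in> borel_measurable borel" "\<And>t. \<bar>w t\<bar> \<le> V"
      "AE t in lborel. 0 < t \<longrightarrow> w t = v (\<rho> (X t, t))"
      "\<And>t. t \<ge> 0 \<Longrightarrow> Xb t = Xb 0 + (LBINT s:{0..t}. a (Xb s) * w s)"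
    and a_Lip: "\<And>x y. \<bar>a x - a y\<bar> \<le> L * \<bar>x - y\<bar>" and a_le: "\<And>x. \<bar>a x\<bar> \<le> A"
    and vb_le: "\<And>r. \<bar>vb r\<bar> \<le> V"
    and \<sigma>: "\<sigma> \<in> {-1, 1}"
    and X_trace: "strong_trace \<sigma> (\<lambda>z. v (\<rho> z)) X (\<lambda>t. v (\<rho> (X t, t)))"
begin

sublocale lagrangian U U0 Xb w a vb \<sigma> \<delta> A L V
  by unfold_locales (fact U U0 w a_Lip a_le vb_le \<sigma> \<delta> Xb_cont vb_meas)+

text \<open>By Fubini, for almost every time the section of \<open>U\<close> represents that of
  \<open>u_L\<close>; at such nonnegative times \<xi> is the inverse of the mass coordinate.\<close>

lemma coordinates:
  "AE t in lborel. 0 \<le> t \<longrightarrow>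
    mass_coordinate (\<lambda>x. \<rho> (x, t)) (Y t) (X t) \<delta> (\<lambda>y. u_L (y, t)) (\<lambda>y. U (y, t)) (\<lambda>y. \<xi> (y, t))"
  using AE_lborel_sections(2)[OF U(4)]
proof eventually_elim
  case (elim t)
  show ?case
  proof
    assume t: "0 \<le> t"
    interpret mass_profile "\<lambda>x. \<rho> (x, t)" "Y t" "X t" \<delta> by (rule profile[OF t])
    show "mass_coordinate (\<lambda>x. \<rho> (x, t)) (Y t) (X t) \<delta> (\<lambda>y. u_L (y, t)) (\<lambda>y. U (y, t)) (\<lambda>y. \<xi> (y, t))"
    proof unfold_locales
      show "(\<lambda>y. U (y, t)) \<in> borel_measurable borel" by measurable
      show "AE y in lborel. u_L (y, t) = U (y, t)" using elim t by (auto elim!: eventually_mono)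
    qed (use t U \<rho>_Y in \<open>auto simp: \<xi>_section Xb_eq\<close>)
  qed
qed

text \<open>The single time 0 may be exceptional for \<open>U\<close>, so it is handled with the
  representative \<open>U0\<close> of the initial datum.\<close>

lemma initial_coordinates: "mass_coordinate (\<lambda>x. \<rho> (x, 0)) (Y 0) (X 0) \<delta> (\<lambda>y. u_L (y, 0)) U0 x0"
proof -
  interpret mass_profile "\<lambda>x. \<rho> (x, 0)" "Y 0" "X 0" \<delta> by (rule profile) simp
  show ?thesis
  proof unfold_locales
    show "AE y in lborel. u_L (y, 0) = U0 y" using U0(4) u0_L_initial by eventually_elim simp
  qed (use U0 \<rho>_Y in \<open>auto simp: x0_def Xb_eq\<close>)
qed

lemma Y_eq_\<Upsilon>: "AE t in lborel. 0 \<le> t \<longrightarrow> (\<forall>x. Y t x = \<Upsilon> (x, t))"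
  using coordinates
proof eventually_elim
  case (elim t)
  show ?case
  proof (intro impI allI)
    fix x assume "0 \<le> t"
    then have "\<xi> (Y t x, t) = x" using elim mass_coordinate.G_Y by blast
    then show "Y t x = \<Upsilon> (x, t)" using \<Upsilon>_\<xi>[of "Y t x" t] by simp
  qed
qed

text \<open>Composition with \<open>T\<close> respects almost everywhere equality since
  \<open>Y t\<close> pulls null sets back to null sets. To assemble the time sections, the
  exceptional set is described by the Borel map \<Upsilon>, which equals \<open>Y t\<close> for
  almost every nonnegative time.\<close>

lemma \<rho>_eq_P: "AE z in lborel. 0 \<le> snd z \<longrightarrow> \<rho> z = P z"
proof -
  obtain N where N: "N \<in> sets borel" "AE z in lborel. z \<notin> N" "\<And>z. z \<notin> N \<Longrightarrow> 0 \<le> snd z \<longrightarrow> u_L z = U z"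
    using AE_lborel_borel_null_set[OF U(4)] by blast
  define N' where "N' = {z. 0 \<le> snd z \<and> (\<Upsilon> z, snd z) \<in> N}"
  note [measurable] = N(1)
  have m: "N' \<in> sets borel"
  proof -
    have "{z \<in> space borel. 0 \<le> snd z \<and> (\<Upsilon> z, snd z) \<in> N} \<in> sets borel" by measurable
    then show ?thesis by (simp add: N'_def)
  qed
  have "AE t in lborel. AE x in lborel. (x, t) \<notin> N'"
    using AE_lborel_sections(2)[OF N(2)] Y_eq_\<Upsilon>
  proof eventually_elim
    case (elim t)
    show ?case
    proof (cases "0 \<le> t")
      case True
      have "AE x in lborel. (Y t x, t) \<notin> N"
        by (rule mass_profile.AE_pullback[OF profile[OF True] elim(1)])
      then show ?thesis using elim(2) True by (simp add: N'_def)
    qed (simp add: N'_def)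
  qed
  then have "AE z in lborel. z \<notin> N'" by (rule AE_lborel_if_sections(2)[OF m])
  then show ?thesis using AE_lborel_fst_snd(1)[OF Y_eq_\<Upsilon>]
  proof eventually_elim
    case (elim z)
    obtain x t where z: "z = (x, t)" by (cases z)
    show ?case
    proof
      assume "0 \<le> snd z"
      then have t: "0 \<le> t" "Y t x = \<Upsilon> (x, t)" using elim(2) z by auto
      then have "\<rho> z = u_L (\<Upsilon> (x, t), t)" using \<rho>_Y[of t x] z by simp
      then show "\<rho> z = P z" using N(3)[of "(\<Upsilon> (x, t), t)"] elim(1) z t by (simp add: N'_def P_def)
    qed
  qed
qed

text \<open>\<open>a_L\<close> is prescribed along \<open>T\<close> only; \<open>Y t\<close> maps
  \<open>\<xi> (y, t)\<close> back to y for almost every nonnegative time, so at these times every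
  label is reached.\<close>

lemma a_L_eq: "AE z in lborel. 0 \<le> snd z \<longrightarrow> a_L z = a (\<xi> z)"
proof -
  have "AE t in lborel. 0 \<le> t \<longrightarrow> (\<forall>y. a_L (y, t) = a (\<xi> (y, t)))"
    using coordinates
  proof eventually_elim
    case (elim t)
    show ?case
    proof (intro impI allI)
      fix y assume t: "0 \<le> t"
      then have "Y t (\<xi> (y, t)) = y" using elim mass_coordinate.Y_G by blast
      then show "a_L (y, t) = a (\<xi> (y, t))" using a_L[OF t, of "\<xi> (y, t)"] T_Y[OF t, of "\<xi> (y, t)"] by simp
    qed
  qed
  from AE_lborel_fst_snd(1)[OF this] show ?thesis by eventually_elim (metis prod.collapse)
qed

lemma weak_borel:
  assumes "test_fun \<phi>"
  shows "(LINT z:UNIV \<times> {0..}|lborel. dt \<phi> z * (1 / U z) - dx \<phi> z * b z) + (LBINT y. \<phi> (y, 0) * (1 / U0 y)) = 0"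
proof -
  note [measurable] = test_fun_continuous[OF assms, THEN borel_measurable_continuous_onI]
  have eq1: "(LINT z:UNIV \<times> {0..}|lebesgue. dt \<phi> z * (1 / u_L z) + dx \<phi> z * - (a_L z * v (u_L z)))
      = (LINT z:UNIV \<times> {0..}|lborel. dt \<phi> z * (1 / U z) - dx \<phi> z * b z)"
  proof (rule set_integral_lebesgue_eq_lborel(1))
    show "AE z in lborel. z \<in> UNIV \<times> {0..} \<longrightarrow>
        dt \<phi> z * (1 / u_L z) + dx \<phi> z * - (a_L z * v (u_L z)) = dt \<phi> z * (1 / U z) - dx \<phi> z * b z"
      using U(4) a_L_eq
    proof eventually_elim
      case (elim z)
      have "vb (U z) = v (U z)" using U(2,3) by (intro vb_eq)
      then show ?case using elim by (cases z) (auto simp: b_def)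
    qed
  qed measurable
  have eq2: "(LINT y|lebesgue. \<phi> (y, 0) * (1 / u0_L y)) = (LBINT y. \<phi> (y, 0) * (1 / U0 y))"
    by (rule integral_lebesgue_eq_lborel(1)) (measurable, use U0(4) in \<open>auto elim!: eventually_mono\<close>)
  have "(LINT z:UNIV \<times> {0..}|lebesgue. dt \<phi> z * (1 / u_L z) + dx \<phi> z * - (a_L z * v (u_L z)))
      + (LINT y|lebesgue. \<phi> (y, 0) * (1 / u0_L y)) = 0"
    using u_L_weak assms unfolding weak_solution_def by blast
  then show ?thesis unfolding eq1 eq2 .
qed

text \<open>The shift \<open>(t, s) \<mapsto> (Xb t + \<sigma> s, t)\<close> acts affinely on each
  time section, so the null set where \<rho> and \<open>P\<close> differ pulls back to a null set in
  the coordinates of the trace.\<close>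

lemma trace_borel:
  assumes "\<tau> > 0"
  shows "((\<lambda>\<epsilon>. (1 / \<epsilon>) * (LINT p:{0..\<tau>} \<times> {0..\<epsilon>}|lborel.
      \<bar>vb (P (Xb (fst p) + \<sigma> * snd p, fst p)) - w (fst p)\<bar>)) \<longlongrightarrow> 0) (at_right 0)"
proof -
  obtain N where N: "N \<in> sets borel" "AE z in lborel. z \<notin> N" "\<And>z. z \<notin> N \<Longrightarrow> 0 \<le> snd z \<longrightarrow> \<rho> z = P z"
    using AE_lborel_borel_null_set[OF \<rho>_eq_P] by blast
  define N' where "N' = {p. (Xb (fst p) + \<sigma> * snd p, fst p) \<in> N}"
  note [measurable] = N(1)
  have m: "N' \<in> sets borel"
  proof -
    have "{p \<in> space borel. (Xb (fst p) + \<sigma> * snd p, fst p) \<in> N} \<in> sets borel" by measurable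
    then show ?thesis by (simp add: N'_def)
  qed
  have "AE t in lborel. AE s in lborel. (t, s) \<notin> N'"
    using AE_lborel_sections(2)[OF N(2)]
  proof eventually_elim
    case (elim t)
    have "AE s in lborel. (Xb t + \<sigma> * s, t) \<notin> N"
    proof (rule AE_borel_affine[where P = "\<lambda>x. (x, t) \<notin> N" and c = \<sigma> and t = "Xb t"])
      show "\<sigma> \<noteq> 0" using \<sigma> by auto
      show "Measurable.pred borel (\<lambda>x. (x, t) \<notin> N)" by measurable
    qed (rule elim)
    then show ?case by (simp add: N'_def)
  qed
  then have ae1: "AE p in lborel. p \<notin> N'" by (rule AE_lborel_if_sections(1)[OF m])
  have ae: "AE p in lborel. 0 < fst p \<longrightarrow> \<bar>v (\<rho> (X (fst p) + \<sigma> * snd p, fst p)) - v (\<rho> (X (fst p), fst p))\<bar>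
      = \<bar>vb (P (Xb (fst p) + \<sigma> * snd p, fst p)) - w (fst p)\<bar>"
    using ae1 AE_lborel_fst_snd(2)[OF w(3)]
  proof eventually_elim
    case (elim p)
    show ?case
    proof
      assume p: "0 < fst p"
      then have "\<rho> (X (fst p) + \<sigma> * snd p, fst p) = P (Xb (fst p) + \<sigma> * snd p, fst p)"
        using N(3)[of "(X (fst p) + \<sigma> * snd p, fst p)"] elim(1) by (simp add: N'_def Xb_eq)
      moreover have "vb (P z) = v (P z)" for z by (intro vb_eq P_ge P_le)
      ultimately show "\<bar>v (\<rho> (X (fst p) + \<sigma> * snd p, fst p)) - v (\<rho> (X (fst p), fst p))\<bar>
          = \<bar>vb (P (Xb (fst p) + \<sigma> * snd p, fst p)) - w (fst p)\<bar>"
        using elim(2) p by simp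
    qed
  qed
  have "(LINT p:{0..\<tau>} \<times> {0..\<epsilon>}|lebesgue. \<bar>v (\<rho> (X (fst p) + \<sigma> * snd p, fst p)) - v (\<rho> (X (fst p), fst p))\<bar>)
      = (LINT p:{0..\<tau>} \<times> {0..\<epsilon>}|lborel. \<bar>vb (P (Xb (fst p) + \<sigma> * snd p, fst p)) - w (fst p)\<bar>)" for \<epsilon>
  proof (rule set_integral_lebesgue_eq_lborel(1))
    show "{0..\<tau>} \<times> {0..\<epsilon>} \<in> sets borel" by (intro borel_closed closed_Times) auto
    show "AE p in lborel. p \<in> {0..\<tau>} \<times> {0..\<epsilon>} \<longrightarrow>
        \<bar>v (\<rho> (X (fst p) + \<sigma> * snd p, fst p)) - v (\<rho> (X (fst p), fst p))\<bar>
        = \<bar>vb (P (Xb (fst p) + \<sigma> * snd p, fst p)) - w (fst p)\<bar>"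
      using ae AE_lborel_fst_snd(2)[OF AE_lborel_singleton[of 0]] by eventually_elim auto
  qed measurable
  moreover have "((\<lambda>\<epsilon>. (1 / \<epsilon>) * (LINT p:{0..\<tau>} \<times> {0..\<epsilon>}|lebesgue.
      \<bar>v (\<rho> (X (fst p) + \<sigma> * snd p, fst p)) - v (\<rho> (X (fst p), fst p))\<bar>)) \<longlongrightarrow> 0) (at_right 0)"
    using X_trace assms unfolding strong_trace_def by blast
  ultimately show ?thesis by simp
qed

sublocale lagrangian_solution U U0 Xb w a vb \<sigma> \<delta> A L V
proof unfold_locales
  fix \<tau> :: real assume \<tau>: "\<tau> > 0"
  let ?S = "\<lambda>\<epsilon>. LINT p:{0..\<tau>} \<times> {0..\<epsilon>}|lborel. \<bar>vb (P (Xb (fst p) + \<sigma> * snd p, fst p)) - w (fst p)\<bar>"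
  let ?Q = "\<lambda>\<epsilon>. LINT p:{0..\<tau>} \<times> {0..\<epsilon>}|lborel. \<bar>vb (U (\<sigma> * snd p, fst p)) - w (fst p)\<bar>"
  \<comment> \<open>A strip of width \<epsilon> in mass is controlled by one of width
    \<open>\<epsilon> / \<delta>\<close> in space, so the Eulerian trace is used at the rescaled
    width; the ratio of the widths costs the constant \<open>1 / \<delta>\<close>.\<close>
  have "filterlim (\<lambda>\<epsilon>. \<epsilon> / \<delta>) (at_right 0) (at_right 0)"
    unfolding filterlim_at
  proof
    have "((\<lambda>\<epsilon>. \<epsilon> / \<delta>) \<longlongrightarrow> 0 / \<delta>) (at_right 0)" using \<delta> by (intro tendsto_divide tendsto_ident_at tendsto_const) auto
    then show "((\<lambda>\<epsilon>. \<epsilon> / \<delta>) \<longlongrightarrow> 0) (at_right 0)" by simp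
    show "\<forall>\<^sub>F \<epsilon> in at_right 0. \<epsilon> / \<delta> \<in> {0<..} \<and> \<epsilon> / \<delta> \<noteq> 0"
      using eventually_at_right_less[of "0::real"] \<delta> by (auto elim!: eventually_mono)
  qed
  from filterlim_compose[OF trace_borel[OF \<tau>] this]
  have "((\<lambda>\<epsilon>. (1 / \<delta>) * ((1 / (\<epsilon> / \<delta>)) * ?S (\<epsilon> / \<delta>))) \<longlongrightarrow> (1 / \<delta>) * 0) (at_right 0)"
    by (intro tendsto_mult tendsto_const)
  then have lim: "((\<lambda>\<epsilon>. (1 / \<delta>) * ((1 / (\<epsilon> / \<delta>)) * ?S (\<epsilon> / \<delta>))) \<longlongrightarrow> 0) (at_right 0)" by simp
  show "((\<lambda>\<epsilon>. (1 / \<epsilon>) * ?Q \<epsilon>) \<longlongrightarrow> 0) (at_right 0)"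
  proof (rule tendsto_sandwich[OF _ _ tendsto_const lim])
    show "\<forall>\<^sub>F \<epsilon> in at_right 0. 0 \<le> (1 / \<epsilon>) * ?Q \<epsilon>"
      using eventually_at_right_less[of "0::real"]
    proof eventually_elim
      case (elim \<epsilon>)
      have "0 \<le> ?Q \<epsilon>"
        unfolding set_lebesgue_integral_def by (intro integral_nonneg_AE AE_I2) simp
      then show ?case using elim by simp
    qed
    show "\<forall>\<^sub>F \<epsilon> in at_right 0. (1 / \<epsilon>) * ?Q \<epsilon> \<le> (1 / \<delta>) * ((1 / (\<epsilon> / \<delta>)) * ?S (\<epsilon> / \<delta>))"
      using eventually_at_right_less[of "0::real"]
    proof eventually_elim
      case (elim \<epsilon>)
      have "(1 / \<delta>) * ((1 / (\<epsilon> / \<delta>)) * ?S (\<epsilon> / \<delta>)) = (1 / \<epsilon>) * ?S (\<epsilon> / \<delta>)" using \<delta> by simp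
      moreover have "(1 / \<epsilon>) * ?Q \<epsilon> \<le> (1 / \<epsilon>) * ?S (\<epsilon> / \<delta>)"
        using trace_Eulerian_bound[OF elim \<tau>] elim by (intro mult_left_mono) auto
      ultimately show ?case by linarith
    qed
  qed
qed (rule weak_borel)

lemma u0_eq: "AE x in lborel. u0 x = U0 (Y 0 x)"
  using mass_profile.AE_pullback[OF profile[OF order_refl] U0(4)] u0_L by (simp add: Y_def)

lemma Eulerian_weak_solution: "weak_solution \<rho> (\<lambda>(x, t). a x * v (\<rho> (x, t)) * \<rho> (x, t)) u0"
proof -
  interpret I: mass_coordinate "\<lambda>x. \<rho> (x, 0)" "Y 0" "X 0" \<delta> "\<lambda>y. u_L (y, 0)" U0 x0
    by (rule initial_coordinates)
  have P_abs: "\<bar>P z\<bar> \<le> 1" for z using P_ge[of z] P_le[of z] \<delta> by simp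
  have flux: "AE z in lborel. z \<in> UNIV \<times> {0..} \<longrightarrow>
      (case z of (x, t) \<Rightarrow> a x * v (\<rho> (x, t)) * \<rho> (x, t)) = a (fst z) * vb (P z) * P z"
    using \<rho>_eq_P
  proof eventually_elim
    case (elim z)
    have "vb (P z) = v (P z)" by (intro vb_eq P_ge P_le)
    then show ?case using elim by (cases z) auto
  qed
  have \<rho>P: "AE z in lborel. z \<in> UNIV \<times> {0..} \<longrightarrow> \<rho> z = P z" using \<rho>_eq_P by eventually_elim auto
  have "loc_integrable_on (UNIV \<times> {0..}) \<rho>"
    by (rule loc_integrable_on_bounded[OF P_meas P_abs \<rho>P])
  moreover have "loc_integrable_on (UNIV \<times> {0..}) (\<lambda>(x, t). a x * v (\<rho> (x, t)) * \<rho> (x, t))"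
  proof (rule loc_integrable_on_bounded[OF _ _ flux])
    show "\<bar>a (fst z) * vb (P z) * P z\<bar> \<le> A * V * 1" for z
      unfolding abs_mult by (intro mult_mono a_le vb_le P_abs mult_nonneg_nonneg A_nonneg V_nonneg) auto
  qed measurable
  moreover have "loc_integrable_on UNIV u0"
  proof (rule loc_integrable_on_bounded)
    show "\<bar>U0 (Y 0 x)\<bar> \<le> 1" for x using U0(2,3)[of "Y 0 x"] \<delta> by simp
    show "AE x in lborel. x \<in> UNIV \<longrightarrow> u0 x = U0 (Y 0 x)" using u0_eq by simp
  qed measurable
  moreover have "(LINT z:UNIV \<times> {0..}|lebesgue. dt \<phi> z * \<rho> z + dx \<phi> z * (case z of (x, t) \<Rightarrow> a x * v (\<rho> (x, t)) * \<rho> (x, t)))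
        + (LINT x|lebesgue. \<phi> (x, 0) * u0 x) = 0" if \<phi>: "test_fun \<phi>" for \<phi>
  proof -
    note [measurable] = test_fun_continuous[OF \<phi>, THEN borel_measurable_continuous_onI]
    have "(LINT z:UNIV \<times> {0..}|lebesgue. dt \<phi> z * \<rho> z + dx \<phi> z * (case z of (x, t) \<Rightarrow> a x * v (\<rho> (x, t)) * \<rho> (x, t)))
        = (LINT z:UNIV \<times> {0..}|lborel. (dt \<phi> z + dx \<phi> z * (a (fst z) * vb (P z))) * P z)"
    proof (rule set_integral_lebesgue_eq_lborel(1))
      show "AE z in lborel. z \<in> UNIV \<times> {0..} \<longrightarrow>
          dt \<phi> z * \<rho> z + dx \<phi> z * (case z of (x, t) \<Rightarrow> a x * v (\<rho> (x, t)) * \<rho> (x, t))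
          = (dt \<phi> z + dx \<phi> z * (a (fst z) * vb (P z))) * P z"
        using flux \<rho>P by eventually_elim (simp add: algebra_simps)
    qed measurable
    \<comment> \<open>The substitution \<open>y = Y 0 x\<close>, with inverse \<open>x0\<close>,
      turns the weight \<open>u0\<close> into Lebesgue measure and produces the initial term of the
      transport identity.\<close>
    moreover have "(LINT x|lebesgue. \<phi> (x, 0) * u0 x) = (LBINT y. \<phi> (x0 y, 0))"
    proof -
      have "(LINT x|lebesgue. \<phi> (x, 0) * u0 x) = (LBINT x. \<phi> (x, 0) * U0 (Y 0 x))"
        by (rule integral_lebesgue_eq_lborel(1)) (measurable, use u0_eq in \<open>auto elim!: eventually_mono\<close>)
      also have "\<dots> = (LBINT x. \<phi> (x0 (Y 0 x), 0) * U0 (Y 0 x))" by (simp add: I.G_Y)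
      also have "\<dots> = (LBINT y. \<phi> (x0 y, 0))" by (rule I.change_of_variables) measurable
      finally show ?thesis .
    qed
    ultimately show ?thesis using Lagrangian_transport[OF \<phi>] by simp
  qed
  ultimately show ?thesis unfolding weak_solution_def by blast
qed

end

lemma (in vehicle_flow) weak_solution_\<rho>: "weak_solution \<rho> (\<lambda>(x, t). a x * v (\<rho> (x, t)) * \<rho> (x, t)) u0"
proof -
  obtain U where U: "U \<in> borel_measurable borel" "\<And>z. \<delta> \<le> U z" "\<And>z. U z \<le> 1"
      "AE z in lborel. 0 \<le> snd z \<longrightarrow> u_L z = U z"
    using ex_U by blast
  obtain U0 where U0: "U0 \<in> borel_measurable borel" "\<And>z. \<delta> \<le> U0 z" "\<And>z. U0 z \<le> 1"
      "AE y in lborel. u0_L y = U0 y"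
    using ex_U0 by blast
  obtain V where V: "\<And>r. \<bar>vb r\<bar> \<le> V" using vb_bounded by blast
  obtain w where w: "w \<in> borel_measurable borel" "\<And>t. \<bar>w t\<bar> \<le> V"
      "AE t in lborel. 0 < t \<longrightarrow> w t = v (\<rho> (X t, t))"
      "\<And>t. t \<ge> 0 \<Longrightarrow> Xb t = Xb 0 + (LBINT s:{0..t}. a (Xb s) * w s)"
    using ex_w[OF V] by blast
  obtain L where L: "\<And>x y. \<bar>a x - a y\<bar> \<le> L * \<bar>x - y\<bar>"
    using a_lip by (auto simp: lipschitz_on_def dist_real_def)
  obtain A where A: "\<And>x. \<bar>a x\<bar> \<le> A" using a_bounded by blast
  obtain \<sigma> where \<sigma>: "\<sigma> \<in> {-1, 1}" "strong_trace \<sigma> (\<lambda>z. v (\<rho> z)) X (\<lambda>t. v (\<rho> (X t, t)))"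
    using X unfolding vehicle_trajectory_def by blast
  interpret vehicle_flow_borel u_L \<rho> a_L u0_L u0 a v X T \<delta> U U0 w \<sigma> A L V
    by unfold_locales (fact U U0 w L A V \<sigma>)+
  show ?thesis by (rule Eulerian_weak_solution)
qed

theorem theorem3p7:
  fixes u_L \<rho> a_L :: "real \<times> real \<Rightarrow> real"
    and u0_L u0 a v X :: "real \<Rightarrow> real"
    and T :: "real \<times> real \<Rightarrow> real \<times> real"
    and \<delta> :: real
  assumes "Linfty_on (UNIV \<times> {0..}) u_L"
    and "weak_solution (\<lambda>z. 1 / u_L z) (\<lambda>z. - (a_L z * v (u_L z))) (\<lambda>y. 1 / u0_L y)"
    and "AE y in lebesgue. u_L (y, 0) = u0_L y"
    and "\<rho> = u_L \<circ> T"
    and "\<And>t x1 x2. t \<ge> 0 \<Longrightarrow> set_integrable lebesgue {x1..x2} (\<lambda>z. \<rho> (z, t))"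
    and "\<And>x t. t \<ge> 0 \<Longrightarrow> T (x, t) = (LINT z = X t..x | lebesgue. \<rho> (z, t), t)"
    and "vehicle_trajectory a v \<rho> X"
    and "0 < \<delta>"
    and "\<And>x t. t \<ge> 0 \<Longrightarrow> \<delta> \<le> \<rho> (x, t) \<and> \<rho> (x, t) \<le> 1"
    and "\<And>r. 0 < r \<Longrightarrow> r \<le> 1 \<Longrightarrow> v r > 0"
    and "Linfty_on {\<delta><..1} v"
    and "\<exists>L. L-lipschitz_on {\<delta><..1} v"
    and "Linfty_on UNIV a"
    and "\<exists>L. L-lipschitz_on UNIV a"
    and "\<And>x. a x > 0"
    and "\<And>x t. t \<ge> 0 \<Longrightarrow> a_L (T (x, t)) = a x"
    and "\<And>x. u0_L (fst (T (x, 0))) = u0 x"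
  shows "weak_solution (u_L \<circ> T)
           (\<lambda>(x, t). a x * v ((u_L \<circ> T) (x, t)) * (u_L \<circ> T) (x, t)) u0"
proof -
  interpret vehicle_flow u_L \<rho> a_L u0_L u0 a v X T \<delta>
    by (rule vehicle_flow.intro) (fact assms)+
  show ?thesis using weak_solution_\<rho> unfolding \<rho>_def .
qed

end
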